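(* Let $d\ge 1$, let $S\subset\mathbb{Z}^{d}$ be a finitely generated subsemigroup (containing $0$), and let $E=\coprod_{s\in S}E(s)$ be a product system over $S$. Then there exist an infinite dimensional separable complex Hilbert space $\mathcal{H}$ and a semigroup $\alpha=\{\alpha_{x}\}_{x\in S}$ of unital normal $*$-endomorphisms of $B(\mathcal{H})$ (that is, an $E_0^{S}$-semigroup on $B(\mathcal{H})$) such that $E$ is isomorphic to the product system associated to $\alpha$.
   Context: $\mathbb{N}=\{0,1,2,\dots\}$. Finitely generated means $S=\{\sum_{i=1}^{r}m_ie_i : m_i\in\mathbb{N}\}$ for some $e_1,\dots,e_r\in S$; in particular $0\in S$. Inner products are linear in the first variable. A (discrete) product system (of Hilbert spaces) over $S$ is a disjoint union $E=\coprod_{s\in S}E(s)$ such that: (1) each $E(s)$ is a non-zero complex separable Hilbert space; (2) $E$ has an associative multiplication with $xy\in E(s+t)$ for $x\in E(s)$, $y\in E(t)$; (3) for $s,t\in S$ there is a unitary $u_{s,t}:E(s)\otimes E(t)\to E(s+t)$ with $u_{s,t}(x\otimes y)=xy$; (4) $E(0)=\mathbb{C}$ and the multiplications $E(0)\times E(s)\to E(s)$ and $E(s)\times E(0)\to E(s)$ are scalar multiplication. Two product systems $E,F$ over $S$ are isomorphic if there are unitaries $\theta_s:E(s)\to F(s)$ ($s\in S$) with $\theta_{s+t}(xy)=\theta_s(x)\theta_t(y)$ for all $s,t\in S$, $x\in E(s)$, $y\in E(t)$. An $E^{S}$-semigroup on $B(\mathcal{H})$ is a family $\alpha=\{\alpha_s\}_{s\in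 S}$ of non-zero normal $*$-endomorphisms of $B(\mathcal{H})$ with $\alpha_{s+t}=\alpha_s\circ\alpha_t$ for all $s,t \in S$ and $\alpha_0=\mathrm{id}$. It is an $E_0^{S}$-semigroup if moreover $\alpha_s(1)=1$ for all $s\in S$. The product system associated to $\alpha$ has fibres $\{T\in B(\mathcal{H}):\alpha_s(A)T=TA\ \text{for all }A\in B(\mathcal{H})\}$, $s\in S$, where for $R,T$ in the same fibre the inner product $\langle R|T\rangle$ is the scalar $T^{*}R$, and multiplication is operator multiplication, $(s,R)(t,T)=(s+t,RT)$. *)

theory Defs
  imports "HOL-Analysis.Analysis" "HOL-Algebra.Module"
begin

section \<open>Complex Hilbert spaces\<close>

text \<open>The fibres of a product system are a family of different Hilbert spaces, so Hilbert spaces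
  are carrier-based structures: modules over the field of complex numbers in the sense of
  HOL-Algebra, together with an inner product. The fields \<open>mult\<close> and \<open>one\<close> inherited from
  the record \<^typ>\<open>('a, 'b) module\<close> are irrelevant.\<close>

definition complex_ring :: "complex ring" where
  "complex_ring = \<lparr>carrier = UNIV, mult = (*), one = 1, zero = 0, add = (+)\<rparr>"

record 'a hilb = "(complex, 'a) module" +
  hinner :: "'a \<Rightarrow> 'a \<Rightarrow> complex"

definition hnorm :: "'a hilb \<Rightarrow> 'a \<Rightarrow> real" where
  "hnorm H x = sqrt (Re (hinner H x x))"

text \<open>The locale \<open>Metric_space\<close> asks for nonnegativity and symmetry on the whole type, hence the
  value 0 outside the carrier.\<close>

definition hdist :: "'a hilb \<Rightarrow> 'a \<Rightarrow> 'a \<Rightarrow> real" where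
  "hdist H x y = (if x \<in> carrier H \<and> y \<in> carrier H then hnorm H (x \<ominus>\<^bsub>H\<^esub> y) else 0)"

locale inner_product_space = Module.module complex_ring H for H :: "'a hilb" (structure) +
  assumes hinner_add_left:
      "\<lbrakk>x \<in> carrier H; y \<in> carrier H; z \<in> carrier H\<rbrakk> \<Longrightarrow>
        hinner H (x \<oplus> y) z = hinner H x z + hinner H y z"
    and hinner_smult_left:
      "\<lbrakk>x \<in> carrier H; y \<in> carrier H\<rbrakk> \<Longrightarrow> hinner H (c \<odot> x) y = c * hinner H x y"
    and hinner_commute:
      "\<lbrakk>x \<in> carrier H; y \<in> carrier H\<rbrakk> \<Longrightarrow> hinner H y x = cnj (hinner H x y)"
    and hinner_ge_zero: "x \<in> carrier H \<Longrightarrow> 0 \<le> Re (hinner H x x)"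
    and hinner_definite: "\<lbrakk>x \<in> carrier H; hinner H x x = 0\<rbrakk> \<Longrightarrow> x = \<zero>"

context inner_product_space
begin

lemma carrier_complex_ring [simp]: "c \<in> carrier complex_ring"
  by (simp add: complex_ring_def)

lemma smult_minus_one: "x \<in> carrier H \<Longrightarrow> (- 1) \<odot> x = \<ominus> x"
proof -
  assume x: "x \<in> carrier H"
  have "\<ominus>\<^bsub>complex_ring\<^esub> 1 = - 1"
    by (rule R.minus_equality) (auto simp: complex_ring_def)
  moreover have "1 = \<one>\<^bsub>complex_ring\<^esub>"
    by (simp add: complex_ring_def)
  ultimately show ?thesis
    using smult_l_minus[of "1" x] x smult_one[OF x] by simp
qed

lemma hinner_add_right:
  "\<lbrakk>x \<in> carrier H; y \<in> carrier H; z \<in> carrier H\<rbrakk> \<Longrightarrow>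
    hinner H x (y \<oplus> z) = hinner H x y + hinner H x z"
  by (metis M.a_closed complex_cnj_add hinner_add_left hinner_commute)

lemma hinner_smult_right:
  "\<lbrakk>x \<in> carrier H; y \<in> carrier H\<rbrakk> \<Longrightarrow> hinner H x (c \<odot> y) = cnj c * hinner H x y"
  by (metis carrier_complex_ring complex_cnj_mult hinner_commute hinner_smult_left smult_closed)

lemma hinner_minus_left:
  "\<lbrakk>x \<in> carrier H; y \<in> carrier H\<rbrakk> \<Longrightarrow> hinner H (\<ominus> x) y = - hinner H x y"
  using hinner_smult_left[of x y "- 1"] by (simp add: smult_minus_one)

lemma hinner_minus_right:
  "\<lbrakk>x \<in> carrier H; y \<in> carrier H\<rbrakk> \<Longrightarrow> hinner H x (\<ominus> y) = - hinner H x y"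
  using hinner_smult_right[of x y "- 1"] by (simp add: smult_minus_one)

lemma hinner_self: "x \<in> carrier H \<Longrightarrow> hinner H x x = of_real ((hnorm H x)\<^sup>2)"
  using hinner_commute[of x x] hinner_ge_zero[of x]
  by (auto simp: hnorm_def complex_eq_iff)

lemma hinner_zero_left: "y \<in> carrier H \<Longrightarrow> hinner H \<zero> y = 0"
  using hinner_add_left[of \<zero> \<zero> y] by simp

lemma hnorm_nonneg: "x \<in> carrier H \<Longrightarrow> 0 \<le> hnorm H x"
  by (simp add: hnorm_def hinner_ge_zero)

lemma hnorm_zero_iff: "x \<in> carrier H \<Longrightarrow> hnorm H x = 0 \<longleftrightarrow> x = \<zero>"
  using hinner_self[of x] hinner_definite[of x] hinner_zero_left[of \<zero>] by (auto simp: hnorm_def)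

lemma Cauchy_Schwarz:
  assumes x: "x \<in> carrier H" and y: "y \<in> carrier H"
  shows "cmod (hinner H x y) \<le> hnorm H x * hnorm H y"
proof (cases "y = \<zero>")
  case True
  have "hinner H x \<zero> = 0"
    using hinner_commute[OF M.zero_closed x] hinner_zero_left[OF x] by simp
  then show ?thesis using True by (simp add: hnorm_nonneg x)
next
  case False
  define c where "c = hinner H x y"
  define b where "b = (hnorm H y)\<^sup>2"
  have b: "b > 0" using False hnorm_zero_iff[OF y] by (simp add: b_def)
  define z where "z = (of_real b \<odot> x) \<oplus> ((- c) \<odot> y)"
  have zc: "z \<in> carrier H" by (simp add: z_def x y)
  have yx: "hinner H y x = cnj c" using hinner_commute[OF x y] by (simp add: c_def)
  have "hinner H z z = of_real b * (of_real b * of_real ((hnorm H x)\<^sup>2) - c * cnj c)"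
    by (simp add: z_def x y hinner_add_left hinner_add_right hinner_smult_left
        hinner_smult_right hinner_self[OF x] hinner_self[OF y] yx c_def[symmetric] b_def[symmetric] algebra_simps)
  also have "\<dots> = of_real (b * (b * (hnorm H x)\<^sup>2 - (cmod c)\<^sup>2))"
    by (simp add: complex_norm_square[symmetric])
  finally have "0 \<le> b * (b * (hnorm H x)\<^sup>2 - (cmod c)\<^sup>2)"
    using hinner_ge_zero[OF zc] by (simp del: of_real_mult of_real_diff of_real_power)
  then have "(cmod c)\<^sup>2 \<le> (hnorm H x * hnorm H y)\<^sup>2"
    using b by (simp add: zero_le_mult_iff b_def power_mult_distrib mult.commute)
  then show ?thesis
    by (simp add: c_def abs_le_square_iff[symmetric] hnorm_nonneg x y)
qed

lemma hnorm_triangle: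
  assumes x: "x \<in> carrier H" and y: "y \<in> carrier H"
  shows "hnorm H (x \<oplus> y) \<le> hnorm H x + hnorm H y"
proof -
  have "complex_of_real ((hnorm H (x \<oplus> y))\<^sup>2) = hinner H (x \<oplus> y) (x \<oplus> y)"
    by (rule hinner_self[symmetric]) (simp add: x y)
  also have "\<dots> = of_real ((hnorm H x)\<^sup>2) + of_real ((hnorm H y)\<^sup>2)
      + (hinner H x y + cnj (hinner H x y))"
    using hinner_commute[OF x y]
    by (simp add: x y hinner_add_left hinner_add_right hinner_self[OF x] hinner_self[OF y] algebra_simps)
  also have "\<dots> = of_real ((hnorm H x)\<^sup>2 + (hnorm H y)\<^sup>2 + 2 * Re (hinner H x y))"
    by (simp add: complex_add_cnj)
  finally have "(hnorm H (x \<oplus> y))\<^sup>2 = (hnorm H x)\<^sup>2 + (hnorm H y)\<^sup>2 + 2 * Re (hinner H x y)"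
    using of_real_eq_iff by blast
  also have "\<dots> \<le> (hnorm H x + hnorm H y)\<^sup>2"
    using Cauchy_Schwarz[OF x y] complex_Re_le_cmod[of "hinner H x y"]
    by (simp add: power2_sum)
  finally show ?thesis
    by (rule power2_le_imp_le) (simp add: hnorm_nonneg x y)
qed

lemma hnorm_uminus: "x \<in> carrier H \<Longrightarrow> hnorm H (\<ominus> x) = hnorm H x"
  by (simp add: hnorm_def hinner_minus_left hinner_minus_right)

sublocale Metric_space "carrier H" "hdist H"
proof
  fix x y z
  show "0 \<le> hdist H x y" by (simp add: hdist_def hnorm_nonneg)
  show "hdist H x y = hdist H y x"
    using hnorm_uminus[of "x \<ominus> y"]
    by (auto simp: hdist_def a_minus_def M.minus_add M.add.m_comm)
  assume x: "x \<in> carrier H" and y: "y \<in> carrier H"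
  show "hdist H x y = 0 \<longleftrightarrow> x = y"
    using M.minus_equality[of x "\<ominus> y"]
    by (auto simp: hdist_def x y hnorm_zero_iff a_minus_def M.r_neg)
  assume z: "z \<in> carrier H"
  have "(x \<ominus> y) \<oplus> (y \<ominus> z) = x \<ominus> z"
    by (simp add: a_minus_def x y z M.a_assoc M.r_neg1)
  then show "hdist H x z \<le> hdist H x y + hdist H y z"
    using hnorm_triangle[of "x \<ominus> y" "y \<ominus> z"] by (simp add: hdist_def x y z)
qed

end

locale hilbert_space = inner_product_space +
  assumes complete: "Metric_space.mcomplete (carrier H) (hdist H)"

definition separable_hilb :: "'a hilb \<Rightarrow> bool" where
  "separable_hilb H \<longleftrightarrow> separable_space (Metric_space.mtopology (carrier H) (hdist H))"

definition infinite_dimensional :: "'a hilb \<Rightarrow> bool" where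
  "infinite_dimensional H \<longleftrightarrow>
    (\<forall>B. finite B \<and> B \<subseteq> carrier H \<longrightarrow> (\<lambda>V. submodule V complex_ring H) hull B \<noteq> carrier H)"

definition complex_hilb :: "complex hilb" where
  "complex_hilb = \<lparr>carrier = UNIV, mult = (*), one = 1, zero = 0, add = (+), smult = (*),
     hinner = (\<lambda>z w. z * cnj w)\<rparr>"

definition linear_op :: "'a hilb \<Rightarrow> 'b hilb \<Rightarrow> ('a \<Rightarrow> 'b) \<Rightarrow> bool" where
  "linear_op H K T \<longleftrightarrow> T \<in> carrier H \<rightarrow> carrier K \<and>
    (\<forall>x\<in>carrier H. \<forall>y\<in>carrier H. T (x \<oplus>\<^bsub>H\<^esub> y) = T x \<oplus>\<^bsub>K\<^esub> T y) \<and>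
    (\<forall>c. \<forall>x\<in>carrier H. T (c \<odot>\<^bsub>H\<^esub> x) = c \<odot>\<^bsub>K\<^esub> T x)"

definition antilinear_op :: "'a hilb \<Rightarrow> 'b hilb \<Rightarrow> ('a \<Rightarrow> 'b) \<Rightarrow> bool" where
  "antilinear_op H K T \<longleftrightarrow> T \<in> carrier H \<rightarrow> carrier K \<and>
    (\<forall>x\<in>carrier H. \<forall>y\<in>carrier H. T (x \<oplus>\<^bsub>H\<^esub> y) = T x \<oplus>\<^bsub>K\<^esub> T y) \<and>
    (\<forall>c. \<forall>x\<in>carrier H. T (c \<odot>\<^bsub>H\<^esub> x) = cnj c \<odot>\<^bsub>K\<^esub> T x)"

definition bounded_op :: "'a hilb \<Rightarrow> 'b hilb \<Rightarrow> ('a \<Rightarrow> 'b) \<Rightarrow> bool" where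
  "bounded_op H K T \<longleftrightarrow> (\<exists>C. \<forall>x\<in>carrier H. hnorm K (T x) \<le> C * hnorm H x)"

definition unitary_op :: "'a hilb \<Rightarrow> 'b hilb \<Rightarrow> ('a \<Rightarrow> 'b) \<Rightarrow> bool" where
  "unitary_op H K U \<longleftrightarrow> linear_op H K U \<and> bij_betw U (carrier H) (carrier K) \<and>
    (\<forall>x\<in>carrier H. \<forall>y\<in>carrier H. hinner K (U x) (U y) = hinner H x y)"


section \<open>The tensor product of Hilbert spaces\<close>

definition orthonormal_basis :: "'a hilb \<Rightarrow> 'a set \<Rightarrow> bool" where
  "orthonormal_basis H B \<longleftrightarrow> B \<subseteq> carrier H \<and>
    (\<forall>e\<in>B. \<forall>f\<in>B. hinner H e f = (if e = f then 1 else 0)) \<and>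
    (\<forall>x\<in>carrier H. (\<forall>e\<in>B. hinner H x e = 0) \<longrightarrow> x = \<zero>\<^bsub>H\<^esub>)"

definition some_onb :: "'a hilb \<Rightarrow> 'a set" where
  "some_onb H = (SOME B. orthonormal_basis H B)"

text \<open>The Hilbert space tensor product of \<open>H\<close> and \<open>K\<close> in its standard concrete model, the space
  of conjugate-linear Hilbert-Schmidt operators from \<open>K\<close> to \<open>H\<close>, in which the elementary tensor
  of \<open>x\<close> and \<open>y\<close> is the operator sending \<open>z\<close> to \<open>\<langle>y|z\<rangle> x\<close>. The inner product is
  \<open>\<Sum>e. \<langle>A e|B e\<rangle>\<close>, which does not depend on the orthonormal basis over which \<open>e\<close> runs.\<close>

definition hilb_tensor :: "'a hilb \<Rightarrow> 'b hilb \<Rightarrow> ('b \<Rightarrow> 'a) hilb" where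
  "hilb_tensor H K =
    \<lparr>carrier = {A \<in> carrier K \<rightarrow>\<^sub>E carrier H. antilinear_op K H A \<and> bounded_op K H A \<and>
        (\<lambda>e. (hnorm H (A e))\<^sup>2) summable_on some_onb K},
     mult = undefined,
     one = undefined,
     zero = (\<lambda>z\<in>carrier K. \<zero>\<^bsub>H\<^esub>),
     add = (\<lambda>A B. \<lambda>z\<in>carrier K. A z \<oplus>\<^bsub>H\<^esub> B z),
     smult = (\<lambda>c A. \<lambda>z\<in>carrier K. c \<odot>\<^bsub>H\<^esub> A z),
     hinner = (\<lambda>A B. \<Sum>\<^sub>\<infinity>e\<in>some_onb K. hinner H (A e) (B e))\<rparr>"

definition elem_tensor :: "'a hilb \<Rightarrow> 'b hilb \<Rightarrow> 'a \<Rightarrow> 'b \<Rightarrow> 'b \<Rightarrow> 'a" where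
  "elem_tensor H K x y = (\<lambda>z\<in>carrier K. hinner K y z \<odot>\<^bsub>H\<^esub> x)"


section \<open>Product systems\<close>

text \<open>The disjoint union of the fibres is given by the family \<open>E\<close> itself, and \<open>\<mu> s t\<close> is the
  multiplication from \<open>E s\<close> and \<open>E t\<close> to \<open>E (s + t)\<close>. The requirement \<open>E 0 = \<complex>\<close> is expressed by an
  identification \<open>j\<close> of the Hilbert space of complex numbers with \<open>E 0\<close>.\<close>

locale product_system =
  fixes S :: "'i::monoid_add set"
    and E :: "'i \<Rightarrow> 'a hilb"
    and \<mu> :: "'i \<Rightarrow> 'i \<Rightarrow> 'a \<Rightarrow> 'a \<Rightarrow> 'a"
  assumes fibre_hilbert: "s \<in> S \<Longrightarrow> hilbert_space (E s)"
    and fibre_separable: "s \<in> S \<Longrightarrow> separable_hilb (E s)"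
    and fibre_nonzero: "s \<in> S \<Longrightarrow> carrier (E s) \<noteq> {\<zero>\<^bsub>E s\<^esub>}"
    and mult_closed: "\<lbrakk>s \<in> S; t \<in> S; x \<in> carrier (E s); y \<in> carrier (E t)\<rbrakk> \<Longrightarrow>
      \<mu> s t x y \<in> carrier (E (s + t))"
    and mult_assoc: "\<lbrakk>r \<in> S; s \<in> S; t \<in> S;
      x \<in> carrier (E r); y \<in> carrier (E s); z \<in> carrier (E t)\<rbrakk> \<Longrightarrow>
      \<mu> (r + s) t (\<mu> r s x y) z = \<mu> r (s + t) x (\<mu> s t y z)"
    and mult_unitary: "\<lbrakk>s \<in> S; t \<in> S\<rbrakk> \<Longrightarrow>
      \<exists>u. unitary_op (hilb_tensor (E s) (E t)) (E (s + t)) u \<and>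
        (\<forall>x\<in>carrier (E s). \<forall>y\<in>carrier (E t). u (elem_tensor (E s) (E t) x y) = \<mu> s t x y)"
    and zero_fibre: "\<exists>j. unitary_op complex_hilb (E 0) j \<and>
      (\<forall>s\<in>S. \<forall>c. \<forall>x\<in>carrier (E s).
        \<mu> 0 s (j c) x = c \<odot>\<^bsub>E s\<^esub> x \<and> \<mu> s 0 x (j c) = c \<odot>\<^bsub>E s\<^esub> x)"

definition ps_isomorphic :: "'i::monoid_add set \<Rightarrow>
    ('i \<Rightarrow> 'a hilb) \<Rightarrow> ('i \<Rightarrow> 'i \<Rightarrow> 'a \<Rightarrow> 'a \<Rightarrow> 'a) \<Rightarrow>
    ('i \<Rightarrow> 'b hilb) \<Rightarrow> ('i \<Rightarrow> 'i \<Rightarrow> 'b \<Rightarrow> 'b \<Rightarrow> 'b) \<Rightarrow> bool" where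
  "ps_isomorphic S E \<mu> F \<nu> \<longleftrightarrow>
    (\<exists>\<theta>. (\<forall>s\<in>S. unitary_op (E s) (F s) (\<theta> s)) \<and>
      (\<forall>s\<in>S. \<forall>t\<in>S. \<forall>x\<in>carrier (E s). \<forall>y\<in>carrier (E t).
        \<theta> (s + t) (\<mu> s t x y) = \<nu> s t (\<theta> s x) (\<theta> t y)))"


section \<open>Normal endomorphisms of B(H)\<close>

text \<open>Bounded operators are extensional functions, so that equality of operators is equality of
  functions; the product of \<open>R\<close> and \<open>T\<close> is \<open>compose (carrier H) R T\<close>.\<close>

definition bop :: "'h hilb \<Rightarrow> ('h \<Rightarrow> 'h) set" where
  "bop H = {T \<in> carrier H \<rightarrow>\<^sub>E carrier H. linear_op H H T \<and> bounded_op H H T}"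

definition op_id :: "'h hilb \<Rightarrow> 'h \<Rightarrow> 'h" where
  "op_id H = (\<lambda>x\<in>carrier H. x)"

definition op_zero :: "'h hilb \<Rightarrow> 'h \<Rightarrow> 'h" where
  "op_zero H = (\<lambda>x\<in>carrier H. \<zero>\<^bsub>H\<^esub>)"

definition op_add :: "'h hilb \<Rightarrow> ('h \<Rightarrow> 'h) \<Rightarrow> ('h \<Rightarrow> 'h) \<Rightarrow> 'h \<Rightarrow> 'h" where
  "op_add H R T = (\<lambda>x\<in>carrier H. R x \<oplus>\<^bsub>H\<^esub> T x)"

definition op_smult :: "'h hilb \<Rightarrow> complex \<Rightarrow> ('h \<Rightarrow> 'h) \<Rightarrow> 'h \<Rightarrow> 'h" where
  "op_smult H c T = (\<lambda>x\<in>carrier H. c \<odot>\<^bsub>H\<^esub> T x)"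

definition op_adj :: "'h hilb \<Rightarrow> ('h \<Rightarrow> 'h) \<Rightarrow> 'h \<Rightarrow> 'h" where
  "op_adj H T = (THE R. R \<in> bop H \<and>
    (\<forall>x\<in>carrier H. \<forall>y\<in>carrier H. hinner H (T x) y = hinner H x (R y)))"

text \<open>Normality is continuity for the ultraweak (\<open>\<sigma>\<close>-weak) topology, the initial topology of the
  functionals \<open>A \<mapsto> \<Sum>n. \<langle>A x\<^sub>n|y\<^sub>n\<rangle>\<close> with \<open>x\<close> and \<open>y\<close> square summable.\<close>

definition ultraweak_functionals :: "'h hilb \<Rightarrow> (('h \<Rightarrow> 'h) \<Rightarrow> complex) set" where
  "ultraweak_functionals H = {\<lambda>A. \<Sum>n. hinner H (A (x n)) (y n) | x y :: nat \<Rightarrow> 'h.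
     range x \<subseteq> carrier H \<and> range y \<subseteq> carrier H \<and>
     summable (\<lambda>n. (hnorm H (x n))\<^sup>2) \<and> summable (\<lambda>n. (hnorm H (y n))\<^sup>2)}"

definition ultraweak_topology :: "'h hilb \<Rightarrow> ('h \<Rightarrow> 'h) topology" where
  "ultraweak_topology H = topology_generated_by
     {{A \<in> bop H. \<omega> A \<in> U} | \<omega> U. \<omega> \<in> ultraweak_functionals H \<and> open U}"

definition star_endomorphism :: "'h hilb \<Rightarrow> (('h \<Rightarrow> 'h) \<Rightarrow> 'h \<Rightarrow> 'h) \<Rightarrow> bool" where
  "star_endomorphism H \<phi> \<longleftrightarrow> \<phi> \<in> bop H \<rightarrow> bop H \<and>
    (\<forall>A\<in>bop H. \<forall>B\<in>bop H. \<phi> (op_add H A B) = op_add H (\<phi> A) (\<phi> B)) \<and>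
    (\<forall>c. \<forall>A\<in>bop H. \<phi> (op_smult H c A) = op_smult H c (\<phi> A)) \<and>
    (\<forall>A\<in>bop H. \<forall>B\<in>bop H.
      \<phi> (compose (carrier H) A B) = compose (carrier H) (\<phi> A) (\<phi> B)) \<and>
    (\<forall>A\<in>bop H. \<phi> (op_adj H A) = op_adj H (\<phi> A))"

definition normal_map :: "'h hilb \<Rightarrow> (('h \<Rightarrow> 'h) \<Rightarrow> 'h \<Rightarrow> 'h) \<Rightarrow> bool" where
  "normal_map H \<phi> \<longleftrightarrow> continuous_map (ultraweak_topology H) (ultraweak_topology H) \<phi>"

definition E_semigroup ::
    "'i::monoid_add set \<Rightarrow> 'h hilb \<Rightarrow> ('i \<Rightarrow> ('h \<Rightarrow> 'h) \<Rightarrow> 'h \<Rightarrow> 'h) \<Rightarrow> bool" where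
  "E_semigroup S H \<alpha> \<longleftrightarrow>
    (\<forall>s\<in>S. star_endomorphism H (\<alpha> s) \<and> normal_map H (\<alpha> s) \<and>
      (\<exists>A\<in>bop H. \<alpha> s A \<noteq> op_zero H)) \<and>
    (\<forall>s\<in>S. \<forall>t\<in>S. \<forall>A\<in>bop H. \<alpha> (s + t) A = \<alpha> s (\<alpha> t A)) \<and>
    (\<forall>A\<in>bop H. \<alpha> 0 A = A)"

definition E0_semigroup ::
    "'i::monoid_add set \<Rightarrow> 'h hilb \<Rightarrow> ('i \<Rightarrow> ('h \<Rightarrow> 'h) \<Rightarrow> 'h \<Rightarrow> 'h) \<Rightarrow> bool" where
  "E0_semigroup S H \<alpha> \<longleftrightarrow> E_semigroup S H \<alpha> \<and> (\<forall>s\<in>S. \<alpha> s (op_id H) = op_id H)"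

definition assoc_fibre ::
    "'h hilb \<Rightarrow> ('i \<Rightarrow> ('h \<Rightarrow> 'h) \<Rightarrow> 'h \<Rightarrow> 'h) \<Rightarrow> 'i \<Rightarrow> ('h \<Rightarrow> 'h) hilb" where
  "assoc_fibre H \<alpha> s =
    \<lparr>carrier = {T \<in> bop H. \<forall>A\<in>bop H.
        compose (carrier H) (\<alpha> s A) T = compose (carrier H) T A},
     mult = undefined,
     one = undefined,
     zero = op_zero H,
     add = op_add H,
     smult = op_smult H,
     hinner = (\<lambda>R T. THE c. compose (carrier H) (op_adj H T) R = op_smult H c (op_id H))\<rparr>"

definition assoc_mult ::
    "'h hilb \<Rightarrow> 'i \<Rightarrow> 'i \<Rightarrow> ('h \<Rightarrow> 'h) \<Rightarrow> ('h \<Rightarrow> 'h) \<Rightarrow> 'h \<Rightarrow> 'h" where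
  "assoc_mult H s t R T = compose (carrier H) R T"


section \<open>Finitely generated subsemigroups\<close>

definition finitely_generated :: "(int^'d) set \<Rightarrow> bool" where
  "finitely_generated S \<longleftrightarrow> (\<exists>(r::nat) e. (\<forall>i\<in>{1..r}. e i \<in> S) \<and>
    S = {\<Sum>i=1..r. int (m i) *s e i | m. True})"

lemma finitely_generated_zero: "finitely_generated S \<Longrightarrow> 0 \<in> S"
proof -
  assume "finitely_generated S"
  then obtain r :: nat and e where S: "S = {\<Sum>i=1..r. int (m i) *s e i | m. True}"
    unfolding finitely_generated_def by auto
  have "(\<Sum>i=1..r. int ((\<lambda>_. 0) i) *s e i) = 0" by simp
  then show ?thesis unfolding S mem_Collect_eq by (intro exI[of _ "\<lambda>_. 0"]) simp
qed

lemma finitely_generated_add: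
  "finitely_generated S \<Longrightarrow> a \<in> S \<Longrightarrow> b \<in> S \<Longrightarrow> a + b \<in> S"
proof -
  assume "finitely_generated S" and ab: "a \<in> S" "b \<in> S"
  then obtain r :: nat and e where S: "S = {\<Sum>i=1..r. int (m i) *s e i | m. True}"
    unfolding finitely_generated_def by auto
  from ab obtain m n where "a = (\<Sum>i=1..r. int (m i) *s e i)" "b = (\<Sum>i=1..r. int (n i) *s e i)"
    unfolding S by auto
  then have "a + b = (\<Sum>i=1..r. int (m i + n i) *s e i)"
    by (simp add: sum.distrib vector_sadd_rdistrib)
  then show ?thesis unfolding S mem_Collect_eq by (intro exI[of _ "\<lambda>i. m i + n i"]) simp
qed

end

(* Let a be the sum of the generators and u a unit vector of E(a). Right multiplication by u embeds
   E(s) isometrically in E(s + a) and commutes with all left multiplications, so for each t the fibres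
   E(t + na), which exist for large n because a absorbs every element of S, have an inductive limit
   H(t), and left multiplication gives unitaries from E(s) tensor H(t) onto H(s + t). Hence the direct
   sum H of the H(t), with infinite multiplicity, carries an essential representation phi of E, and
   alpha_s(A) = sum over b of phi(b) A phi(b)*, with b running over an orthonormal basis of E(s), is
   the required semigroup.

   H is realised directly as l2: the limit is encoded by its Gram kernel on the vectors of the fibres,
   and the vectors of level n that are orthogonal to all lower levels (as in a Wold decomposition)
   provide an orthonormal basis along which the kernel is expanded into coordinates. *)

theory Submission
  imports Defs
begin

text \<open>Left multiplication by E(r) is onto because a vector of E(s) lifted N levels lies in E(s
  + Na) = E(r + t) with t = Na - r + s, and t is in S once Na - r is; there the products from E(r)
  and E(t) are total. This surjectivity is exactly what turns \<alpha>_s(1), a priori only the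
  projection onto the span of the ranges of the \<open>\<phi> s x\<close>, into 1. The multiplicity
  is there because the H(t) may add up to a finite-dimensional space, as for S = {0}. A limit formed
  as a quotient followed by a completion would not live in a type fixed in advance. The Gram kernel
  avoids both: vectors with a Parseval expansion along a countable orthonormal family embed in l2,
  and linear relations hold there automatically. Parseval itself is checked inside a single fibre,
  since two vectors over the same t can be raised to a common level. Infinite sums of operators are
  understood weakly, through matrix coefficients. Most algebraic properties of \<alpha> are read off
  \<alpha>_s(A) \<phi>(x) = \<phi>(x) A, which determines \<alpha>_s(A) because the vectors
  \<phi>(x)h are total.\<close>

section \<open>Orthonormal families and bounded operators\<close>

text \<open>The finite Cauchy-Schwarz inequality bounds all partial sums of the moduli by one
  constant. Domination of \<open>f\<close> by a product, instead of equality, also covers terms such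
  as \<open>hinner H (A x) y\<close> with a bounded operator \<open>A\<close>.\<close>

lemma l2_Cauchy_Schwarz:
  fixes f :: "'i \<Rightarrow> complex" and a b :: "'i \<Rightarrow> real"
  assumes a: "(\<lambda>i. (a i)\<^sup>2) summable_on I" and b: "(\<lambda>i. (b i)\<^sup>2) summable_on I"
    and le: "\<And>i. i \<in> I \<Longrightarrow> cmod (f i) \<le> a i * b i"
  shows "(\<lambda>i. cmod (f i)) summable_on I" and "f summable_on I"
    and "cmod (\<Sum>\<^sub>\<infinity>i\<in>I. f i) \<le> sqrt (\<Sum>\<^sub>\<infinity>i\<in>I. (a i)\<^sup>2) * sqrt (\<Sum>\<^sub>\<infinity>i\<in>I. (b i)\<^sup>2)"
proof -
  let ?C = "sqrt (\<Sum>\<^sub>\<infinity>i\<in>I. (a i)\<^sup>2) * sqrt (\<Sum>\<^sub>\<infinity>i\<in>I. (b i)\<^sup>2)"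
  have bound: "(\<Sum>i\<in>F. cmod (f i)) \<le> ?C" if F: "finite F" "F \<subseteq> I" for F
  proof -
    have "(\<Sum>i\<in>F. cmod (f i)) \<le> (\<Sum>i\<in>F. \<bar>a i\<bar> * \<bar>b i\<bar>)"
      using le F by (intro sum_mono) (metis abs_ge_self abs_mult order_trans subsetD)
    also have "\<dots> \<le> L2_set a F * L2_set b F" by (rule L2_set_mult_ineq)
    also have "\<dots> \<le> ?C"
      unfolding L2_set_def using F a b
      by (intro mult_mono real_sqrt_le_mono finite_sum_le_infsum)
        (auto intro: real_sqrt_ge_zero sum_nonneg infsum_nonneg)
    finally show ?thesis .
  qed
  show s: "(\<lambda>i. cmod (f i)) summable_on I"
    by (rule nonneg_bdd_above_summable_on) (use bound in \<open>auto intro!: bdd_aboveI[of _ ?C]\<close>)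
  then show "f summable_on I" by (rule abs_summable_summable)
  have "(\<Sum>\<^sub>\<infinity>i\<in>I. cmod (f i)) \<le> ?C" by (rule infsum_le_finite_sums[OF s bound])
  then show "cmod (\<Sum>\<^sub>\<infinity>i\<in>I. f i) \<le> ?C" using norm_infsum_bound[OF s] by linarith
qed

definition orthonormal :: "'a hilb \<Rightarrow> ('i \<Rightarrow> 'a) \<Rightarrow> 'i set \<Rightarrow> bool" where
  "orthonormal H e I \<longleftrightarrow> e \<in> I \<rightarrow> carrier H \<and>
    (\<forall>i\<in>I. \<forall>j\<in>I. hinner H (e i) (e j) = (if i = j then 1 else 0))"

text \<open>In a Hilbert space this means that the linear span of \<open>V\<close> is dense; stated
  through orthogonality, it is used without closures or approximation.\<close>

definition total_in :: "'a hilb \<Rightarrow> 'a set \<Rightarrow> bool" where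
  "total_in H V \<longleftrightarrow> V \<subseteq> carrier H \<and>
    (\<forall>x\<in>carrier H. (\<forall>v\<in>V. hinner H x v = 0) \<longrightarrow> x = \<zero>\<^bsub>H\<^esub>)"

text \<open>Bases are indexed families rather than sets because the important ones are images:
  \<open>\<phi> s b i\<close> over pairs \<open>(b, i)\<close>, lifted fibre vectors, and
  \<open>coords\<close> over \<open>basis_points\<close>.\<close>

definition onb_family :: "'a hilb \<Rightarrow> ('i \<Rightarrow> 'a) \<Rightarrow> 'i set \<Rightarrow> bool" where
  "onb_family H e I \<longleftrightarrow> orthonormal H e I \<and> total_in H (e ` I)"

definition bounded_functional :: "'a hilb \<Rightarrow> ('a \<Rightarrow> complex) \<Rightarrow> bool" where
  "bounded_functional H f \<longleftrightarrow>
    (\<forall>x\<in>carrier H. \<forall>y\<in>carrier H. f (x \<oplus>\<^bsub>H\<^esub> y) = f x + f y) \<and>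
    (\<forall>c. \<forall>x\<in>carrier H. f (c \<odot>\<^bsub>H\<^esub> x) = c * f x) \<and>
    (\<exists>C. \<forall>x\<in>carrier H. cmod (f x) \<le> C * hnorm H x)"

lemma orthonormal_basis_iff_family:
  "orthonormal_basis H B \<longleftrightarrow> onb_family H (\<lambda>b. b) B"
  by (auto simp: orthonormal_basis_def onb_family_def orthonormal_def
      total_in_def)

definition sesquilinear_form :: "'a hilb \<Rightarrow> ('a \<Rightarrow> 'a \<Rightarrow> complex) \<Rightarrow> bool" where
  "sesquilinear_form H q \<longleftrightarrow>
    (\<forall>x\<in>carrier H. \<forall>y\<in>carrier H. \<forall>z\<in>carrier H.
      q (x \<oplus>\<^bsub>H\<^esub> y) z = q x z + q y z \<and> q z (x \<oplus>\<^bsub>H\<^esub> y) = q z x + q z y) \<and>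
    (\<forall>c. \<forall>x\<in>carrier H. \<forall>y\<in>carrier H.
      q (c \<odot>\<^bsub>H\<^esub> x) y = c * q x y \<and> q x (c \<odot>\<^bsub>H\<^esub> y) = cnj c * q x y)"

section \<open>Geometry without completeness: Bessel's inequality, maximal orthonormal sets,
  countability\<close>

context inner_product_space
begin

lemma hinner_zero_right: "x \<in> carrier H \<Longrightarrow> hinner H x \<zero> = 0"
  using hinner_commute[of \<zero> x] hinner_zero_left by simp

lemma hinner_diff_left:
  "\<lbrakk>x \<in> carrier H; y \<in> carrier H; z \<in> carrier H\<rbrakk> \<Longrightarrow>
    hinner H (x \<ominus> y) z = hinner H x z - hinner H y z"
  by (simp add: a_minus_def hinner_add_left hinner_minus_left)

lemma hinner_diff_right:
  "\<lbrakk>x \<in> carrier H; y \<in> carrier H; z \<in> carrier H\<rbrakk> \<Longrightarrow>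
    hinner H x (y \<ominus> z) = hinner H x y - hinner H x z"
  by (simp add: a_minus_def hinner_add_right hinner_minus_right)

lemma diff_eq_zero_iff:
  "\<lbrakk>x \<in> carrier H; y \<in> carrier H\<rbrakk> \<Longrightarrow> x \<ominus> y = \<zero> \<longleftrightarrow> x = y"
  using M.minus_equality[of x "\<ominus> y"] by (auto simp: a_minus_def M.r_neg)

text \<open>Take \<open>z = x \<ominus> y\<close>. Many module identities below are proved this way,
  because testing against vectors turns them into identities of complex numbers.\<close>

lemma hinner_ext:
  assumes x: "x \<in> carrier H" and y: "y \<in> carrier H"
    and eq: "\<And>z. z \<in> carrier H \<Longrightarrow> hinner H x z = hinner H y z"
  shows "x = y"
proof -
  have "hinner H (x \<ominus> y) (x \<ominus> y) = 0"
    using x y eq[of "x \<ominus> y"] by (simp add: hinner_diff_left)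
  then show ?thesis
    using hinner_definite[of "x \<ominus> y"] diff_eq_zero_iff x y by simp
qed

lemma hinner_ext_total:
  assumes "total_in H V" and x: "x \<in> carrier H" and y: "y \<in> carrier H"
    and eq: "\<And>v. v \<in> V \<Longrightarrow> hinner H x v = hinner H y v"
  shows "x = y"
proof -
  have "\<forall>v\<in>V. hinner H (x \<ominus> y) v = 0"
    using assms by (auto simp: total_in_def hinner_diff_left)
  then have "x \<ominus> y = \<zero>"
    using assms by (auto simp: total_in_def)
  then show ?thesis using x y diff_eq_zero_iff by simp
qed

lemma hnorm_sq: "x \<in> carrier H \<Longrightarrow> (hnorm H x)\<^sup>2 = Re (hinner H x x)"
  by (simp add: hnorm_def hinner_ge_zero)

lemma hnorm_smult: "x \<in> carrier H \<Longrightarrow> hnorm H (c \<odot> x) = cmod c * hnorm H x"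
proof -
  assume x: "x \<in> carrier H"
  have "hinner H (c \<odot> x) (c \<odot> x) = of_real ((cmod c * hnorm H x)\<^sup>2)"
    using x by (simp add: hinner_smult_left hinner_smult_right hinner_self[OF x] power_mult_distrib
        complex_norm_square mult_ac del: of_real_power)
  then have "(hnorm H (c \<odot> x))\<^sup>2 = (cmod c * hnorm H x)\<^sup>2"
    using x hnorm_sq[of "c \<odot> x"] by (simp del: of_real_mult of_real_power)
  then show ?thesis
    by (rule power2_eq_imp_eq) (use x in \<open>simp_all add: hnorm_nonneg\<close>)
qed

lemma hnorm_diff_le:
  assumes "x \<in> carrier H" "y \<in> carrier H" "z \<in> carrier H"
  shows "hnorm H (x \<ominus> z) \<le> hnorm H (x \<ominus> y) + hnorm H (y \<ominus> z)"
  using triangle[of x y z] assms by (simp add: hdist_def)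

lemma hinner_finsum_left:
  assumes "finite F" "f \<in> F \<rightarrow> carrier H" and y: "y \<in> carrier H"
  shows "hinner H (finsum H f F) y = (\<Sum>i\<in>F. hinner H (f i) y)"
  using assms(1,2)
proof (induction F rule: finite_induct)
  case empty
  then show ?case by (simp add: M.finsum_empty hinner_zero_left y)
next
  case (insert i F)
  then show ?case
    by (simp add: M.finsum_insert Pi_iff hinner_add_left M.finsum_closed y)
qed

lemma hinner_finsum_right:
  assumes "finite F" "f \<in> F \<rightarrow> carrier H" and y: "y \<in> carrier H"
  shows "hinner H y (finsum H f F) = (\<Sum>i\<in>F. hinner H y (f i))"
proof -
  have "hinner H y (finsum H f F) = cnj (hinner H (finsum H f F) y)"
    by (rule hinner_commute) (use assms in \<open>auto intro: M.finsum_closed\<close>)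
  also have "\<dots> = (\<Sum>i\<in>F. hinner H y (f i))"
    using assms by (auto simp: hinner_finsum_left hinner_commute[symmetric] Pi_iff intro!: sum.cong)
  finally show ?thesis .
qed

lemma functional_finsum:
  assumes f: "bounded_functional H f" and "finite F" "g \<in> F \<rightarrow> carrier H"
  shows "f (finsum H g F) = (\<Sum>i\<in>F. f (g i))"
  using assms(2,3)
proof (induction F rule: finite_induct)
  case empty
  have "f (0 \<odot> \<zero>) = 0 * f \<zero>"
    using f unfolding bounded_functional_def by blast
  moreover have "0 \<odot> \<zero> = \<zero>" by (rule smult_r_null) simp
  ultimately show ?case by (simp add: M.finsum_empty)
next
  case (insert i F)
  then show ?case
    using f by (simp add: M.finsum_insert Pi_iff bounded_functional_def M.finsum_closed)
qed

lemma functional_bound: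
  assumes "bounded_functional H f"
  obtains C where "C \<ge> 0" "\<And>x. x \<in> carrier H \<Longrightarrow> cmod (f x) \<le> C * hnorm H x"
proof -
  obtain C where C: "\<And>x. x \<in> carrier H \<Longrightarrow> cmod (f x) \<le> C * hnorm H x"
    using assms unfolding bounded_functional_def by blast
  show ?thesis
  proof (rule that[of "\<bar>C\<bar>"])
    fix x assume x: "x \<in> carrier H"
    show "cmod (f x) \<le> \<bar>C\<bar> * hnorm H x"
      using C[OF x] mult_right_mono[of C "\<bar>C\<bar>" "hnorm H x"] hnorm_nonneg[OF x] by linarith
  qed simp
qed

lemma bounded_functional_hinner: "y \<in> carrier H \<Longrightarrow> bounded_functional H (\<lambda>x. hinner H x y)"
  unfolding bounded_functional_def
  by (auto simp: hinner_add_left hinner_smult_left intro!: exI[of _ "hnorm H y"])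
    (metis Cauchy_Schwarz mult.commute)

lemma orthonormal_closed: "orthonormal H e I \<Longrightarrow> i \<in> I \<Longrightarrow> e i \<in> carrier H"
  by (auto simp: orthonormal_def)

lemma orthonormal_hinner:
  "orthonormal H e I \<Longrightarrow> i \<in> I \<Longrightarrow> j \<in> I \<Longrightarrow> hinner H (e i) (e j) = (if i = j then 1 else 0)"
  by (auto simp: orthonormal_def)

lemma finite_combination_hinner:
  assumes e: "orthonormal H e I" and F: "finite F" "F \<subseteq> I" and j: "j \<in> I"
  shows "hinner H (\<Oplus>i\<in>F. c i \<odot> e i) (e j) = (if j \<in> F then c j else 0)"
proof -
  note ec = orthonormal_closed[OF e]
  have "hinner H (\<Oplus>i\<in>F. c i \<odot> e i) (e j) = (\<Sum>i\<in>F. hinner H (c i \<odot> e i) (e j))"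
    by (rule hinner_finsum_left) (use F ec j in auto)
  also have "\<dots> = (\<Sum>i\<in>F. if i = j then c j else 0)"
    by (rule sum.cong)
      (use F ec j in \<open>auto simp: hinner_smult_left orthonormal_hinner[OF e] subset_iff\<close>)
  finally show ?thesis using F by (simp add: sum.delta)
qed

lemma finite_combination_closed:
  "orthonormal H e I \<Longrightarrow> F \<subseteq> I \<Longrightarrow> (\<Oplus>i\<in>F. c i \<odot> e i) \<in> carrier H"
  by (rule M.finsum_closed) (auto intro!: smult_closed dest: orthonormal_closed)

lemma finite_combination_hinner_right:
  assumes e: "orthonormal H e I" and F: "finite F" "F \<subseteq> I" and x: "x \<in> carrier H"
  shows "hinner H x (\<Oplus>i\<in>F. c i \<odot> e i) = (\<Sum>i\<in>F. cnj (c i) * hinner H x (e i))"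
proof -
  note ec = orthonormal_closed[OF e]
  have "hinner H x (\<Oplus>i\<in>F. c i \<odot> e i) = (\<Sum>i\<in>F. hinner H x (c i \<odot> e i))"
    by (rule hinner_finsum_right) (use F ec x in auto)
  also have "\<dots> = (\<Sum>i\<in>F. cnj (c i) * hinner H x (e i))"
    by (rule sum.cong) (use F ec x in \<open>auto simp: hinner_smult_right subset_iff\<close>)
  finally show ?thesis .
qed

lemma finite_combination_norm:
  assumes e: "orthonormal H e I" and F: "finite F" "F \<subseteq> I"
  shows "(hnorm H (\<Oplus>i\<in>F. c i \<odot> e i))\<^sup>2 = (\<Sum>i\<in>F. (cmod (c i))\<^sup>2)"
proof -
  let ?s = "\<Oplus>i\<in>F. c i \<odot> e i"
  have s: "?s \<in> carrier H" using e F by (simp add: finite_combination_closed)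
  have "hinner H ?s ?s = (\<Sum>i\<in>F. cnj (c i) * hinner H ?s (e i))"
    by (rule finite_combination_hinner_right[OF e F s])
  also have "\<dots> = (\<Sum>i\<in>F. of_real ((cmod (c i))\<^sup>2))"
    by (rule sum.cong) (use F in \<open>auto simp: finite_combination_hinner[OF e F] subset_iff complex_norm_square mult.commute simp del: of_real_power\<close>)
  finally show ?thesis using hnorm_sq[OF s] by (simp flip: of_real_sum)
qed

text \<open>Pythagoras: the finite expansion is the orthogonal projection of \<open>x\<close>.
  Nonnegativity of the left side is Bessel's inequality, and its convergence to 0 is what makes
  expansions of functionals converge.\<close>

lemma finite_combination_diff_norm:
  assumes e: "orthonormal H e I" and F: "finite F" "F \<subseteq> I" and x: "x \<in> carrier H"
  shows "(hnorm H (x \<ominus> (\<Oplus>i\<in>F. hinner H x (e i) \<odot> e i)))\<^sup>2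
    = (hnorm H x)\<^sup>2 - (\<Sum>i\<in>F. (cmod (hinner H x (e i)))\<^sup>2)"
proof -
  let ?s = "\<Oplus>i\<in>F. hinner H x (e i) \<odot> e i"
  have s: "?s \<in> carrier H" using e F by (simp add: finite_combination_closed)
  have xs: "hinner H x ?s = of_real (\<Sum>i\<in>F. (cmod (hinner H x (e i)))\<^sup>2)"
    unfolding finite_combination_hinner_right[OF e F x] of_real_sum
    by (rule sum.cong) (simp_all add: complex_norm_square mult.commute del: of_real_power)
  have sx: "hinner H ?s x = of_real (\<Sum>i\<in>F. (cmod (hinner H x (e i)))\<^sup>2)"
    using hinner_commute[OF x s] xs by simp
  have ss: "hinner H ?s ?s = of_real (\<Sum>i\<in>F. (cmod (hinner H x (e i)))\<^sup>2)"
    using hinner_self[OF s] finite_combination_norm[OF e F] by simp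
  have "hinner H (x \<ominus> ?s) (x \<ominus> ?s) = hinner H x x - of_real (\<Sum>i\<in>F. (cmod (hinner H x (e i)))\<^sup>2)"
    using x s by (simp add: hinner_diff_left hinner_diff_right xs sx ss)
  then show ?thesis
    using x s by (simp add: hnorm_sq)
qed

lemma Bessel_finite:
  assumes e: "orthonormal H e I" and F: "finite F" "F \<subseteq> I" and x: "x \<in> carrier H"
  shows "(\<Sum>i\<in>F. (cmod (hinner H x (e i)))\<^sup>2) \<le> (hnorm H x)\<^sup>2"
  using finite_combination_diff_norm[OF assms] zero_le_power2[of "hnorm H (x \<ominus> (\<Oplus>i\<in>F. hinner H x (e i) \<odot> e i))"]
  by linarith

lemma Bessel:
  assumes e: "orthonormal H e I" and x: "x \<in> carrier H"
  shows "(\<lambda>i. (cmod (hinner H x (e i)))\<^sup>2) summable_on I"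
    and "(\<Sum>\<^sub>\<infinity>i\<in>I. (cmod (hinner H x (e i)))\<^sup>2) \<le> (hnorm H x)\<^sup>2"
proof -
  show s: "(\<lambda>i. (cmod (hinner H x (e i)))\<^sup>2) summable_on I"
    by (rule nonneg_bdd_above_summable_on)
      (use Bessel_finite[OF e _ _ x] in \<open>auto intro!: bdd_aboveI[of _ "(hnorm H x)\<^sup>2"]\<close>)
  show "(\<Sum>\<^sub>\<infinity>i\<in>I. (cmod (hinner H x (e i)))\<^sup>2) \<le> (hnorm H x)\<^sup>2"
    by (rule infsum_le_finite_sums[OF s]) (rule Bessel_finite[OF e _ _ x])
qed

text \<open>Zorn's lemma: a non-zero \<open>x\<close> orthogonal to a maximal \<open>B\<close> could
  be normalised inside \<open>W\<close> and adjoined. \<open>W\<close> is the whole space for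
  orthonormal bases, and the part of a fibre orthogonal to the lower levels for
  \<open>innovation_basis\<close>.\<close>

lemma maximal_orthonormal_subset:
  assumes W: "W \<subseteq> carrier H" and scale: "\<And>c x. x \<in> W \<Longrightarrow> c \<odot> x \<in> W"
  obtains B where "B \<subseteq> W" "orthonormal H (\<lambda>b. b) B"
    "\<And>x. x \<in> W \<Longrightarrow> (\<And>b. b \<in> B \<Longrightarrow> hinner H x b = 0) \<Longrightarrow> x = \<zero>"
proof -
  let ?A = "{B. B \<subseteq> W \<and> orthonormal H (\<lambda>b. b) B}"
  have "\<exists>M\<in>?A. \<forall>B\<in>?A. M \<subseteq> B \<longrightarrow> B = M"
  proof (rule subset_Zorn')
    fix C assume C: "subset.chain ?A C"
    have "\<exists>B\<in>C. b \<in> B \<and> b' \<in> B" if "b \<in> \<Union>C" "b' \<in> \<Union>C" for b b'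
      using that C unfolding subset.chain_def by blast
    moreover have "C \<subseteq> ?A" using C by (auto simp: subset.chain_def)
    ultimately show "\<Union>C \<in> ?A"
      unfolding orthonormal_def by blast
  qed
  then obtain B where BW: "B \<subseteq> W" and B: "orthonormal H (\<lambda>b. b) B"
    and max: "\<And>B'. B' \<subseteq> W \<Longrightarrow> orthonormal H (\<lambda>b. b) B' \<Longrightarrow> B \<subseteq> B' \<Longrightarrow> B' = B"
    by auto
  show ?thesis
  proof (rule that[OF BW B])
    fix x assume x: "x \<in> W" and orth: "\<And>b. b \<in> B \<Longrightarrow> hinner H x b = 0"
    have xc: "x \<in> carrier H" using x W by auto
    show "x = \<zero>"
    proof (rule ccontr)
      assume "x \<noteq> \<zero>"
      then have n: "hnorm H x \<noteq> 0" using hnorm_zero_iff[OF xc] by simp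
      define y where "y = of_real (inverse (hnorm H x)) \<odot> x"
      have y: "y \<in> W" "y \<in> carrier H" using x xc scale by (auto simp: y_def)
      have yy: "hinner H y y = 1"
        using n xc by (simp add: y_def hinner_smult_left hinner_smult_right hinner_self[OF xc] power2_eq_square field_simps)
      have yb: "hinner H y b = 0" "hinner H b y = 0" if "b \<in> B" for b
      proof -
        have b: "b \<in> carrier H" using that BW W by auto
        show "hinner H y b = 0" using orth[OF that] xc b by (simp add: y_def hinner_smult_left)
        then show "hinner H b y = 0" using hinner_commute[OF y(2) b] by simp
      qed
      have "orthonormal H (\<lambda>b. b) (insert y B)"
        using B yy yb y(2) unfolding orthonormal_def by auto
      then have "insert y B = B" using max[of "insert y B"] y BW by auto
      then show False using yb(1)[of y] yy by auto
    qed
  qed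
qed

lemma orthonormal_basis_exists: "\<exists>B. orthonormal_basis H B"
proof -
  obtain B where "B \<subseteq> carrier H" "orthonormal H (\<lambda>b. b) B"
    "\<And>x. x \<in> carrier H \<Longrightarrow> (\<And>b. b \<in> B \<Longrightarrow> hinner H x b = 0) \<Longrightarrow> x = \<zero>"
    using maximal_orthonormal_subset[of "carrier H"] by auto
  then have "orthonormal_basis H B"
    by (auto simp: orthonormal_basis_def orthonormal_def)
  then show ?thesis ..
qed

lemma some_onb: "onb_family H (\<lambda>b. b) (some_onb H)"
  unfolding some_onb_def orthonormal_basis_iff_family[symmetric]
  by (rule someI_ex[OF orthonormal_basis_exists])

text \<open>Distinct orthonormal vectors are at distance sqrt 2, so points of a countable dense set
  chosen within 1/2 of them are distinct.\<close>

lemma orthonormal_countable: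
  assumes sep: "separable_hilb H" and B: "orthonormal H (\<lambda>b. b) B"
  shows "countable B"
proof -
  obtain C where C: "countable C" "C \<subseteq> carrier H" "mtopology closure_of C = carrier H"
    using sep by (auto simp: separable_hilb_def separable_space_def)
  have "\<exists>c\<in>C. hnorm H (b \<ominus> c) < 1/2" if "b \<in> B" for b
  proof -
    have b: "b \<in> carrier H" using B that by (auto simp: orthonormal_def)
    then have "b \<in> mtopology closure_of C" using C by simp
    then obtain c where "c \<in> C" "hdist H b c < 1/2"
      unfolding metric_closure_of by (auto simp: in_mball dest!: spec[of _ "1/2"])
    then show ?thesis using C b by (auto simp: hdist_def split: if_splits)
  qed
  then obtain g where g: "\<And>b. b \<in> B \<Longrightarrow> g b \<in> C" "\<And>b. b \<in> B \<Longrightarrow> hnorm H (b \<ominus> g b) < 1/2"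
    by metis
  have "inj_on g B"
  proof (rule inj_onI, rule ccontr)
    fix b b' assume b: "b \<in> B" "b' \<in> B" "g b = g b'" "b \<noteq> b'"
    have c: "b \<in> carrier H" "b' \<in> carrier H" "g b \<in> carrier H"
      using B b g C by (auto simp: orthonormal_def)
    have "hnorm H (b \<ominus> b') \<le> hnorm H (b \<ominus> g b) + hnorm H (g b \<ominus> b')"
      using hnorm_diff_le c by blast
    also have "hnorm H (g b \<ominus> b') = hnorm H (b' \<ominus> g b)"
      using commute[of "g b" b'] c by (simp add: hdist_def)
    finally have "hnorm H (b \<ominus> b') < 1" using g(2)[of b] g(2)[of b'] b by simp
    moreover have "(hnorm H (b \<ominus> b'))\<^sup>2 = 2"
      using b c B by (simp add: hnorm_sq hinner_diff_left hinner_diff_right orthonormal_def)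
    moreover have "hnorm H (b \<ominus> b') \<ge> 0" using c hnorm_nonneg by simp
    ultimately show False
      using power_mono[of "hnorm H (b \<ominus> b')" 1 2] by simp
  qed
  moreover have "countable (g ` B)"
    using g(1) by (intro countable_subset[OF _ C(1)]) auto
  ultimately show ?thesis by (simp add: countable_image_inj_eq)
qed

end

section \<open>Consequences of completeness: Riesz-Fischer, Parseval, Riesz representation\<close>

context hilbert_space
begin

text \<open>\<open>I\<close> may be uncountable, so a Cauchy sequence is extracted from finite sets
  \<open>F n\<close> that carry all but 1/(n+1) of the total mass. These sets need not be
  nested.\<close>

lemma Riesz_Fischer:
  assumes e: "orthonormal H e I" and c: "(\<lambda>i. (cmod (c i))\<^sup>2) summable_on I"
  obtains y where "y \<in> carrier H" "\<And>i. i \<in> I \<Longrightarrow> hinner H y (e i) = c i"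
    "(hnorm H y)\<^sup>2 \<le> (\<Sum>\<^sub>\<infinity>i\<in>I. (cmod (c i))\<^sup>2)"
proof -
  define S where "S = (\<Sum>\<^sub>\<infinity>i\<in>I. (cmod (c i))\<^sup>2)"
  have leS: "(\<Sum>i\<in>F. (cmod (c i))\<^sup>2) \<le> S" if "finite F" "F \<subseteq> I" for F
    unfolding S_def by (rule finite_sum_le_infsum[OF c]) (use that in auto)
  have "\<exists>F. finite F \<and> F \<subseteq> I \<and> S - (\<Sum>i\<in>F. (cmod (c i))\<^sup>2) < inverse (real (Suc n))" for n
  proof -
    obtain F where "finite F" "F \<subseteq> I"
      "dist (\<Sum>i\<in>F. (cmod (c i))\<^sup>2) S \<le> inverse (real (Suc n)) / 2"
      using infsum_finite_approximation[OF c, of "inverse (real (Suc n)) / 2"]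
      unfolding S_def by auto
    then have "S - (\<Sum>i\<in>F. (cmod (c i))\<^sup>2) \<le> inverse (real (Suc n)) / 2"
      unfolding dist_real_def by linarith
    also have "\<dots> < inverse (real (Suc n))" by simp
    finally show ?thesis using \<open>finite F\<close> \<open>F \<subseteq> I\<close> by auto
  qed
  then obtain F where F: "\<And>n. finite (F n)" "\<And>n. F n \<subseteq> I"
    and FS: "\<And>n. S - (\<Sum>i\<in>F n. (cmod (c i))\<^sup>2) < inverse (real (Suc n))"
    by metis
  define y where "y n = (\<Oplus>i\<in>F n. c i \<odot> e i)" for n
  have y: "y n \<in> carrier H" for n
    unfolding y_def by (rule finite_combination_closed[OF e F(2)])
  have ye: "hinner H (y n) (e i) = (if i \<in> F n then c i else 0)" if "i \<in> I" for n i
    unfolding y_def by (rule finite_combination_hinner[OF e F that])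
  have yn: "hinner H (y n) (y n) = of_real (\<Sum>i\<in>F n. (cmod (c i))\<^sup>2)" for n
    using hinner_self[OF y] finite_combination_norm[OF e F] by (simp add: y_def)
  have yy: "hinner H (y m) (y n) = of_real (\<Sum>i\<in>F m \<inter> F n. (cmod (c i))\<^sup>2)" for m n
  proof -
    have "hinner H (y m) (y n) = (\<Sum>i\<in>F n. cnj (c i) * hinner H (y m) (e i))"
      unfolding y_def[of n] by (rule finite_combination_hinner_right[OF e F y])
    also have "\<dots> = (\<Sum>i\<in>F n. if i \<in> F m then of_real ((cmod (c i))\<^sup>2) else 0)"
      by (rule sum.cong)
        (use F(2) in \<open>auto simp: ye subset_iff complex_norm_square mult.commute simp del: of_real_power\<close>)
    also have "\<dots> = (\<Sum>i\<in>F m \<inter> F n. of_real ((cmod (c i))\<^sup>2))"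
      using sum.inter_restrict[OF F(1), of "\<lambda>i. complex_of_real ((cmod (c i))\<^sup>2)" n "F m"]
      by (simp add: Int_commute)
    finally show ?thesis by simp
  qed
  \<comment> \<open>The squared distance is the mass of the symmetric difference of
    \<open>F m\<close> and \<open>F n\<close>. By inclusion-exclusion, and since the union has mass
    at most \<open>S\<close>, it is bounded by the two missing tails.\<close>
  have diff: "(hnorm H (y m \<ominus> y n))\<^sup>2 < inverse (real (Suc m)) + inverse (real (Suc n))" for m n
  proof -
    let ?g = "\<lambda>A. \<Sum>i\<in>A. (cmod (c i))\<^sup>2"
    have "hinner H (y m \<ominus> y n) (y m \<ominus> y n) = of_real (?g (F m) + ?g (F n) - 2 * ?g (F m \<inter> F n))"
      using y by (simp add: hinner_diff_left hinner_diff_right yy Int_commute)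
    then have "(hnorm H (y m \<ominus> y n))\<^sup>2 = ?g (F m) + ?g (F n) - 2 * ?g (F m \<inter> F n)"
      using y hnorm_sq[of "y m \<ominus> y n"] by simp
    moreover have "?g (F m) + ?g (F n) = ?g (F m \<union> F n) + ?g (F m \<inter> F n)"
      by (rule sum.union_inter[symmetric]) (use F in auto)
    moreover have "?g (F m \<union> F n) \<le> S" using leS[of "F m \<union> F n"] F by auto
    ultimately show ?thesis using FS[of m] FS[of n] by linarith
  qed
  have "MCauchy y"
    unfolding MCauchy_def
  proof (intro conjI allI impI)
    show "range y \<subseteq> carrier H" using y by auto
    fix \<epsilon> :: real assume \<epsilon>: "\<epsilon> > 0"
    obtain N where N: "inverse (real (Suc N)) < \<epsilon>\<^sup>2 / 2"
      using reals_Archimedean[of "\<epsilon>\<^sup>2 / 2"] \<epsilon> by auto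
    have "hdist H (y m) (y n) < \<epsilon>" if "N \<le> m" "N \<le> n" for m n
    proof -
      have "inverse (real (Suc m)) \<le> inverse (real (Suc N))" "inverse (real (Suc n)) \<le> inverse (real (Suc N))"
        using that by (simp_all add: field_simps)
      then have "(hnorm H (y m \<ominus> y n))\<^sup>2 < \<epsilon>\<^sup>2" using diff[of m n] N by linarith
      then show ?thesis
        using power2_less_imp_less[of "hnorm H (y m \<ominus> y n)" \<epsilon>] \<epsilon> y by (simp add: hdist_def)
    qed
    then show "\<exists>N. \<forall>n n'. N \<le> n \<longrightarrow> N \<le> n' \<longrightarrow> hdist H (y n) (y n') < \<epsilon>" by blast
  qed
  then obtain z where "limitin mtopology y z sequentially"
    using complete by (auto simp: mcomplete_def)
  then have z: "z \<in> carrier H" and yz: "(\<lambda>n. hdist H (y n) z) \<longlonglongrightarrow> 0"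
    by (auto simp: limitin_metric_dist_null)
  have yz: "(\<lambda>n. hnorm H (y n \<ominus> z)) \<longlonglongrightarrow> 0"
    using yz y z by (simp add: hdist_def)
  show ?thesis
  proof (rule that[OF z])
    fix i assume i: "i \<in> I"
    have ei: "e i \<in> carrier H" using e i by (rule orthonormal_closed)
    have "(\<lambda>n. hinner H (y n \<ominus> z) (e i)) \<longlonglongrightarrow> 0"
    proof (rule Lim_null_comparison)
      show "\<forall>\<^sub>F n in sequentially. cmod (hinner H (y n \<ominus> z) (e i)) \<le> hnorm H (y n \<ominus> z) * hnorm H (e i)"
        using Cauchy_Schwarz y z ei by simp
      show "(\<lambda>n. hnorm H (y n \<ominus> z) * hnorm H (e i)) \<longlonglongrightarrow> 0"
        using tendsto_mult_left_zero[OF yz] by simp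
    qed
    then have "(\<lambda>n. hinner H (y n) (e i) - hinner H z (e i)) \<longlonglongrightarrow> 0"
      using y z ei by (simp add: hinner_diff_left)
    then have 1: "(\<lambda>n. hinner H (y n) (e i)) \<longlonglongrightarrow> hinner H z (e i)"
      by (rule LIM_zero_cancel)
    have "(\<lambda>n. hinner H (y n) (e i) - c i) \<longlonglongrightarrow> 0"
    proof (rule Lim_null_comparison)
      show "\<forall>\<^sub>F n in sequentially. norm (hinner H (y n) (e i) - c i) \<le> sqrt (inverse (real (Suc n)))"
      proof (intro always_eventually allI)
        fix n
        show "norm (hinner H (y n) (e i) - c i) \<le> sqrt (inverse (real (Suc n)))"
        proof (cases "i \<in> F n")
          \<comment> \<open>An index outside \<open>F n\<close> lies in the missing tail, so its
            squared coefficient is at most 1/(n+1).\<close>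
          case False
          have "(\<Sum>i\<in>insert i (F n). (cmod (c i))\<^sup>2) \<le> S"
            by (rule leS) (use F i in auto)
          then have "(cmod (c i))\<^sup>2 \<le> inverse (real (Suc n))"
            using False F FS[of n] by simp
          then show ?thesis
            using False i by (simp add: ye real_le_rsqrt)
        qed (simp add: ye i)
      qed
      have "(\<lambda>n. sqrt (inverse (real (Suc n)))) \<longlonglongrightarrow> sqrt 0"
        by (intro tendsto_real_sqrt LIMSEQ_inverse_real_of_nat)
      then show "(\<lambda>n. sqrt (inverse (real (Suc n)))) \<longlonglongrightarrow> 0" by simp
    qed
    then have "(\<lambda>n. hinner H (y n) (e i)) \<longlonglongrightarrow> c i" by (rule LIM_zero_cancel)
    with 1 show "hinner H z (e i) = c i" by (rule LIMSEQ_unique)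
  next
    have "hnorm H z \<le> sqrt S"
    proof (rule LIMSEQ_le_const[OF _ exI[of _ 0], of "\<lambda>n. hnorm H (y n \<ominus> z) + sqrt S"])
      show "(\<lambda>n. hnorm H (y n \<ominus> z) + sqrt S) \<longlonglongrightarrow> sqrt S"
        using tendsto_add[OF yz tendsto_const[of "sqrt S"]] by simp
      have "hnorm H z \<le> hnorm H (y n \<ominus> z) + sqrt S" for n
      proof -
        have "hnorm H (z \<ominus> \<zero>) \<le> hnorm H (z \<ominus> y n) + hnorm H (y n \<ominus> \<zero>)"
          using y z by (intro hnorm_diff_le) auto
        moreover have "hnorm H (z \<ominus> y n) = hnorm H (y n \<ominus> z)"
          using commute[of z "y n"] y z by (simp add: hdist_def)
        moreover have "hnorm H (y n) \<le> sqrt S"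
          using leS[OF F, of n] yn[of n] y by (simp add: hnorm_def)
        moreover have "z \<ominus> \<zero> = z" "y n \<ominus> \<zero> = y n"
          using y z by (simp_all add: a_minus_def)
        ultimately show ?thesis by simp
      qed
      then show "\<forall>n\<ge>0. hnorm H z \<le> hnorm H (y n \<ominus> z) + sqrt S" by blast
    qed
    moreover have "S \<ge> 0" using leS[of "{}"] by simp
    ultimately show "(hnorm H z)\<^sup>2 \<le> (\<Sum>\<^sub>\<infinity>i\<in>I. (cmod (c i))\<^sup>2)"
      using hnorm_nonneg[OF z] power_mono[of "hnorm H z" "sqrt S" 2] by (simp add: S_def)
  qed
qed

text \<open>The vector built by \<open>Riesz_Fischer\<close> from the coefficients of
  \<open>x\<close> equals \<open>x\<close> by totality, and its norm bound is the converse of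
  Bessel's inequality.\<close>

lemma Parseval_norm:
  assumes e: "onb_family H e I" and x: "x \<in> carrier H"
  shows "((\<lambda>i. (cmod (hinner H x (e i)))\<^sup>2) has_sum (hnorm H x)\<^sup>2) I"
proof -
  have e': "orthonormal H e I" and tot: "total_in H (e ` I)"
    using e by (auto simp: onb_family_def)
  note B = Bessel[OF e' x]
  obtain y where y: "y \<in> carrier H" "\<And>i. i \<in> I \<Longrightarrow> hinner H y (e i) = hinner H x (e i)"
    "(hnorm H y)\<^sup>2 \<le> (\<Sum>\<^sub>\<infinity>i\<in>I. (cmod (hinner H x (e i)))\<^sup>2)"
    using Riesz_Fischer[OF e' B(1)] by metis
  have "y = x" by (rule hinner_ext_total[OF tot]) (use x y in auto)
  then show ?thesis using y(3) B by (auto simp: has_sum_iff)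
qed

text \<open>The remainder of the finite expansion tends to 0 in norm by
  \<open>Parseval_norm\<close>, and \<open>f\<close> is bounded. Allowing a general functional gives
  Parseval's identity and also the expansion of a representation \<open>\<phi> s x\<close> along a
  basis of the fibre.\<close>

lemma functional_has_sum:
  assumes e: "onb_family H e I" and x: "x \<in> carrier H"
    and f: "bounded_functional H f"
  shows "((\<lambda>i. hinner H x (e i) * f (e i)) has_sum f x) I"
proof -
  have e': "orthonormal H e I"
    using e by (auto simp: onb_family_def)
  obtain C where C: "C \<ge> 0" "\<And>x. x \<in> carrier H \<Longrightarrow> cmod (f x) \<le> C * hnorm H x"
    using functional_bound[OF f] by metis
  define s where "s F = (\<Oplus>i\<in>F. hinner H x (e i) \<odot> e i)" for F
  have "((\<lambda>F. (hnorm H x)\<^sup>2 - (\<Sum>i\<in>F. (cmod (hinner H x (e i)))\<^sup>2)) \<longlongrightarrow>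
      (hnorm H x)\<^sup>2 - (hnorm H x)\<^sup>2) (finite_subsets_at_top I)"
    by (intro tendsto_diff tendsto_const Parseval_norm[OF e x, unfolded has_sum_def])
  then have lim: "((\<lambda>F. (hnorm H x)\<^sup>2 - (\<Sum>i\<in>F. (cmod (hinner H x (e i)))\<^sup>2)) \<longlongrightarrow> 0)
      (finite_subsets_at_top I)" by simp
  have "((\<lambda>F. C * sqrt ((hnorm H x)\<^sup>2 - (\<Sum>i\<in>F. (cmod (hinner H x (e i)))\<^sup>2))) \<longlongrightarrow> C * sqrt 0)
      (finite_subsets_at_top I)"
    by (intro tendsto_mult tendsto_const tendsto_real_sqrt lim)
  then have lim: "((\<lambda>F. C * sqrt ((hnorm H x)\<^sup>2 - (\<Sum>i\<in>F. (cmod (hinner H x (e i)))\<^sup>2))) \<longlongrightarrow> 0)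
      (finite_subsets_at_top I)" by simp
  have "((\<lambda>F. (\<Sum>i\<in>F. hinner H x (e i) * f (e i)) - f x) \<longlongrightarrow> 0) (finite_subsets_at_top I)"
  proof (rule Lim_null_comparison[OF _ lim], rule eventually_finite_subsets_at_top_weakI)
    fix F assume F: "finite F" "F \<subseteq> I"
    have s: "s F \<in> carrier H" unfolding s_def by (rule finite_combination_closed[OF e' F(2)])
    have "f (s F) = (\<Sum>i\<in>F. f (hinner H x (e i) \<odot> e i))"
      unfolding s_def
      by (rule functional_finsum[OF f F(1)])
        (use F(2) in \<open>auto intro!: smult_closed dest: orthonormal_closed[OF e']\<close>)
    also have "\<dots> = (\<Sum>i\<in>F. hinner H x (e i) * f (e i))"
      using f F(2) orthonormal_closed[OF e']
      by (intro sum.cong) (auto simp: bounded_functional_def subset_iff)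
    finally have fs: "(\<Sum>i\<in>F. hinner H x (e i) * f (e i)) = f (s F)" ..
    have fd: "f (x \<ominus> s F) = f x - f (s F)"
    proof -
      have "\<ominus> s F = (-1) \<odot> s F" using s smult_minus_one by simp
      moreover have "f (x \<oplus> (-1) \<odot> s F) = f x + f ((-1) \<odot> s F)"
        using f x s by (auto simp: bounded_functional_def)
      moreover have "f ((-1) \<odot> s F) = (-1) * f (s F)"
        using f s by (auto simp: bounded_functional_def)
      ultimately show ?thesis by (simp add: a_minus_def)
    qed
    have "hnorm H (x \<ominus> s F) = sqrt ((hnorm H x)\<^sup>2 - (\<Sum>i\<in>F. (cmod (hinner H x (e i)))\<^sup>2))"
      using finite_combination_diff_norm[OF e' F x] hnorm_nonneg[of "x \<ominus> s F"] x s
      by (simp add: s_def real_sqrt_unique)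
    then show "cmod ((\<Sum>i\<in>F. hinner H x (e i) * f (e i)) - f x)
        \<le> C * sqrt ((hnorm H x)\<^sup>2 - (\<Sum>i\<in>F. (cmod (hinner H x (e i)))\<^sup>2))"
      using C(2)[of "x \<ominus> s F"] x s by (simp add: fs fd norm_minus_commute)
  qed
  then show ?thesis
    unfolding has_sum_def by (rule LIM_zero_cancel)
qed

lemma Parseval:
  assumes e: "onb_family H e I" and x: "x \<in> carrier H" and y: "y \<in> carrier H"
  shows "((\<lambda>i. hinner H x (e i) * cnj (hinner H y (e i))) has_sum hinner H x y) I"
proof -
  have "((\<lambda>i. hinner H x (e i) * hinner H (e i) y) has_sum hinner H x y) I"
    by (rule functional_has_sum[OF e x bounded_functional_hinner[OF y]])
  moreover have "hinner H (e i) y = cnj (hinner H y (e i))" if "i \<in> I" for i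
    using e that y by (intro hinner_commute)
      (auto simp: onb_family_def orthonormal_def)
  ultimately show ?thesis
    by (subst has_sum_cong) auto
qed

text \<open>The representing vector must have the coefficients \<open>cnj (f b)\<close>. On a finite
  combination s of the basis with these coefficients, f s = |s|^2 \<le> C |s|; hence |s| \<le> C,
  the coefficients are square summable, and \<open>Riesz_Fischer\<close> applies.\<close>

lemma Riesz_representation:
  assumes f: "bounded_functional H f"
  obtains y where "y \<in> carrier H" "\<And>x. x \<in> carrier H \<Longrightarrow> f x = hinner H x y"
proof -
  let ?I = "some_onb H"
  have e: "orthonormal H (\<lambda>b. b) ?I" and tot: "total_in H ((\<lambda>b. b) ` ?I)"
    using some_onb by (auto simp: onb_family_def)
  have ec: "b \<in> carrier H" if "b \<in> ?I" for b
    using orthonormal_closed[OF e that] .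
  obtain C where C: "C \<ge> 0" "\<And>x. x \<in> carrier H \<Longrightarrow> cmod (f x) \<le> C * hnorm H x"
    using functional_bound[OF f] by metis
  have bound: "(\<Sum>i\<in>F. (cmod (cnj (f i)))\<^sup>2) \<le> C\<^sup>2" if F: "finite F" "F \<subseteq> ?I" for F
  proof -
    let ?g = "\<Sum>i\<in>F. (cmod (f i))\<^sup>2"
    define s where "s = (\<Oplus>i\<in>F. cnj (f i) \<odot> i)"
    have s: "s \<in> carrier H" unfolding s_def by (rule finite_combination_closed[OF e F(2)])
    have "f s = (\<Sum>i\<in>F. f (cnj (f i) \<odot> i))"
      unfolding s_def
      by (rule functional_finsum[OF f F(1)]) (use F(2) ec in \<open>auto intro!: smult_closed\<close>)
    also have "\<dots> = (\<Sum>i\<in>F. of_real ((cmod (f i))\<^sup>2))"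
      using f F(2) ec
      by (intro sum.cong)
        (auto simp: bounded_functional_def complex_norm_square mult.commute simp del: of_real_power)
    finally have "f s = of_real ?g" by simp
    moreover have "(hnorm H s)\<^sup>2 = ?g"
      unfolding s_def using finite_combination_norm[OF e F, of "\<lambda>i. cnj (f i)"] by simp
    ultimately have "(hnorm H s)\<^sup>2 \<le> C * hnorm H s"
      using C(2)[OF s] by (simp add: sum_nonneg del: of_real_sum of_real_power)
    then have "hnorm H s \<le> C"
      using hnorm_nonneg[OF s] C(1) by (cases "hnorm H s = 0") (auto simp: power2_eq_square)
    then show ?thesis
      using \<open>(hnorm H s)\<^sup>2 = ?g\<close> power_mono[of "hnorm H s" C 2] hnorm_nonneg[OF s] by simp
  qed
  have "(\<lambda>i. (cmod (cnj (f i)))\<^sup>2) summable_on ?I"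
    by (rule nonneg_bdd_above_summable_on)
      (use bound in \<open>auto intro!: bdd_aboveI[of _ "C\<^sup>2"]\<close>)
  then obtain y where y: "y \<in> carrier H" "\<And>i. i \<in> ?I \<Longrightarrow> hinner H y i = cnj (f i)"
    using Riesz_Fischer[OF e] by metis
  show ?thesis
  proof (rule that[OF y(1)])
    fix x assume x: "x \<in> carrier H"
    have "((\<lambda>i. hinner H x i * f i) has_sum f x) ?I"
      by (rule functional_has_sum[OF some_onb x f])
    moreover have "((\<lambda>i. hinner H x i * cnj (hinner H y i)) has_sum hinner H x y) ?I"
      by (rule Parseval[OF some_onb x y(1)])
    moreover have "((\<lambda>i. hinner H x i * cnj (hinner H y i)) has_sum hinner H x y) ?I
        = ((\<lambda>i. hinner H x i * f i) has_sum hinner H x y) ?I"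
      by (rule has_sum_cong) (simp add: y)
    ultimately show "f x = hinner H x y" using has_sum_unique by blast
  qed
qed

text \<open>The Riesz vector of \<open>f\<close> is orthogonal to \<open>V\<close>, hence zero. This
  replaces the usual density argument.\<close>

lemma functional_vanish:
  assumes V: "total_in H V" and f: "bounded_functional H f"
    and 0: "\<And>v. v \<in> V \<Longrightarrow> f v = 0" and x: "x \<in> carrier H"
  shows "f x = 0"
proof -
  obtain y where y: "y \<in> carrier H" "\<And>x. x \<in> carrier H \<Longrightarrow> f x = hinner H x y"
    using Riesz_representation[OF f] by metis
  have "hinner H y v = 0" if "v \<in> V" for v
    using 0[OF that] y hinner_commute[of v y] V that by (auto simp: total_in_def)
  then have "y = \<zero>" using V y(1) by (auto simp: total_in_def)
  then show ?thesis using y(2)[OF x] hinner_zero_right[OF x] by simp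
qed

section \<open>Bounded operators, their adjoints, and operators given by forms\<close>

lemma bop_closed: "T \<in> bop H \<Longrightarrow> x \<in> carrier H \<Longrightarrow> T x \<in> carrier H"
  by (auto simp: bop_def)

lemma bop_add: "T \<in> bop H \<Longrightarrow> x \<in> carrier H \<Longrightarrow> y \<in> carrier H \<Longrightarrow> T (x \<oplus> y) = T x \<oplus> T y"
  by (auto simp: bop_def linear_op_def)

lemma bop_smult: "T \<in> bop H \<Longrightarrow> x \<in> carrier H \<Longrightarrow> T (c \<odot> x) = c \<odot> T x"
  by (auto simp: bop_def linear_op_def)

lemma bop_extensional: "T \<in> bop H \<Longrightarrow> T \<in> extensional (carrier H)"
  by (auto simp: bop_def PiE_def)

lemma bop_bound:
  assumes "T \<in> bop H"
  obtains C where "C \<ge> 0" "\<And>x. x \<in> carrier H \<Longrightarrow> hnorm H (T x) \<le> C * hnorm H x"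
proof -
  obtain C where C: "\<And>x. x \<in> carrier H \<Longrightarrow> hnorm H (T x) \<le> C * hnorm H x"
    using assms by (auto simp: bop_def bounded_op_def)
  show ?thesis
  proof (rule that[of "\<bar>C\<bar>"])
    fix x assume x: "x \<in> carrier H"
    show "hnorm H (T x) \<le> \<bar>C\<bar> * hnorm H x"
      using C[OF x] mult_right_mono[of C "\<bar>C\<bar>" "hnorm H x"] hnorm_nonneg[OF x] by linarith
  qed simp
qed

lemma bop_eqI:
  assumes "T \<in> bop H" "T' \<in> bop H" "\<And>x. x \<in> carrier H \<Longrightarrow> T x = T' x"
  shows "T = T'"
  by (rule extensionalityI[of _ "carrier H"]) (use assms bop_extensional in auto)

lemma bopI:
  assumes "T \<in> extensional (carrier H)" "\<And>x. x \<in> carrier H \<Longrightarrow> T x \<in> carrier H"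
    "\<And>x y. x \<in> carrier H \<Longrightarrow> y \<in> carrier H \<Longrightarrow> T (x \<oplus> y) = T x \<oplus> T y"
    "\<And>c x. x \<in> carrier H \<Longrightarrow> T (c \<odot> x) = c \<odot> T x"
    "\<And>x. x \<in> carrier H \<Longrightarrow> hnorm H (T x) \<le> C * hnorm H x"
  shows "T \<in> bop H"
  unfolding bop_def linear_op_def bounded_op_def PiE_def
  using assms by (intro CollectI conjI exI[of _ C]) auto

lemma op_id_bop: "op_id H \<in> bop H"
  by (rule bopI[where C = 1]) (auto simp: op_id_def)

lemma op_smult_bop: "T \<in> bop H \<Longrightarrow> op_smult H c T \<in> bop H"
proof -
  assume T: "T \<in> bop H"
  obtain C where C: "C \<ge> 0" "\<And>x. x \<in> carrier H \<Longrightarrow> hnorm H (T x) \<le> C * hnorm H x"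
    using bop_bound[OF T] by metis
  have comm: "c \<odot> (d \<odot> x) = d \<odot> (c \<odot> x)" if "x \<in> carrier H" for d x
    by (rule hinner_ext) (use that in \<open>simp_all add: hinner_smult_left\<close>)
  show ?thesis
    by (rule bopI[where C = "cmod c * C"])
      (use C bop_closed[OF T] in \<open>auto simp: op_smult_def bop_add[OF T] bop_smult[OF T]
          smult_r_distr comm hnorm_smult mult.assoc intro!: mult_left_mono\<close>)
qed

lemma op_add_bop: "R \<in> bop H \<Longrightarrow> T \<in> bop H \<Longrightarrow> op_add H R T \<in> bop H"
proof -
  assume R: "R \<in> bop H" and T: "T \<in> bop H"
  obtain C where C: "C \<ge> 0" "\<And>x. x \<in> carrier H \<Longrightarrow> hnorm H (T x) \<le> C * hnorm H x"
    using bop_bound[OF T] by metis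
  obtain D where D: "D \<ge> 0" "\<And>x. x \<in> carrier H \<Longrightarrow> hnorm H (R x) \<le> D * hnorm H x"
    using bop_bound[OF R] by metis
  show ?thesis
  proof (rule bopI[where C = "D + C"])
    fix x assume x: "x \<in> carrier H"
    show "hnorm H (op_add H R T x) \<le> (D + C) * hnorm H x"
      using C(2)[OF x] D(2)[OF x] hnorm_triangle[of "R x" "T x"] x
      by (simp add: op_add_def bop_closed[OF R] bop_closed[OF T] algebra_simps)
  qed (auto simp: op_add_def bop_closed[OF R] bop_closed[OF T] bop_add[OF R] bop_add[OF T]
      bop_smult[OF R] bop_smult[OF T] smult_r_distr M.a_ac)
qed

lemma compose_bop: "R \<in> bop H \<Longrightarrow> T \<in> bop H \<Longrightarrow> compose (carrier H) R T \<in> bop H"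
proof -
  assume R: "R \<in> bop H" and T: "T \<in> bop H"
  obtain C where C: "C \<ge> 0" "\<And>x. x \<in> carrier H \<Longrightarrow> hnorm H (T x) \<le> C * hnorm H x"
    using bop_bound[OF T] by metis
  obtain D where D: "D \<ge> 0" "\<And>x. x \<in> carrier H \<Longrightarrow> hnorm H (R x) \<le> D * hnorm H x"
    using bop_bound[OF R] by metis
  show ?thesis
  proof (rule bopI[where C = "D * C"])
    fix x assume x: "x \<in> carrier H"
    have "hnorm H (R (T x)) \<le> D * hnorm H (T x)" using D(2) bop_closed[OF T x] by simp
    also have "\<dots> \<le> D * (C * hnorm H x)" using C(2)[OF x] D(1) by (rule mult_left_mono)
    finally show "hnorm H (compose (carrier H) R T x) \<le> D * C * hnorm H x"
      using x by (simp add: compose_def)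
  qed (auto simp: compose_def bop_closed[OF R] bop_closed[OF T] bop_add[OF R] bop_add[OF T]
      bop_smult[OF R] bop_smult[OF T])
qed

text \<open>Riesz representation of \<open>y \<mapsto> cnj (q x y)\<close> for each
  \<open>x\<close>; taking \<open>y = T x\<close> in the bound on \<open>q\<close> bounds
  \<open>T\<close>.\<close>

lemma operator_of_form:
  assumes q: "sesquilinear_form H q"
    and C: "C \<ge> 0"
    and bound: "\<And>x y. \<lbrakk>x \<in> carrier H; y \<in> carrier H\<rbrakk> \<Longrightarrow> cmod (q x y) \<le> C * hnorm H x * hnorm H y"
  obtains T where "T \<in> bop H"
    "\<And>x y. x \<in> carrier H \<Longrightarrow> y \<in> carrier H \<Longrightarrow> hinner H (T x) y = q x y"
proof -
  have "\<exists>z\<in>carrier H. \<forall>y\<in>carrier H. hinner H z y = q x y" if x: "x \<in> carrier H" for x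
  proof -
    have "bounded_functional H (\<lambda>y. cnj (q x y))"
      using q C bound x unfolding bounded_functional_def sesquilinear_form_def by (intro conjI exI[of _ "C * hnorm H x"]) auto
    then obtain z where "z \<in> carrier H" "\<And>y. y \<in> carrier H \<Longrightarrow> cnj (q x y) = hinner H y z"
      using Riesz_representation by metis
    then show ?thesis by (metis hinner_commute complex_cnj_cnj)
  qed
  then obtain T where Tc: "\<And>x. x \<in> carrier H \<Longrightarrow> T x \<in> carrier H"
    and Tq: "\<And>x y. x \<in> carrier H \<Longrightarrow> y \<in> carrier H \<Longrightarrow> hinner H (T x) y = q x y"
    by metis
  show ?thesis
  proof (rule that[of "restrict T (carrier H)"])
    show "restrict T (carrier H) \<in> bop H"
    proof (rule bopI[where C = C])
      fix x assume x: "x \<in> carrier H"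
      have "(hnorm H (T x))\<^sup>2 = Re (q x (T x))"
        using x Tc Tq by (simp add: hnorm_sq)
      also have "\<dots> \<le> C * hnorm H x * hnorm H (T x)"
        using bound[OF x Tc[OF x]] complex_Re_le_cmod[of "q x (T x)"] by linarith
      finally have "hnorm H (T x) \<le> C * hnorm H x"
        using hnorm_nonneg[OF Tc[OF x]] hnorm_nonneg[OF x] C
        by (cases "hnorm H (T x) = 0") (auto simp: power2_eq_square)
      then show "hnorm H (restrict T (carrier H) x) \<le> C * hnorm H x" using x by simp
      fix c
      have "T (c \<odot> x) = c \<odot> T x"
        by (rule hinner_ext) (use x Tc Tq q in \<open>simp_all add: hinner_smult_left sesquilinear_form_def\<close>)
      then show "restrict T (carrier H) (c \<odot> x) = c \<odot> restrict T (carrier H) x" using x by simp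
    next
      fix x y assume x: "x \<in> carrier H" and y: "y \<in> carrier H"
      have "T (x \<oplus> y) = T x \<oplus> T y"
        by (rule hinner_ext) (use x y Tc Tq q in \<open>simp_all add: hinner_add_left sesquilinear_form_def\<close>)
      then show "restrict T (carrier H) (x \<oplus> y) = restrict T (carrier H) x \<oplus> restrict T (carrier H) y"
        using x y by simp
    qed (use Tc in auto)
  qed (use Tq in auto)
qed

text \<open>Infinite sums of operators are formed only here, and only weakly: convergence of matrix
  coefficients with a uniform bound suffices.\<close>

lemma operator_of_form_sum:
  fixes f :: "'i \<Rightarrow> 'a \<Rightarrow> 'a \<Rightarrow> complex"
  assumes f: "\<And>i. i \<in> I \<Longrightarrow> sesquilinear_form H (f i)"
    and s: "\<And>x y. x \<in> carrier H \<Longrightarrow> y \<in> carrier H \<Longrightarrow> (\<lambda>i. f i x y) summable_on I"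
    and C: "C \<ge> 0"
    and bound: "\<And>x y. x \<in> carrier H \<Longrightarrow> y \<in> carrier H \<Longrightarrow>
      cmod (\<Sum>\<^sub>\<infinity>i\<in>I. f i x y) \<le> C * hnorm H x * hnorm H y"
  obtains T where "T \<in> bop H"
    "\<And>x y. x \<in> carrier H \<Longrightarrow> y \<in> carrier H \<Longrightarrow> ((\<lambda>i. f i x y) has_sum hinner H (T x) y) I"
proof -
  have "sesquilinear_form H (\<lambda>x y. \<Sum>\<^sub>\<infinity>i\<in>I. f i x y)"
    using f s unfolding sesquilinear_form_def
    by (simp add: infsum_add infsum_cmult_right' cong: infsum_cong)
  then obtain T where "T \<in> bop H"
    "\<And>x y. x \<in> carrier H \<Longrightarrow> y \<in> carrier H \<Longrightarrow> hinner H (T x) y = (\<Sum>\<^sub>\<infinity>i\<in>I. f i x y)"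
    using operator_of_form[OF _ C bound] by blast
  then show ?thesis using that s by simp
qed

text \<open>Existence comes from the form \<open>hinner H x (T y)\<close> and uniqueness from
  testing against all vectors, so the definite description in \<open>op_adj\<close> denotes.\<close>

lemma op_adj:
  assumes T: "T \<in> bop H"
  shows "op_adj H T \<in> bop H \<and>
    (\<forall>x\<in>carrier H. \<forall>y\<in>carrier H. hinner H (T x) y = hinner H x (op_adj H T y))"
proof -
  let ?P = "\<lambda>R. R \<in> bop H \<and>
    (\<forall>x\<in>carrier H. \<forall>y\<in>carrier H. hinner H (T x) y = hinner H x (R y))"
  obtain C where C: "C \<ge> 0" "\<And>x. x \<in> carrier H \<Longrightarrow> hnorm H (T x) \<le> C * hnorm H x"
    using bop_bound[OF T] by metis
  have "cmod (hinner H x (T y)) \<le> C * hnorm H x * hnorm H y" if "x \<in> carrier H" "y \<in> carrier H" for x y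
  proof -
    have "cmod (hinner H x (T y)) \<le> hnorm H x * hnorm H (T y)"
      using that bop_closed[OF T] by (simp add: Cauchy_Schwarz)
    also have "\<dots> \<le> hnorm H x * (C * hnorm H y)"
      using C(2) that hnorm_nonneg by (intro mult_left_mono) auto
    finally show ?thesis by (simp add: mult_ac)
  qed
  then obtain R where R: "R \<in> bop H"
    "\<And>x y. x \<in> carrier H \<Longrightarrow> y \<in> carrier H \<Longrightarrow> hinner H (R x) y = hinner H x (T y)"
    using C(1) operator_of_form[of "\<lambda>x y. hinner H x (T y)" C]
    by (auto simp: sesquilinear_form_def bop_closed[OF T] bop_add[OF T] bop_smult[OF T] hinner_add_left hinner_add_right
        hinner_smult_left hinner_smult_right)
  have "hinner H (T x) y = hinner H x (R y)" if "x \<in> carrier H" "y \<in> carrier H" for x y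
    using R(2)[OF that(2,1)] hinner_commute[of "R y" x] hinner_commute[of y "T x"] that
      bop_closed[OF R(1)] bop_closed[OF T] by simp
  then have ex: "\<exists>R. R \<in> bop H \<and> (\<forall>x\<in>carrier H. \<forall>y\<in>carrier H. hinner H (T x) y = hinner H x (R y))"
    using R(1) by blast
  have "R = R'" if "R \<in> bop H \<and> (\<forall>x\<in>carrier H. \<forall>y\<in>carrier H. hinner H (T x) y = hinner H x (R y))"
    "R' \<in> bop H \<and> (\<forall>x\<in>carrier H. \<forall>y\<in>carrier H. hinner H (T x) y = hinner H x (R' y))" for R R'
  proof (rule bop_eqI)
    fix x assume x: "x \<in> carrier H"
    have c: "R x \<in> carrier H" "R' x \<in> carrier H" using that x by (auto simp: bop_closed)
    show "R x = R' x"
    proof (rule hinner_ext[OF c])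
      fix z assume z: "z \<in> carrier H"
      then have "hinner H z (R x) = hinner H z (R' x)" using that x by simp
      then show "hinner H (R x) z = hinner H (R' x) z"
        using hinner_commute[OF z c(1)] hinner_commute[OF z c(2)] by simp
    qed
  qed (use that in auto)
  with ex have "\<exists>!R. ?P R" by blast
  then show ?thesis unfolding op_adj_def by (rule theI'[of ?P])
qed

lemma op_adj_bop: "T \<in> bop H \<Longrightarrow> op_adj H T \<in> bop H"
  using op_adj by blast

lemma op_adj_hinner:
  "\<lbrakk>T \<in> bop H; x \<in> carrier H; y \<in> carrier H\<rbrakk> \<Longrightarrow> hinner H x (op_adj H T y) = hinner H (T x) y"
  using op_adj by fastforce

lemma op_adj_hinner':
  "\<lbrakk>T \<in> bop H; x \<in> carrier H; y \<in> carrier H\<rbrakk> \<Longrightarrow> hinner H (op_adj H T x) y = hinner H x (T y)"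
  using op_adj_hinner[of T y x] hinner_commute[of "T y" x] hinner_commute[of y "op_adj H T x"]
  by (simp add: op_adj_bop bop_closed)

lemma op_adj_eqI:
  assumes T: "T \<in> bop H" and R: "R \<in> bop H"
    and eq: "\<And>x y. x \<in> carrier H \<Longrightarrow> y \<in> carrier H \<Longrightarrow> hinner H (T x) y = hinner H x (R y)"
  shows "op_adj H T = R"
proof (rule bop_eqI[OF op_adj_bop[OF T] R])
  fix x assume x: "x \<in> carrier H"
  show "op_adj H T x = R x"
  proof (rule hinner_ext)
    fix z assume "z \<in> carrier H"
    then show "hinner H (op_adj H T x) z = hinner H (R x) z"
      using x T R eq[of z x] hinner_commute[of "T z" x] hinner_commute[of z "R x"]
      by (simp add: op_adj_hinner' bop_closed)
  qed (use x T R in \<open>auto simp: op_adj_bop bop_closed\<close>)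
qed

text \<open>The adjoints agree, because their values are tested on \<open>V\<close> alone; passing
  back to the operators then gives equality everywhere, without linear spans or limits.\<close>

lemma bop_eq_on_total:
  assumes V: "total_in H V" and T: "T \<in> bop H" and T': "T' \<in> bop H"
    and eq: "\<And>v. v \<in> V \<Longrightarrow> T v = T' v"
  shows "T = T'"
proof (rule bop_eqI[OF T T'])
  have Vc: "v \<in> carrier H" if "v \<in> V" for v using V that by (auto simp: total_in_def)
  have adj: "op_adj H T y = op_adj H T' y" if y: "y \<in> carrier H" for y
  proof (rule hinner_ext_total[OF V])
    fix v assume "v \<in> V"
    then show "hinner H (op_adj H T y) v = hinner H (op_adj H T' y) v"
      using y Vc eq T T' by (simp add: op_adj_hinner')
  qed (use y T T' in \<open>auto simp: op_adj_bop bop_closed\<close>)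
  fix x assume x: "x \<in> carrier H"
  show "T x = T' x"
    by (rule hinner_ext) (use x T T' adj in \<open>simp_all add: bop_closed flip: op_adj_hinner\<close>)
qed

lemma rank_one_operator:
  assumes x: "x \<in> carrier H" and y: "y \<in> carrier H"
  obtains T where "T \<in> bop H" "\<And>z. z \<in> carrier H \<Longrightarrow> T z = hinner H z x \<odot> y"
proof (rule that[of "\<lambda>z\<in>carrier H. hinner H z x \<odot> y"])
  show "(\<lambda>z\<in>carrier H. hinner H z x \<odot> y) \<in> bop H"
  proof (rule bopI[where C = "hnorm H x * hnorm H y"])
    fix z assume z: "z \<in> carrier H"
    show "hnorm H ((\<lambda>z\<in>carrier H. hinner H z x \<odot> y) z) \<le> hnorm H x * hnorm H y * hnorm H z"
      using mult_right_mono[OF Cauchy_Schwarz[OF z x] hnorm_nonneg[OF y]] z y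
      by (simp add: hnorm_smult mult_ac)
    fix c
    show "(\<lambda>z\<in>carrier H. hinner H z x \<odot> y) (c \<odot> z) = c \<odot> (\<lambda>z\<in>carrier H. hinner H z x \<odot> y) z"
      by (rule hinner_ext) (use x y z in \<open>simp_all add: hinner_smult_left\<close>)
  next
    fix z z' assume z: "z \<in> carrier H" "z' \<in> carrier H"
    show "(\<lambda>z\<in>carrier H. hinner H z x \<odot> y) (z \<oplus> z') =
        (\<lambda>z\<in>carrier H. hinner H z x \<odot> y) z \<oplus> (\<lambda>z\<in>carrier H. hinner H z x \<odot> y) z'"
      by (rule hinner_ext) (use x y z in \<open>simp_all add: hinner_smult_left hinner_add_left algebra_simps\<close>)
  qed (use y in auto)
qed auto

text \<open>\<open>T\<close> is the weak sum over \<open>I\<close> of the rank-one operators sending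
  \<open>\<iota> i\<close> to \<open>g i\<close>; Bessel's inequality for the orthonormal vectors
  \<open>g i\<close> divided by sqrt c bounds it by sqrt c. Linear relations among the
  \<open>\<iota> p\<close> need no separate check, since the distance from
  \<open>T (\<iota> p)\<close> to \<open>g p\<close> is expressed by Gram matrices alone.\<close>

lemma isometry_extension:
  assumes \<iota>: "\<And>p. p \<in> X \<Longrightarrow> \<iota> p \<in> carrier H" and g: "\<And>p. p \<in> X \<Longrightarrow> g p \<in> carrier H"
    and c: "c \<ge> 0"
    and gg: "\<And>p q. p \<in> X \<Longrightarrow> q \<in> X \<Longrightarrow> hinner H (g p) (g q) = of_real c * hinner H (\<iota> p) (\<iota> q)"
    and I: "I \<subseteq> X" and onb: "onb_family H \<iota> I"
  obtains T where "T \<in> bop H" "\<And>p. p \<in> X \<Longrightarrow> T (\<iota> p) = g p"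
proof -
  have on: "orthonormal H \<iota> I" using onb by (simp add: onb_family_def)
  have bes: "(\<lambda>i. (cmod (hinner H (g i) y))\<^sup>2) summable_on I \<and>
      (\<Sum>\<^sub>\<infinity>i\<in>I. (cmod (hinner H (g i) y))\<^sup>2) \<le> c * (hnorm H y)\<^sup>2" if y: "y \<in> carrier H" for y
  proof (cases "c = 0")
    \<comment> \<open>Dividing by sqrt c is impossible here, but then every \<open>g i\<close> is
      zero. The case occurs for the zero vector of a fibre in \<open>rep\<close>.\<close>
    case True
    have "g i = \<zero>" if "i \<in> I" for i
      using gg[of i i] that I g True by (intro hinner_definite) auto
    then have "(cmod (hinner H (g i) y))\<^sup>2 = 0" if "i \<in> I" for i
      using that y hinner_zero_left by simp
    then show ?thesis
      using True by (auto cong: summable_on_cong infsum_cong)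
  next
    case False
    then have c: "c > 0" using c by simp
    define f where "f i = of_real (inverse (sqrt c)) \<odot> g i" for i
    have gf: "hinner H y (g i) = of_real (sqrt c) * hinner H y (f i)" if "i \<in> I" for i
      using that I g y c by (auto simp: f_def hinner_smult_right)
    have "orthonormal H f I"
    proof -
      have "hinner H (f i) (f j) = (if i = j then 1 else 0)" if "i \<in> I" "j \<in> I" for i j
      proof -
        have "complex_of_real (sqrt c) * complex_of_real (sqrt c) = of_real c"
          using c by (simp flip: of_real_mult)
        then show ?thesis
          using that I g c orthonormal_hinner[OF on that]
          by (auto simp: f_def hinner_smult_left hinner_smult_right gg subset_iff field_simps)
      qed
      then show ?thesis using I g by (auto simp: orthonormal_def f_def)
    qed
    note B = Bessel[OF this y]
    have eq: "(cmod (hinner H (g i) y))\<^sup>2 = c * (cmod (hinner H y (f i)))\<^sup>2" if "i \<in> I" for i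
    proof -
      have "cmod (hinner H (g i) y) = cmod (hinner H y (g i))"
        using hinner_commute[of y "g i"] y g I that by auto
      then show ?thesis using gf[OF that] c by (simp add: norm_mult power_mult_distrib)
    qed
    have "(\<lambda>i. c * (cmod (hinner H y (f i)))\<^sup>2) summable_on I"
      using B(1) by (rule summable_on_cmult_right)
    moreover have "(\<Sum>\<^sub>\<infinity>i\<in>I. c * (cmod (hinner H y (f i)))\<^sup>2) \<le> c * (hnorm H y)\<^sup>2"
      using B c by (simp add: infsum_cmult_right)
    ultimately show ?thesis by (simp add: eq cong: summable_on_cong infsum_cong)
  qed
  have gI: "g i \<in> carrier H" "\<iota> i \<in> carrier H" if "i \<in> I" for i using g \<iota> I that by auto
  obtain T where T: "T \<in> bop H"
    and Tsum: "\<And>x y. x \<in> carrier H \<Longrightarrow> y \<in> carrier H \<Longrightarrow>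
      ((\<lambda>i. hinner H x (\<iota> i) * hinner H (g i) y) has_sum hinner H (T x) y) I"
  proof (rule operator_of_form_sum[of I "\<lambda>i x y. hinner H x (\<iota> i) * hinner H (g i) y" "sqrt c"])
    show "sesquilinear_form H (\<lambda>x y. hinner H x (\<iota> i) * hinner H (g i) y)" if "i \<in> I" for i
      using gI[OF that] unfolding sesquilinear_form_def
      by (auto simp: hinner_add_left hinner_add_right hinner_smult_left hinner_smult_right algebra_simps)
    fix x y assume A: "x \<in> carrier H" "y \<in> carrier H"
    note cs = l2_Cauchy_Schwarz[OF Bessel(1)[OF on A(1)] bes[OF A(2), THEN conjunct1],
        of "\<lambda>i. hinner H x (\<iota> i) * hinner H (g i) y"]
    show "(\<lambda>i. hinner H x (\<iota> i) * hinner H (g i) y) summable_on I"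
      by (rule cs(2)) (simp add: norm_mult)
    have "cmod (\<Sum>\<^sub>\<infinity>i\<in>I. hinner H x (\<iota> i) * hinner H (g i) y) \<le>
        sqrt (\<Sum>\<^sub>\<infinity>i\<in>I. (cmod (hinner H x (\<iota> i)))\<^sup>2) * sqrt (\<Sum>\<^sub>\<infinity>i\<in>I. (cmod (hinner H (g i) y))\<^sup>2)"
      by (rule cs(3)) (simp add: norm_mult)
    also have "\<dots> \<le> sqrt ((hnorm H x)\<^sup>2) * sqrt (c * (hnorm H y)\<^sup>2)"
      using Bessel(2)[OF on A(1)] bes[OF A(2)]
      by (intro mult_mono real_sqrt_le_mono) (auto intro: infsum_nonneg real_sqrt_ge_zero)
    finally show "cmod (\<Sum>\<^sub>\<infinity>i\<in>I. hinner H x (\<iota> i) * hinner H (g i) y) \<le> sqrt c * hnorm H x * hnorm H y"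
      using A by (simp add: real_sqrt_mult hnorm_nonneg mult_ac)
  qed (use c in auto)
  show ?thesis
  proof (rule that[OF T])
    fix p assume p: "p \<in> X"
    have pc: "\<iota> p \<in> carrier H" "g p \<in> carrier H" "T (\<iota> p) \<in> carrier H"
      using \<iota> g p bop_closed[OF T] by auto
    have Tg: "hinner H (T (\<iota> p)) (g r) = of_real c * hinner H (\<iota> p) (\<iota> r)" if r: "r \<in> X" for r
    proof -
      have rc: "\<iota> r \<in> carrier H" "g r \<in> carrier H" using \<iota> g r by auto
      have "((\<lambda>i. of_real c * (hinner H (\<iota> p) (\<iota> i) * hinner H (\<iota> i) (\<iota> r)))
          has_sum (of_real c * hinner H (\<iota> p) (\<iota> r))) I"
        by (intro has_sum_cmult_right functional_has_sum[OF onb pc(1) bounded_functional_hinner[OF rc(1)]])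
      then have "((\<lambda>i. hinner H (\<iota> p) (\<iota> i) * hinner H (g i) (g r))
          has_sum (of_real c * hinner H (\<iota> p) (\<iota> r))) I"
        by (subst has_sum_cong) (use r I in \<open>auto simp: gg subset_iff\<close>)
      then show ?thesis
        using Tsum[OF pc(1) rc(2)] has_sum_unique by blast
    qed
    have "hinner H (T (\<iota> p)) (T (\<iota> p)) = of_real c * hinner H (\<iota> p) (\<iota> p)"
    proof -
      have "((\<lambda>i. of_real c * (hinner H (\<iota> p) (\<iota> i) * cnj (hinner H (\<iota> p) (\<iota> i))))
          has_sum (of_real c * hinner H (\<iota> p) (\<iota> p))) I"
        by (intro has_sum_cmult_right Parseval[OF onb pc(1) pc(1)])
      moreover have "hinner H (g i) (T (\<iota> p)) = of_real c * cnj (hinner H (\<iota> p) (\<iota> i))" if "i \<in> I" for i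
        using Tg[of i] that I hinner_commute[OF pc(3) gI(1)[OF that]] by auto
      ultimately have "((\<lambda>i. hinner H (\<iota> p) (\<iota> i) * hinner H (g i) (T (\<iota> p)))
          has_sum (of_real c * hinner H (\<iota> p) (\<iota> p))) I"
        by (subst has_sum_cong) (auto simp: mult_ac)
      then show ?thesis
        using Tsum[OF pc(1) pc(3)] has_sum_unique by blast
    qed
    moreover have "hinner H (g p) (T (\<iota> p)) = of_real c * hinner H (\<iota> p) (\<iota> p)"
      using hinner_commute[OF pc(3,2)] Tg[OF p] hinner_self[OF pc(1)] by simp
    \<comment> \<open>All four terms of the expanded square are, up to sign, c times the squared
      norm of \<open>\<iota> p\<close>, so they cancel.\<close>
    ultimately have "hinner H (T (\<iota> p) \<ominus> g p) (T (\<iota> p) \<ominus> g p) = 0"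
      using pc by (simp add: hinner_diff_left hinner_diff_right Tg[OF p] gg[OF p p])
    then show "T (\<iota> p) = g p"
      using hinner_definite[of "T (\<iota> p) \<ominus> g p"] pc diff_eq_zero_iff by simp
  qed
qed

end

section \<open>The sequence space\<close>

definition ell2 :: "(nat \<Rightarrow> complex) hilb" where
  "ell2 = \<lparr>carrier = {x. (\<lambda>n. (cmod (x n))\<^sup>2) summable_on UNIV}, mult = undefined, one = undefined,
     zero = (\<lambda>n. 0), add = (\<lambda>x y n. x n + y n), smult = (\<lambda>c x n. c * x n),
     hinner = (\<lambda>x y. \<Sum>\<^sub>\<infinity>n. x n * cnj (y n))\<rparr>"

definition ell2_unit :: "nat \<Rightarrow> nat \<Rightarrow> complex" where
  "ell2_unit i = (\<lambda>n. if n = i then 1 else 0)"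

lemma ell2_simps [simp]:
  "x \<in> carrier ell2 \<longleftrightarrow> (\<lambda>n. (cmod (x n))\<^sup>2) summable_on UNIV"
  "\<zero>\<^bsub>ell2\<^esub> = (\<lambda>n. 0)" "x \<oplus>\<^bsub>ell2\<^esub> y = (\<lambda>n. x n + y n)" "c \<odot>\<^bsub>ell2\<^esub> x = (\<lambda>n. c * x n)"
  by (simp_all add: ell2_def)

lemma hinner_ell2: "hinner ell2 x y = (\<Sum>\<^sub>\<infinity>n. x n * cnj (y n))"
  by (simp add: ell2_def)

lemma ell2_hinner_has_sum:
  assumes "x \<in> carrier ell2" "y \<in> carrier ell2"
  shows "((\<lambda>n. x n * cnj (y n)) has_sum hinner ell2 x y) UNIV"
proof -
  have "(\<lambda>n. x n * cnj (y n)) summable_on UNIV"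
    by (rule l2_Cauchy_Schwarz(2)[of "\<lambda>n. cmod (x n)" _ "\<lambda>n. cmod (y n)"])
      (use assms in \<open>auto simp: norm_mult\<close>)
  then show ?thesis unfolding hinner_ell2 by (rule has_sum_infsum)
qed

lemma cring_complex_ring: "cring complex_ring"
proof (rule cringI)
  show "abelian_group complex_ring"
  proof (rule abelian_groupI)
    show "\<exists>y\<in>carrier complex_ring. y \<oplus>\<^bsub>complex_ring\<^esub> x = \<zero>\<^bsub>complex_ring\<^esub>" for x
      by (rule bexI[of _ "- x"]) (simp_all add: complex_ring_def)
  qed (simp_all add: complex_ring_def)
  show "comm_monoid complex_ring"
    by (rule comm_monoidI) (auto simp: complex_ring_def mult_ac)
qed (auto simp: complex_ring_def algebra_simps)

lemma ell2_add_closed: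
  assumes "x \<in> carrier ell2" "y \<in> carrier ell2"
  shows "(\<lambda>n. x n + y n) \<in> carrier ell2"
proof -
  have "(\<lambda>n. 2 * (cmod (x n))\<^sup>2 + 2 * (cmod (y n))\<^sup>2) summable_on UNIV"
    using assms by (intro summable_on_add summable_on_cmult_right) auto
  moreover have "(cmod (x n + y n))\<^sup>2 \<le> 2 * (cmod (x n))\<^sup>2 + 2 * (cmod (y n))\<^sup>2" for n
  proof -
    have "(cmod (x n + y n))\<^sup>2 \<le> (cmod (x n) + cmod (y n))\<^sup>2"
      by (intro power_mono norm_triangle_ineq) auto
    also have "\<dots> \<le> 2 * (cmod (x n))\<^sup>2 + 2 * (cmod (y n))\<^sup>2"
      using sum_squares_bound[of "cmod (x n)" "cmod (y n)"] by (simp add: power2_sum)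
    finally show ?thesis .
  qed
  ultimately show ?thesis
    by (auto intro: summable_on_comparison_test)
qed

lemma ell2_smult_closed: "x \<in> carrier ell2 \<Longrightarrow> (\<lambda>n. c * x n) \<in> carrier ell2"
  by (simp add: norm_mult power_mult_distrib summable_on_cmult_right)

lemma inner_product_space_ell2: "inner_product_space ell2"
proof (intro inner_product_space.intro inner_product_space_axioms.intro)
  show "Module.module complex_ring ell2"
  proof (rule moduleI[OF cring_complex_ring])
    show "abelian_group ell2"
    proof (rule abelian_groupI)
      fix x assume "x \<in> carrier ell2"
      then show "\<exists>y\<in>carrier ell2. y \<oplus>\<^bsub>ell2\<^esub> x = \<zero>\<^bsub>ell2\<^esub>"
        by (intro bexI[of _ "\<lambda>n. (-1) * x n"] ell2_smult_closed) auto
    next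
      show "x \<oplus>\<^bsub>ell2\<^esub> y \<in> carrier ell2" if "x \<in> carrier ell2" "y \<in> carrier ell2" for x y
        using ell2_add_closed[OF that] by simp
    qed (auto simp: add_ac)
    show "c \<odot>\<^bsub>ell2\<^esub> x \<in> carrier ell2" if "x \<in> carrier ell2" for c x
      using ell2_smult_closed[OF that] by simp
  qed (auto simp: complex_ring_def algebra_simps)
next
  fix x y z assume A: "x \<in> carrier ell2" "y \<in> carrier ell2" "z \<in> carrier ell2"
  have "((\<lambda>n. x n * cnj (z n) + y n * cnj (z n)) has_sum (hinner ell2 x z + hinner ell2 y z)) UNIV"
    using A by (intro has_sum_add ell2_hinner_has_sum)
  then show "hinner ell2 (x \<oplus>\<^bsub>ell2\<^esub> y) z = hinner ell2 x z + hinner ell2 y z"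
    by (simp add: hinner_ell2[of "\<lambda>n. x n + y n"] infsumI algebra_simps)
next
  fix c x y assume A: "x \<in> carrier ell2" "y \<in> carrier ell2"
  have "((\<lambda>n. c * (x n * cnj (y n))) has_sum (c * hinner ell2 x y)) UNIV"
    using A by (intro has_sum_cmult_right ell2_hinner_has_sum)
  then show "hinner ell2 (c \<odot>\<^bsub>ell2\<^esub> x) y = c * hinner ell2 x y"
    by (simp add: hinner_ell2[of "\<lambda>n. c * x n"] infsumI algebra_simps)
next
  fix x y assume A: "x \<in> carrier ell2" "y \<in> carrier ell2"
  have "((\<lambda>n. cnj (x n * cnj (y n))) has_sum cnj (hinner ell2 x y)) UNIV"
    unfolding has_sum_cnj_iff using A by (rule ell2_hinner_has_sum)
  then show "hinner ell2 y x = cnj (hinner ell2 x y)"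
    by (simp add: hinner_ell2[of y] infsumI mult.commute)
next
  fix x assume x: "x \<in> carrier ell2"
  have eq: "hinner ell2 x x = of_real (\<Sum>\<^sub>\<infinity>n. (cmod (x n))\<^sup>2)"
  proof -
    have "((\<lambda>n. complex_of_real ((cmod (x n))\<^sup>2)) has_sum of_real (\<Sum>\<^sub>\<infinity>n. (cmod (x n))\<^sup>2)) UNIV"
      using x by (intro has_sum_of_real has_sum_infsum) auto
    then show ?thesis
      by (simp add: hinner_ell2 infsumI complex_norm_square del: of_real_power)
  qed
  show "0 \<le> Re (hinner ell2 x x)" by (simp add: eq infsum_nonneg)
  assume "hinner ell2 x x = 0"
  then have 0: "(\<Sum>\<^sub>\<infinity>n. (cmod (x n))\<^sup>2) = 0" by (simp add: eq)
  have "(cmod (x n))\<^sup>2 = 0" for n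
    by (rule nonneg_infsum_le_0D[of _ UNIV]) (use x 0 in auto)
  then show "x = \<zero>\<^bsub>ell2\<^esub>" by auto
qed

interpretation ell2: inner_product_space ell2
  by (rule inner_product_space_ell2)

lemma ell2_minus: "x \<in> carrier ell2 \<Longrightarrow> y \<in> carrier ell2 \<Longrightarrow> x \<ominus>\<^bsub>ell2\<^esub> y = (\<lambda>n. x n - y n)"
  using ell2.smult_minus_one[of y] by (simp add: a_minus_def fun_eq_iff flip: ell2.smult_minus_one)

lemma ell2_hnorm: "x \<in> carrier ell2 \<Longrightarrow> (hnorm ell2 x)\<^sup>2 = (\<Sum>\<^sub>\<infinity>n. (cmod (x n))\<^sup>2)"
proof -
  assume x: "x \<in> carrier ell2"
  have "((\<lambda>n. complex_of_real ((cmod (x n))\<^sup>2)) has_sum of_real (\<Sum>\<^sub>\<infinity>n. (cmod (x n))\<^sup>2)) UNIV"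
    using x by (intro has_sum_of_real has_sum_infsum) auto
  then have "hinner ell2 x x = of_real (\<Sum>\<^sub>\<infinity>n. (cmod (x n))\<^sup>2)"
    by (simp add: hinner_ell2 infsumI complex_norm_square del: of_real_power)
  then show ?thesis using ell2.hnorm_sq[OF x] by simp
qed

lemma ell2_finite_sum_le_hnorm:
  "x \<in> carrier ell2 \<Longrightarrow> finite F \<Longrightarrow> (\<Sum>n\<in>F. (cmod (x n))\<^sup>2) \<le> (hnorm ell2 x)\<^sup>2"
  unfolding ell2_hnorm by (rule finite_sum_le_infsum) auto

lemma ell2_hnorm_le:
  assumes "\<And>F. finite F \<Longrightarrow> (\<Sum>n\<in>F. (cmod (x n))\<^sup>2) \<le> C\<^sup>2" and C: "C \<ge> 0"
  shows "x \<in> carrier ell2" and "hnorm ell2 x \<le> C"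
proof -
  show x: "x \<in> carrier ell2"
    unfolding ell2_simps
    by (rule nonneg_bdd_above_summable_on) (use assms in \<open>auto intro!: bdd_aboveI[of _ "C\<^sup>2"]\<close>)
  have "(hnorm ell2 x)\<^sup>2 \<le> C\<^sup>2"
    unfolding ell2_hnorm[OF x] by (rule infsum_le_finite_sums) (use x assms in auto)
  then show "hnorm ell2 x \<le> C" using C by (rule power2_le_imp_le)
qed

text \<open>The Cauchy estimates are kept in the form of bounds on finite partial sums, because
  these survive the passage to the coordinatewise limit.\<close>

lemma hilbert_space_ell2: "hilbert_space ell2"
proof (intro hilbert_space.intro inner_product_space_ell2 hilbert_space_axioms.intro)
  show "ell2.mcomplete"
    unfolding ell2.mcomplete_def
  proof (intro allI impI)
    fix \<sigma> assume \<sigma>: "ell2.MCauchy \<sigma>"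
    have c: "\<sigma> n \<in> carrier ell2" for n using \<sigma> by (auto simp: ell2.MCauchy_def image_subset_iff)
    have dc: "(\<lambda>i. \<sigma> m i - \<sigma> n i) \<in> carrier ell2" for m n
      using ell2.M.minus_closed[OF c c, of m n] by (simp only: ell2_minus[OF c c])
    have cau: "\<exists>N. \<forall>m\<ge>N. \<forall>n\<ge>N. \<forall>F. finite F \<longrightarrow> (\<Sum>i\<in>F. (cmod (\<sigma> m i - \<sigma> n i))\<^sup>2) \<le> \<epsilon>\<^sup>2"
      if \<epsilon>: "\<epsilon> > 0" for \<epsilon>
    proof -
      obtain N where N: "\<And>m n. m \<ge> N \<Longrightarrow> n \<ge> N \<Longrightarrow> hdist ell2 (\<sigma> m) (\<sigma> n) < \<epsilon>"
        using \<sigma> \<epsilon> unfolding ell2.MCauchy_def by metis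
      have "(\<Sum>i\<in>F. (cmod (\<sigma> m i - \<sigma> n i))\<^sup>2) \<le> \<epsilon>\<^sup>2" if "m \<ge> N" "n \<ge> N" "finite F" for m n F
      proof -
        have "hnorm ell2 (\<lambda>i. \<sigma> m i - \<sigma> n i) < \<epsilon>"
          using N[OF that(1,2)] c[of m] c[of n] unfolding hdist_def by (simp add: ell2_minus[OF c c])
        then have "(hnorm ell2 (\<lambda>i. \<sigma> m i - \<sigma> n i))\<^sup>2 \<le> \<epsilon>\<^sup>2"
          using ell2.hnorm_nonneg[OF dc] by (intro power_mono) auto
        then show ?thesis using ell2_finite_sum_le_hnorm[OF dc that(3), of m n] by linarith
      qed
      then show ?thesis by blast
    qed
    have "Cauchy (\<lambda>m. \<sigma> m i)" for i
    proof (rule metric_CauchyI)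
      fix \<epsilon> :: real assume \<epsilon>: "\<epsilon> > 0"
      obtain N where N: "\<And>m n F. m \<ge> N \<Longrightarrow> n \<ge> N \<Longrightarrow> finite F \<Longrightarrow>
          (\<Sum>i\<in>F. (cmod (\<sigma> m i - \<sigma> n i))\<^sup>2) \<le> (\<epsilon> / 2)\<^sup>2"
        using cau[of "\<epsilon> / 2"] \<epsilon> by auto
      have "dist (\<sigma> m i) (\<sigma> n i) < \<epsilon>" if "m \<ge> N" "n \<ge> N" for m n
      proof -
        have "(cmod (\<sigma> m i - \<sigma> n i))\<^sup>2 \<le> (\<epsilon> / 2)\<^sup>2" using N[OF that, of "{i}"] by simp
        then have "cmod (\<sigma> m i - \<sigma> n i) \<le> \<epsilon> / 2" by (rule power2_le_imp_le) (use \<epsilon> in auto)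
        then show ?thesis using \<epsilon> by (simp add: dist_norm)
      qed
      then show "\<exists>N. \<forall>m\<ge>N. \<forall>n\<ge>N. dist (\<sigma> m i) (\<sigma> n i) < \<epsilon>" by blast
    qed
    then have "\<forall>i. \<exists>l. (\<lambda>m. \<sigma> m i) \<longlonglongrightarrow> l" by (metis Cauchy_convergent_iff convergent_def)
    then obtain x where x: "\<And>i. (\<lambda>m. \<sigma> m i) \<longlonglongrightarrow> x i" by metis
    have lim: "\<exists>N. \<forall>n\<ge>N. \<forall>F. finite F \<longrightarrow> (\<Sum>i\<in>F. (cmod (\<sigma> n i - x i))\<^sup>2) \<le> \<epsilon>\<^sup>2"
      if \<epsilon>: "\<epsilon> > 0" for \<epsilon>
    proof -
      obtain N where N: "\<And>m n F. m \<ge> N \<Longrightarrow> n \<ge> N \<Longrightarrow> finite F \<Longrightarrow>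
          (\<Sum>i\<in>F. (cmod (\<sigma> m i - \<sigma> n i))\<^sup>2) \<le> \<epsilon>\<^sup>2"
        using cau[OF \<epsilon>] by auto
      have "(\<Sum>i\<in>F. (cmod (\<sigma> n i - x i))\<^sup>2) \<le> \<epsilon>\<^sup>2" if "n \<ge> N" "finite F" for n F
      proof (rule LIMSEQ_le_const2)
        show "(\<lambda>m. \<Sum>i\<in>F. (cmod (\<sigma> n i - \<sigma> m i))\<^sup>2) \<longlonglongrightarrow> (\<Sum>i\<in>F. (cmod (\<sigma> n i - x i))\<^sup>2)"
          by (intro tendsto_sum tendsto_power tendsto_norm tendsto_diff tendsto_const x)
        show "\<exists>M. \<forall>m\<ge>M. (\<Sum>i\<in>F. (cmod (\<sigma> n i - \<sigma> m i))\<^sup>2) \<le> \<epsilon>\<^sup>2"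
          using N that by blast
      qed
      then show ?thesis by blast
    qed
    obtain N where N: "\<And>F. finite F \<Longrightarrow> (\<Sum>i\<in>F. (cmod (\<sigma> N i - x i))\<^sup>2) \<le> 1\<^sup>2"
      using lim[of 1] by auto
    have d: "(\<lambda>i. \<sigma> N i - x i) \<in> carrier ell2" by (rule ell2_hnorm_le(1)[OF N]) auto
    \<comment> \<open>The limit is square summable as the difference of \<open>\<sigma> N\<close>
      and the error \<open>\<sigma> N - x\<close>.\<close>
    have "(\<lambda>i. \<sigma> N i + (-1) * (\<sigma> N i - x i)) \<in> carrier ell2"
      using c d by (intro ell2_add_closed ell2_smult_closed)
    then have xc: "x \<in> carrier ell2" by simp
    have "limitin ell2.mtopology \<sigma> x sequentially"
      unfolding ell2.limit_metric_sequentially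
    proof (intro conjI xc allI impI)
      fix \<epsilon> :: real assume \<epsilon>: "\<epsilon> > 0"
      obtain N where N: "\<And>n F. n \<ge> N \<Longrightarrow> finite F \<Longrightarrow>
          (\<Sum>i\<in>F. (cmod (\<sigma> n i - x i))\<^sup>2) \<le> (\<epsilon> / 2)\<^sup>2"
        using lim[of "\<epsilon> / 2"] \<epsilon> by auto
      have "hdist ell2 (\<sigma> n) x < \<epsilon>" if "n \<ge> N" for n
      proof -
        have "hnorm ell2 (\<lambda>i. \<sigma> n i - x i) \<le> \<epsilon> / 2"
          by (rule ell2_hnorm_le(2)) (use N that \<epsilon> in auto)
        then show ?thesis
          using c[of n] xc \<epsilon> unfolding hdist_def ell2_minus[OF c xc] by simp
      qed
      then show "\<exists>N. \<forall>n\<ge>N. \<sigma> n \<in> carrier ell2 \<and> hdist ell2 (\<sigma> n) x < \<epsilon>" using c by blast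
    qed
    then show "\<exists>x. limitin ell2.mtopology \<sigma> x sequentially" by blast
  qed
qed

interpretation ell2: hilbert_space ell2
  by (rule hilbert_space_ell2)

lemma ell2_unit_carrier: "ell2_unit i \<in> carrier ell2"
proof -
  have "finite {n \<in> UNIV. (cmod (ell2_unit i n))\<^sup>2 \<noteq> 0}"
    by (rule finite_subset[of _ "{i}"]) (auto simp: ell2_unit_def)
  then show ?thesis unfolding ell2_simps by (rule finite_nonzero_values_imp_summable_on)
qed

lemma ell2_hinner_unit: "hinner ell2 x (ell2_unit i) = x i"
proof -
  have "((\<lambda>n. x n * cnj (ell2_unit i n)) has_sum x i) UNIV"
    by (rule has_sum_finite_neutralI[of "{i}"]) (auto simp: ell2_unit_def)
  then show ?thesis by (simp add: hinner_ell2 infsumI)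
qed

lemma ell2_unit_basis: "onb_family ell2 ell2_unit UNIV"
  unfolding onb_family_def orthonormal_def total_in_def
  using ell2_unit_carrier by (auto simp: ell2_hinner_unit ell2_unit_def[THEN fun_cong])

lemma complex_rational_approximation:
  fixes w :: complex assumes "\<delta> > 0"
  shows "\<exists>p. cmod (w - Complex (of_rat (fst p)) (of_rat (snd p))) < \<delta>"
proof -
  obtain p where p: "Re w - \<delta> / 2 < of_rat p" "of_rat p < Re w"
    using of_rat_dense[of "Re w - \<delta> / 2" "Re w"] assms by auto
  obtain q where q: "Im w - \<delta> / 2 < of_rat q" "of_rat q < Im w"
    using of_rat_dense[of "Im w - \<delta> / 2" "Im w"] assms by auto
  have "cmod (w - Complex (of_rat p) (of_rat q)) \<le> \<bar>Re w - of_rat p\<bar> + \<bar>Im w - of_rat q\<bar>"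
    using cmod_le[of "w - Complex (of_rat p) (of_rat q)"] by simp
  also have "\<dots> < \<delta>" using p q by linarith
  finally show ?thesis by (intro exI[of _ "(p, q)"]) simp
qed

text \<open>The dense set consists of the finitely supported sequences with rational real and
  imaginary parts, coded by finite lists.\<close>

lemma separable_ell2: "separable_hilb ell2"
proof -
  define g :: "(rat \<times> rat) list \<Rightarrow> nat \<Rightarrow> complex" where
    "g l n = (if n < length l then Complex (of_rat (fst (l ! n))) (of_rat (snd (l ! n))) else 0)" for l n
  have gc: "g l \<in> carrier ell2" for l
  proof -
    have "finite {n \<in> UNIV. (cmod (g l n))\<^sup>2 \<noteq> 0}"
      by (rule finite_subset[of _ "{..<length l}"]) (auto simp: g_def)
    then show ?thesis unfolding ell2_simps by (rule finite_nonzero_values_imp_summable_on)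
  qed
  have "ell2.mtopology closure_of range g = carrier ell2"
    unfolding ell2.metric_closure_of
  proof (intro equalityI subsetI CollectI conjI allI impI)
    fix x and r :: real assume x: "x \<in> carrier ell2" and r: "r > 0"
    obtain F where F: "finite F" "dist (\<Sum>n\<in>F. (cmod (x n))\<^sup>2) (\<Sum>\<^sub>\<infinity>n. (cmod (x n))\<^sup>2) \<le> r\<^sup>2 / 8"
      using infsum_finite_approximation[of "\<lambda>n. (cmod (x n))\<^sup>2" UNIV "r\<^sup>2 / 8"] x r by auto
    then have tail: "(\<Sum>\<^sub>\<infinity>n. (cmod (x n))\<^sup>2) \<le> (\<Sum>n\<in>F. (cmod (x n))\<^sup>2) + r\<^sup>2 / 8"
      unfolding dist_real_def by linarith
    obtain N where N: "F \<subseteq> {..<N}" using F(1) finite_nat_iff_bounded by auto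
    \<comment> \<open>Chosen so that \<open>N\<close> coordinates contribute at most r^2/16; with
      the tail r^2/8 this stays below (r/2)^2. The summand 1 keeps the denominator positive when
      \<open>N\<close> is 0.\<close>
    define \<delta> where "\<delta> = r / (4 * sqrt (real N + 1))"
    have \<delta>: "\<delta> > 0" using r by (simp add: \<delta>_def)
    have N\<delta>: "real N * \<delta>\<^sup>2 \<le> r\<^sup>2 / 16"
      using r by (simp add: \<delta>_def power_divide power_mult_distrib field_simps)
    obtain p where p: "\<And>n. cmod (x n - Complex (of_rat (fst (p n))) (of_rat (snd (p n)))) < \<delta>"
      using choice[OF allI[OF complex_rational_approximation[OF \<delta>]], of x] by blast
    define l where "l = map p [0..<N]"
    have lo: "(cmod (x n - g l n))\<^sup>2 \<le> \<delta>\<^sup>2" if "n < N" for n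
      using p[of n] that \<delta> by (intro power_mono) (auto simp: g_def l_def)
    have hi: "g l n = 0" if "\<not> n < N" for n using that by (simp add: g_def l_def)
    have "(\<Sum>n\<in>G. (cmod (x n - g l n))\<^sup>2) \<le> (r / 2)\<^sup>2" if G: "finite G" for G
    proof -
      have "(\<Sum>n\<in>G. (cmod (x n - g l n))\<^sup>2) =
          (\<Sum>n\<in>G \<inter> {..<N}. (cmod (x n - g l n))\<^sup>2) + (\<Sum>n\<in>G - {..<N}. (cmod (x n - g l n))\<^sup>2)"
        using G by (rule sum.Int_Diff)
      also have "(\<Sum>n\<in>G \<inter> {..<N}. (cmod (x n - g l n))\<^sup>2) \<le> (\<Sum>n\<in>G \<inter> {..<N}. \<delta>\<^sup>2)"
        by (rule sum_mono) (use lo in auto)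
      also have "\<dots> \<le> real N * \<delta>\<^sup>2"
        using card_mono[of "{..<N}" "G \<inter> {..<N}"] by (simp add: mult_right_mono)
      also have "(\<Sum>n\<in>G - {..<N}. (cmod (x n - g l n))\<^sup>2) = (\<Sum>n\<in>G - {..<N}. (cmod (x n))\<^sup>2)"
        by (rule sum.cong) (auto simp: hi)
      also have "\<dots> \<le> r\<^sup>2 / 8"
      proof -
        have "(\<Sum>n\<in>F \<union> (G - {..<N}). (cmod (x n))\<^sup>2) =
            (\<Sum>n\<in>F. (cmod (x n))\<^sup>2) + (\<Sum>n\<in>G - {..<N}. (cmod (x n))\<^sup>2)"
          using F(1) G N by (intro sum.union_disjoint) auto
        moreover have "(\<Sum>n\<in>F \<union> (G - {..<N}). (cmod (x n))\<^sup>2) \<le> (\<Sum>\<^sub>\<infinity>n. (cmod (x n))\<^sup>2)"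
          using F(1) G x by (intro finite_sum_le_infsum) auto
        ultimately show ?thesis using tail by linarith
      qed
      finally have "(\<Sum>n\<in>G. (cmod (x n - g l n))\<^sup>2) \<le> real N * \<delta>\<^sup>2 + r\<^sup>2 / 8" by simp
      also have "\<dots> \<le> (r / 2)\<^sup>2" using N\<delta> zero_le_power2[of r] unfolding power_divide power2_eq_square[of 2] by linarith
      finally show ?thesis .
    qed
    then have "hnorm ell2 (\<lambda>n. x n - g l n) \<le> r / 2"
      using r by (intro ell2_hnorm_le(2)) auto
    then have "g l \<in> ell2.mball x r"
      using x gc[of l] r unfolding ell2.in_mball hdist_def by (simp add: ell2_minus[OF x gc])
    then show "\<exists>y\<in>range g. y \<in> ell2.mball x r" by blast
  qed auto
  moreover have "countable (range g)" by simp
  ultimately show ?thesis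
    unfolding separable_hilb_def separable_space_def ell2.topspace_mtopology
    using gc by (intro exI[of _ "range g"]) auto
qed

text \<open>\<open>h\<close> is a finitely supported linear functional killing \<open>B\<close>. The
  lower bound \<open>N\<close> on its support serves the induction: two functionals killing
  \<open>B\<close> with disjoint supports always have a non-trivial combination that also kills one
  further vector.\<close>

lemma ell2_finite_annihilator:
  fixes B :: "(nat \<Rightarrow> complex) set"
  assumes "finite B"
  shows "\<exists>h M. (\<forall>n. h n \<noteq> 0 \<longrightarrow> N \<le> n \<and> n < M) \<and> (\<exists>n. h n \<noteq> 0) \<and>
    (\<forall>b\<in>B. (\<Sum>n<M. h n * b n) = 0)"
  using assms
proof (induction B arbitrary: N rule: finite_induct)
  case empty
  then show ?case
    by (intro exI[of _ "ell2_unit N"] exI[of _ "Suc N"]) (auto simp: ell2_unit_def)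
next
  case (insert b B)
  obtain h M where "(\<forall>n. h n \<noteq> 0 \<longrightarrow> N \<le> n \<and> n < M) \<and> (\<exists>n. h n \<noteq> 0) \<and>
      (\<forall>b\<in>B. (\<Sum>n<M. h n * b n) = 0)"
    using insert.IH[of N] by (elim exE)
  then have h: "\<And>n. h n \<noteq> 0 \<Longrightarrow> N \<le> n \<and> n < M" "\<exists>n. h n \<noteq> 0"
    "\<And>b. b \<in> B \<Longrightarrow> (\<Sum>n<M. h n * b n) = 0"
    by blast+
  obtain k L where "(\<forall>n. k n \<noteq> 0 \<longrightarrow> M \<le> n \<and> n < L) \<and> (\<exists>n. k n \<noteq> 0) \<and>
      (\<forall>b\<in>B. (\<Sum>n<L. k n * b n) = 0)"
    using insert.IH[of M] by (elim exE)
  then have k: "\<And>n. k n \<noteq> 0 \<Longrightarrow> M \<le> n \<and> n < L" "\<exists>n. k n \<noteq> 0"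
    "\<And>b. b \<in> B \<Longrightarrow> (\<Sum>n<L. k n * b n) = 0"
    by blast+
  have NM: "N \<le> M" "M \<le> L" using h(1,2) k(1,2) by (meson le_less_trans less_imp_le le_trans)+
  have hL: "(\<Sum>n<L. h n * c n) = (\<Sum>n<M. h n * c n)" for c :: "nat \<Rightarrow> complex"
    by (rule sum.mono_neutral_right) (use NM h(1) in force)+
  define f where "f = (\<Sum>n<L. h n * b n)"
  define g where "g = (\<Sum>n<L. k n * b n)"
  show ?case
  proof (cases "f = 0")
    case True
    then show ?thesis
      using h NM hL by (intro exI[of _ h] exI[of _ M]) (auto simp: f_def)
  next
    case False
    \<comment> \<open>At \<open>b\<close> the functionals \<open>k\<close> and \<open>h\<close> take
      the values \<open>g\<close> and \<open>f\<close>, so the cross combination vanishes there; it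
      is non-zero because \<open>f\<close> is and the supports are disjoint.\<close>
    define w where "w n = f * k n - g * h n" for n
    have wsum: "(\<Sum>n<L. w n * c n) = f * (\<Sum>n<L. k n * c n) - g * (\<Sum>n<L. h n * c n)" for c
      by (simp add: w_def sum_subtractf sum_distrib_left algebra_simps)
    obtain m where m: "k m \<noteq> 0" using k(2) by auto
    then have "h m = 0" using h(1)[of m] k(1)[of m] by auto
    then have "w m \<noteq> 0" using m False by (simp add: w_def)
    moreover have "N \<le> n \<and> n < L" if "w n \<noteq> 0" for n
      using that h(1)[of n] k(1)[of n] NM by (cases "k n = 0"; cases "h n = 0") (auto simp: w_def)
    moreover have "(\<Sum>n<L. w n * c n) = 0" if "c \<in> insert b B" for c
    proof (cases "c = b")
      case True
      then show ?thesis by (simp add: wsum flip: f_def g_def)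
    next
      case False
      then show ?thesis using that h(3) k(3) by (simp add: wsum hL)
    qed
    ultimately show ?thesis by (intro exI[of _ w] exI[of _ L]) blast
  qed
qed

text \<open>A finite spanning set would lie in the kernel of a non-zero finitely supported
  functional, which is a submodule missing some unit vector.\<close>

lemma infinite_dimensional_ell2: "infinite_dimensional ell2"
  unfolding infinite_dimensional_def
proof (intro allI impI notI)
  fix B assume B: "finite B \<and> B \<subseteq> carrier ell2"
    and hull: "(\<lambda>V. submodule V complex_ring ell2) hull B = carrier ell2"
  obtain h M where "(\<forall>n. h n \<noteq> 0 \<longrightarrow> 0 \<le> n \<and> n < M) \<and> (\<exists>n. h n \<noteq> 0) \<and>
      (\<forall>b\<in>B. (\<Sum>n<M. h n * b n) = 0)"
    using ell2_finite_annihilator[of B 0] B by blast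
  then have h: "\<And>n. h n \<noteq> 0 \<Longrightarrow> n < M" "\<exists>n. h n \<noteq> 0"
    "\<And>b. b \<in> B \<Longrightarrow> (\<Sum>n<M. h n * b n) = 0"
    by blast+
  define V where "V = {x \<in> carrier ell2. (\<Sum>n<M. h n * x n) = 0}"
  have add: "x \<oplus>\<^bsub>ell2\<^esub> y \<in> V" if "x \<in> V" "y \<in> V" for x y
    using that ell2.M.a_closed[of x y] by (auto simp: V_def algebra_simps sum.distrib)
  have sm: "c \<odot>\<^bsub>ell2\<^esub> x \<in> V" if "x \<in> V" for c x
  proof -
    have "(\<Sum>n<M. h n * (c * x n)) = c * (\<Sum>n<M. h n * x n)"
      by (simp add: sum_distrib_left algebra_simps)
    then show ?thesis using that ell2.smult_closed[of c x] by (auto simp: V_def)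
  qed
  have "submodule V complex_ring ell2"
  proof (rule ell2.submoduleI)
    show "\<ominus>\<^bsub>ell2\<^esub> x \<in> V" if "x \<in> V" for x
    proof -
      have "(- 1) \<odot>\<^bsub>ell2\<^esub> x = \<ominus>\<^bsub>ell2\<^esub> x"
        by (rule ell2.smult_minus_one) (use that in \<open>simp add: V_def\<close>)
      then show ?thesis using sm[OF that, of "- 1"] by (simp only:)
    qed
  qed (use add sm in \<open>auto simp: V_def\<close>)
  moreover have "B \<subseteq> V" using B h(3) by (auto simp: V_def)
  ultimately have "(\<lambda>V. submodule V complex_ring ell2) hull B \<subseteq> V"
    by (auto simp: hull_def)
  moreover obtain n where n: "h n \<noteq> 0" using h(2) by auto
  have "(\<Sum>i<M. h i * ell2_unit n i) = h n"
    using h(1)[OF n] by (simp add: ell2_unit_def if_distrib[of "\<lambda>z. h _ * z"] sum.delta cong: if_cong)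
  then have "ell2_unit n \<notin> V" using n by (simp add: V_def)
  ultimately show False using hull ell2_unit_carrier[of n] by blast
qed

section \<open>Multiplication in a product system\<close>

lemma elem_tensor_carrier:
  assumes "hilbert_space H" and "hilbert_space K" and x: "x \<in> carrier H" and y: "y \<in> carrier K"
  shows "elem_tensor H K x y \<in> carrier (hilb_tensor H K)"
proof -
  interpret H: hilbert_space H by fact
  interpret K: hilbert_space K by fact
  have "antilinear_op K H (elem_tensor H K x y)"
    unfolding antilinear_op_def
  proof (intro conjI ballI allI)
    show "elem_tensor H K x y \<in> carrier K \<rightarrow> carrier H"
      using x by (auto simp: elem_tensor_def)
    fix z assume z: "z \<in> carrier K"
    show "elem_tensor H K x y (c \<odot>\<^bsub>K\<^esub> z) = cnj c \<odot>\<^bsub>H\<^esub> elem_tensor H K x y z" for c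
      by (rule H.hinner_ext)
        (use x y z in \<open>simp_all add: elem_tensor_def H.hinner_smult_left K.hinner_smult_right\<close>)
    show "elem_tensor H K x y (z \<oplus>\<^bsub>K\<^esub> w) = elem_tensor H K x y z \<oplus>\<^bsub>H\<^esub> elem_tensor H K x y w"
      if "w \<in> carrier K" for w
      by (rule H.hinner_ext)
        (use x y z that in \<open>simp_all add: elem_tensor_def H.hinner_smult_left H.hinner_add_left
          K.hinner_add_right algebra_simps\<close>)
  qed
  moreover have "bounded_op K H (elem_tensor H K x y)"
    unfolding bounded_op_def
  proof (intro exI ballI)
    fix z assume z: "z \<in> carrier K"
    show "hnorm H (elem_tensor H K x y z) \<le> (hnorm H x * hnorm K y) * hnorm K z"
      using mult_right_mono[OF K.Cauchy_Schwarz[OF y z] H.hnorm_nonneg[OF x]] x z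
      by (simp add: elem_tensor_def H.hnorm_smult mult_ac)
  qed
  moreover have "(\<lambda>e. (hnorm H (elem_tensor H K x y e))\<^sup>2) summable_on some_onb K"
  proof -
    have on: "orthonormal K (\<lambda>b. b) (some_onb K)"
      using K.some_onb by (simp add: onb_family_def)
    have "(\<lambda>e. (hnorm H x)\<^sup>2 * (cmod (hinner K y e))\<^sup>2) summable_on some_onb K"
      by (intro summable_on_cmult_right K.Bessel(1)[OF on y])
    moreover have "(hnorm H (elem_tensor H K x y e))\<^sup>2 = (hnorm H x)\<^sup>2 * (cmod (hinner K y e))\<^sup>2"
      if "e \<in> some_onb K" for e
      using K.orthonormal_closed[OF on that] x
      by (simp add: elem_tensor_def H.hnorm_smult power_mult_distrib)
    ultimately show ?thesis by (simp cong: summable_on_cong)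
  qed
  ultimately show ?thesis
    using x by (auto simp: hilb_tensor_def elem_tensor_def)
qed

lemma elem_tensor_hinner:
  assumes "hilbert_space H" and "hilbert_space K"
    and x: "x \<in> carrier H" "x' \<in> carrier H" and y: "y \<in> carrier K" "y' \<in> carrier K"
  shows "hinner (hilb_tensor H K) (elem_tensor H K x y) (elem_tensor H K x' y')
    = hinner H x x' * hinner K y y'"
proof -
  interpret H: hilbert_space H by fact
  interpret K: hilbert_space K by fact
  have on: "orthonormal K (\<lambda>b. b) (some_onb K)"
    using K.some_onb by (simp add: onb_family_def)
  have "((\<lambda>e. hinner H x x' * (hinner K y e * cnj (hinner K y' e))) has_sum
      (hinner H x x' * hinner K y y')) (some_onb K)"
    by (intro has_sum_cmult_right K.Parseval[OF K.some_onb] y)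
  moreover have "hinner H (elem_tensor H K x y e) (elem_tensor H K x' y' e) =
      hinner H x x' * (hinner K y e * cnj (hinner K y' e))" if "e \<in> some_onb K" for e
    using K.orthonormal_closed[OF on that] x
    by (simp add: elem_tensor_def H.hinner_smult_left H.hinner_smult_right)
  ultimately have "((\<lambda>e. hinner H (elem_tensor H K x y e) (elem_tensor H K x' y' e)) has_sum
      (hinner H x x' * hinner K y y')) (some_onb K)"
    by (simp cong: has_sum_cong)
  then show ?thesis by (simp add: hilb_tensor_def infsumI)
qed

text \<open>Against the tensor of \<open>x\<close> with a basis vector \<open>b\<close>, the inner
  product collapses to the single term \<open>hinner H (A b) x\<close>, so \<open>A\<close> vanishes
  on the basis. Since \<open>A\<close> is antilinear, \<open>z \<mapsto> hinner H h (A z)\<close> is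
  a bounded linear functional and vanishes everywhere.\<close>

lemma elem_tensor_total:
  assumes "hilbert_space H" and "hilbert_space K" and A: "A \<in> carrier (hilb_tensor H K)"
    and orth: "\<And>x y. x \<in> carrier H \<Longrightarrow> y \<in> carrier K \<Longrightarrow>
      hinner (hilb_tensor H K) A (elem_tensor H K x y) = 0"
  shows "A = \<zero>\<^bsub>hilb_tensor H K\<^esub>"
proof -
  interpret H: hilbert_space H by fact
  interpret K: hilbert_space K by fact
  have on: "orthonormal K (\<lambda>b. b) (some_onb K)" and tot: "total_in K (some_onb K)"
    using K.some_onb by (simp_all add: onb_family_def)
  have AE: "A \<in> carrier K \<rightarrow>\<^sub>E carrier H" and Aanti: "antilinear_op K H A" and "bounded_op K H A"
    using A by (auto simp: hilb_tensor_def)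
  then obtain C where C: "\<And>z. z \<in> carrier K \<Longrightarrow> hnorm H (A z) \<le> C * hnorm K z"
    by (auto simp: bounded_op_def)
  have Ac: "A z \<in> carrier H" if "z \<in> carrier K" for z using AE that by auto
  have Ab: "A b = \<zero>\<^bsub>H\<^esub>" if b: "b \<in> some_onb K" for b
  proof -
    have bc: "b \<in> carrier K" using K.orthonormal_closed[OF on b] .
    have "hinner H (A b) x = 0" if x: "x \<in> carrier H" for x
    proof -
      have "((\<lambda>e. hinner H (A e) (elem_tensor H K x b e)) has_sum hinner H (A b) x) (some_onb K)"
      proof (rule has_sum_finite_neutralI[of "{b}"])
        fix e assume e: "e \<in> some_onb K - {b}"
        then have "elem_tensor H K x b e = 0 \<odot>\<^bsub>H\<^esub> x"
          using K.orthonormal_closed[OF on] K.orthonormal_hinner[OF on b, of e]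
          by (auto simp: elem_tensor_def)
        then show "hinner H (A e) (elem_tensor H K x b e) = 0"
          using e x K.orthonormal_closed[OF on] Ac by (simp add: H.hinner_smult_right)
      next
        have "elem_tensor H K x b b = 1 \<odot>\<^bsub>H\<^esub> x"
          using bc K.orthonormal_hinner[OF on b b] by (auto simp: elem_tensor_def)
        then show "hinner H (A b) x = (\<Sum>e\<in>{b}. hinner H (A e) (elem_tensor H K x b e))"
          using x Ac[OF bc] by (simp add: H.hinner_smult_right)
      qed (use b in auto)
      then have "hinner (hilb_tensor H K) A (elem_tensor H K x b) = hinner H (A b) x"
        by (simp add: hilb_tensor_def infsumI)
      then show ?thesis using orth[OF x bc] by simp
    qed
    then show ?thesis using Ac[OF bc] H.hinner_definite by blast
  qed
  have "A z = \<zero>\<^bsub>H\<^esub>" if z: "z \<in> carrier K" for z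
  proof -
    have "hinner H h (A z) = 0" if h: "h \<in> carrier H" for h
    proof (rule K.functional_vanish[OF tot _ _ z])
      have "cmod (hinner H h (A w)) \<le> (hnorm H h * C) * hnorm K w" if w: "w \<in> carrier K" for w
      proof -
        have "cmod (hinner H h (A w)) \<le> hnorm H h * hnorm H (A w)"
          by (rule H.Cauchy_Schwarz[OF h Ac[OF w]])
        also have "\<dots> \<le> hnorm H h * (C * hnorm K w)"
          by (rule mult_left_mono[OF C[OF w] H.hnorm_nonneg[OF h]])
        finally show ?thesis by simp
      qed
      then show "bounded_functional K (\<lambda>z. hinner H h (A z))"
        using Aanti h Ac unfolding bounded_functional_def antilinear_op_def
        by (intro conjI exI[of _ "hnorm H h * C"])
          (auto simp: H.hinner_add_right H.hinner_smult_right)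
    qed (simp add: Ab H.hinner_zero_right h)
    then show ?thesis using Ac[OF z] H.hinner_definite by blast
  qed
  then show ?thesis
    using AE by (auto simp: hilb_tensor_def fun_eq_iff PiE_def extensional_def)
qed

section \<open>Multiplication in a product system, expressed by inner products and totality\<close>

locale semigroup_product_system = product_system +
  assumes zero_mem: "0 \<in> S"
    and add_closed: "s \<in> S \<Longrightarrow> t \<in> S \<Longrightarrow> s + t \<in> S"
begin

lemma fibre_inner: "s \<in> S \<Longrightarrow> inner_product_space (E s)"
  using fibre_hilbert hilbert_space.axioms(1) by blast

lemma mult_hinner:
  assumes s: "s \<in> S" and t: "t \<in> S" and "x \<in> carrier (E s)" "x' \<in> carrier (E s)"
    "y \<in> carrier (E t)" "y' \<in> carrier (E t)"
  shows "hinner (E (s + t)) (\<mu> s t x y) (\<mu> s t x' y') = hinner (E s) x x' * hinner (E t) y y'"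
proof -
  note H = fibre_hilbert[OF s] and K = fibre_hilbert[OF t]
  obtain u where u: "unitary_op (hilb_tensor (E s) (E t)) (E (s + t)) u"
    "\<And>x y. x \<in> carrier (E s) \<Longrightarrow> y \<in> carrier (E t) \<Longrightarrow>
      u (elem_tensor (E s) (E t) x y) = \<mu> s t x y"
    using mult_unitary[OF s t] by auto
  show ?thesis
    using u(1) assms elem_tensor_carrier[OF H K] elem_tensor_hinner[OF H K]
    by (simp add: u(2)[symmetric] unitary_op_def)
qed

text \<open>Together with \<open>mult_hinner\<close> this is all that is used of the unitary from
  the tensor product; tensors do not occur in the rest of the argument.\<close>

lemma mult_total:
  assumes s: "s \<in> S" and t: "t \<in> S"
  shows "total_in (E (s + t)) {\<mu> s t x y | x y. x \<in> carrier (E s) \<and> y \<in> carrier (E t)}"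
  unfolding total_in_def
proof (intro conjI ballI impI)
  show "{\<mu> s t x y | x y. x \<in> carrier (E s) \<and> y \<in> carrier (E t)} \<subseteq> carrier (E (s + t))"
    using mult_closed[OF s t] by auto
  note H = fibre_hilbert[OF s] and K = fibre_hilbert[OF t]
  interpret HK: inner_product_space "E (s + t)" by (rule fibre_inner[OF add_closed[OF s t]])
  let ?T = "hilb_tensor (E s) (E t)"
  fix z assume z: "z \<in> carrier (E (s + t))"
    and orth: "\<forall>v\<in>{\<mu> s t x y | x y. x \<in> carrier (E s) \<and> y \<in> carrier (E t)}. hinner (E (s + t)) z v = 0"
  obtain u where u: "unitary_op ?T (E (s + t)) u"
    "\<And>x y. x \<in> carrier (E s) \<Longrightarrow> y \<in> carrier (E t) \<Longrightarrow>
      u (elem_tensor (E s) (E t) x y) = \<mu> s t x y"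
    using mult_unitary[OF s t] by auto
  have "z \<in> u ` carrier ?T"
    using u(1) z by (simp add: unitary_op_def bij_betw_def)
  then obtain A where A: "A \<in> carrier ?T" "z = u A" by blast
  have "A = \<zero>\<^bsub>?T\<^esub>"
  proof (rule elem_tensor_total[OF H K A(1)])
    fix x y assume xy: "x \<in> carrier (E s)" "y \<in> carrier (E t)"
    have "hinner (E (s + t)) (u A) (u (elem_tensor (E s) (E t) x y)) =
        hinner ?T A (elem_tensor (E s) (E t) x y)"
      using u(1) A(1) elem_tensor_carrier[OF H K xy] by (auto simp: unitary_op_def)
    then show "hinner ?T A (elem_tensor (E s) (E t) x y) = 0"
      using bspec[OF orth, of "\<mu> s t x y"] xy u(2)[OF xy] A(2) by auto
  qed
  moreover have "hinner (E (s + t)) (u A) (u A) = hinner ?T A A"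
    using u(1) A(1) by (auto simp: unitary_op_def)
  \<comment> \<open>Computed from the definition, since no Hilbert space structure on the tensor
    product has been established.\<close>
  moreover have "hinner ?T \<zero>\<^bsub>?T\<^esub> \<zero>\<^bsub>?T\<^esub> = 0"
  proof -
    interpret H: hilbert_space "E s" by (rule H)
    interpret K: hilbert_space "E t" by (rule K)
    have on: "orthonormal (E t) (\<lambda>b. b) (some_onb (E t))"
      using K.some_onb by (simp add: onb_family_def)
    show ?thesis
      using K.orthonormal_closed[OF on]
      by (auto simp: hilb_tensor_def H.hinner_zero_left cong: infsum_cong)
  qed
  ultimately have "hinner (E (s + t)) z z = 0" using A(2) by simp
  then show "z = \<zero>\<^bsub>E (s + t)\<^esub>" using z HK.hinner_definite by blast
qed

text \<open>Linearity is hidden in the unitary of \<open>mult_unitary\<close>. It is recovered by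
  testing against products, where \<open>mult_hinner\<close> reduces it to the inner product of
  \<open>E s\<close>.\<close>

lemma mult_add_left:
  assumes s: "s \<in> S" and t: "t \<in> S" and x: "x \<in> carrier (E s)" "x' \<in> carrier (E s)"
    and y: "y \<in> carrier (E t)"
  shows "\<mu> s t (x \<oplus>\<^bsub>E s\<^esub> x') y = \<mu> s t x y \<oplus>\<^bsub>E (s + t)\<^esub> \<mu> s t x' y"
proof -
  interpret H: inner_product_space "E s" by (rule fibre_inner[OF s])
  interpret HK: inner_product_space "E (s + t)" by (rule fibre_inner[OF add_closed[OF s t]])
  show ?thesis
    by (rule HK.hinner_ext_total[OF mult_total[OF s t]])
      (use s t x y in \<open>auto simp: mult_closed mult_hinner HK.hinner_add_left H.hinner_add_left
        algebra_simps\<close>)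
qed

lemma mult_smult_left:
  assumes s: "s \<in> S" and t: "t \<in> S" and x: "x \<in> carrier (E s)" and y: "y \<in> carrier (E t)"
  shows "\<mu> s t (c \<odot>\<^bsub>E s\<^esub> x) y = c \<odot>\<^bsub>E (s + t)\<^esub> \<mu> s t x y"
proof -
  interpret H: inner_product_space "E s" by (rule fibre_inner[OF s])
  interpret HK: inner_product_space "E (s + t)" by (rule fibre_inner[OF add_closed[OF s t]])
  show ?thesis
    by (rule HK.hinner_ext_total[OF mult_total[OF s t]])
      (use s t x y in \<open>auto simp: mult_closed mult_hinner HK.hinner_smult_left H.hinner_smult_left\<close>)
qed

lemma one_exists:
  obtains e where "e \<in> carrier (E 0)" "hinner (E 0) e e = 1"
    "\<And>s x. s \<in> S \<Longrightarrow> x \<in> carrier (E s) \<Longrightarrow> \<mu> 0 s e x = x"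
    "\<And>s x. s \<in> S \<Longrightarrow> x \<in> carrier (E s) \<Longrightarrow> \<mu> s 0 x e = x"
proof -
  obtain j where j: "unitary_op complex_hilb (E 0) j"
    "\<And>s c x. s \<in> S \<Longrightarrow> x \<in> carrier (E s) \<Longrightarrow> \<mu> 0 s (j c) x = c \<odot>\<^bsub>E s\<^esub> x \<and> \<mu> s 0 x (j c) = c \<odot>\<^bsub>E s\<^esub> x"
    using zero_fibre by blast
  have one: "1 \<odot>\<^bsub>E s\<^esub> x = x" if "s \<in> S" "x \<in> carrier (E s)" for s x
  proof -
    interpret H: inner_product_space "E s" by (rule fibre_inner[OF that(1)])
    show ?thesis by (rule H.hinner_ext) (use that in \<open>simp_all add: H.hinner_smult_left\<close>)
  qed
  show ?thesis
  proof (rule that[of "j 1"])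
    show "j 1 \<in> carrier (E 0)"
      using j(1) by (auto simp: unitary_op_def linear_op_def complex_hilb_def)
    show "hinner (E 0) (j 1) (j 1) = 1"
      using j(1) by (auto simp: unitary_op_def complex_hilb_def)
  qed (simp_all add: j(2) one)
qed

end

section \<open>The semigroup of an essential representation\<close>

lemma op_apply:
  "x \<in> carrier H \<Longrightarrow> op_id H x = x"
  "x \<in> carrier H \<Longrightarrow> op_add H R T x = R x \<oplus>\<^bsub>H\<^esub> T x"
  "x \<in> carrier H \<Longrightarrow> op_smult H c T x = c \<odot>\<^bsub>H\<^esub> T x"
  by (simp_all add: op_id_def op_add_def op_smult_def)

lemma (in hilbert_space) hinner_operator_bound:
  assumes A: "A \<in> bop H" and C: "C \<ge> 0" "\<And>x. x \<in> carrier H \<Longrightarrow> hnorm H (A x) \<le> C * hnorm H x"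
    and x: "x \<in> carrier H" and y: "y \<in> carrier H"
  shows "cmod (hinner H (A x) y) \<le> C * hnorm H x * hnorm H y"
  using Cauchy_Schwarz[OF bop_closed[OF A x] y] mult_right_mono[OF C(2)[OF x] hnorm_nonneg[OF y]]
  by linarith

text \<open>Let \<open>R\<close> commute with the rank-one operator sending z to <z,h> x and
  evaluate at \<open>h\<close>: the squared norm of \<open>h\<close> times \<open>R x\<close> is
  \<open>hinner H (R h) h\<close> times \<open>x\<close>.\<close>

lemma (in hilbert_space) commutant_scalar:
  assumes nz: "carrier H \<noteq> {\<zero>}" and R: "R \<in> bop H"
    and comm: "\<And>A x. A \<in> bop H \<Longrightarrow> x \<in> carrier H \<Longrightarrow> R (A x) = A (R x)"
  obtains c where "\<And>x. x \<in> carrier H \<Longrightarrow> R x = c \<odot> x"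
proof -
  obtain h where h: "h \<in> carrier H" "h \<noteq> \<zero>" using nz M.zero_closed by blast
  define r where "r = complex_of_real ((hnorm H h)\<^sup>2)"
  have hh: "hinner H h h = r" "r \<noteq> 0"
    using h hinner_self hnorm_zero_iff by (auto simp: r_def)
  show ?thesis
  proof (rule that[of "hinner H (R h) h / r"])
    fix x assume x: "x \<in> carrier H"
    obtain A where A: "A \<in> bop H" "\<And>z. z \<in> carrier H \<Longrightarrow> A z = hinner H z h \<odot> x"
      using rank_one_operator[OF h(1) x] by metis
    have "r \<odot> R x = hinner H (R h) h \<odot> x"
      using comm[OF A(1) h(1)] A(2) h(1) x hh bop_closed[OF R] bop_smult[OF R] by simp
    then have eq: "r * hinner H (R x) z = hinner H (R h) h * hinner H x z" if "z \<in> carrier H" for z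
      using hinner_smult_left[of "R x" z r] hinner_smult_left[OF x that] bop_closed[OF R x] that
      by simp
    show "R x = (hinner H (R h) h / r) \<odot> x"
    proof (rule hinner_ext)
      fix z assume "z \<in> carrier H"
      then show "hinner H (R x) z = hinner H ((hinner H (R h) h / r) \<odot> x) z"
        using eq[of z] hh(2) x by (simp add: hinner_smult_left field_simps)
    qed (use x bop_closed[OF R] in auto)
  qed
qed

text \<open>\<open>rep_hinner\<close> says weakly that the adjoint of \<open>\<phi> s y\<close>
  times \<open>\<phi> s x\<close> is the scalar <x,y>; \<open>rep_total\<close> says that the
  representation is essential. Linearity in the fibre variable follows from these two
  (\<open>rep_add\<close>, \<open>rep_smult\<close>).\<close>

locale product_system_representation = semigroup_product_system S E \<mu> + H: hilbert_space H
  for S :: "'i::monoid_add set" and E :: "'i \<Rightarrow> 'a hilb" and \<mu> and H :: "'h hilb" +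
  fixes \<phi> :: "'i \<Rightarrow> 'a \<Rightarrow> 'h \<Rightarrow> 'h"
  assumes rep_bop: "s \<in> S \<Longrightarrow> x \<in> carrier (E s) \<Longrightarrow> \<phi> s x \<in> bop H"
    and rep_hinner: "\<lbrakk>s \<in> S; x \<in> carrier (E s); y \<in> carrier (E s); h \<in> carrier H; k \<in> carrier H\<rbrakk> \<Longrightarrow>
      hinner H (\<phi> s x h) (\<phi> s y k) = hinner (E s) x y * hinner H h k"
    and rep_mult: "\<lbrakk>s \<in> S; t \<in> S; x \<in> carrier (E s); y \<in> carrier (E t)\<rbrakk> \<Longrightarrow>
      \<phi> (s + t) (\<mu> s t x y) = compose (carrier H) (\<phi> s x) (\<phi> t y)"
    and rep_total: "s \<in> S \<Longrightarrow> total_in H {\<phi> s x h | x h. x \<in> carrier (E s) \<and> h \<in> carrier H}"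
    and H_nonzero: "carrier H \<noteq> {\<zero>\<^bsub>H\<^esub>}"
begin

abbreviation "onb s \<equiv> some_onb (E s)"

definition "radj s x = op_adj H (\<phi> s x)"

lemma onb_closed: "s \<in> S \<Longrightarrow> b \<in> onb s \<Longrightarrow> b \<in> carrier (E s)"
  using hilbert_space.axioms(1)[OF fibre_hilbert, of s]
  by (auto simp: onb_family_def orthonormal_def
      dest!: inner_product_space.some_onb)

lemma rep_closed: "s \<in> S \<Longrightarrow> x \<in> carrier (E s) \<Longrightarrow> h \<in> carrier H \<Longrightarrow> \<phi> s x h \<in> carrier H"
  using H.bop_closed rep_bop by blast

lemma radj_closed: "s \<in> S \<Longrightarrow> x \<in> carrier (E s) \<Longrightarrow> h \<in> carrier H \<Longrightarrow> radj s x h \<in> carrier H"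
  unfolding radj_def using H.op_adj_bop H.bop_closed rep_bop by blast

lemma radj_hinner:
  "\<lbrakk>s \<in> S; x \<in> carrier (E s); h \<in> carrier H; k \<in> carrier H\<rbrakk> \<Longrightarrow>
    hinner H (radj s x h) k = hinner H h (\<phi> s x k)"
  unfolding radj_def by (simp add: H.op_adj_hinner' rep_bop)

lemma radj_add:
  "\<lbrakk>s \<in> S; x \<in> carrier (E s); h \<in> carrier H; k \<in> carrier H\<rbrakk> \<Longrightarrow>
    radj s x (h \<oplus>\<^bsub>H\<^esub> k) = radj s x h \<oplus>\<^bsub>H\<^esub> radj s x k"
  unfolding radj_def by (simp add: H.bop_add H.op_adj_bop rep_bop)

lemma radj_smult:
  "\<lbrakk>s \<in> S; x \<in> carrier (E s); h \<in> carrier H\<rbrakk> \<Longrightarrow> radj s x (c \<odot>\<^bsub>H\<^esub> h) = c \<odot>\<^bsub>H\<^esub> radj s x h"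
  unfolding radj_def by (simp add: H.bop_smult H.op_adj_bop rep_bop)

lemma radj_rep:
  assumes "s \<in> S" "x \<in> carrier (E s)" "y \<in> carrier (E s)" "h \<in> carrier H"
  shows "radj s x (\<phi> s y h) = hinner (E s) y x \<odot>\<^bsub>H\<^esub> h"
  by (rule H.hinner_ext)
    (use assms in \<open>simp_all add: radj_closed rep_closed radj_hinner rep_hinner H.hinner_smult_left\<close>)

lemma rep_add:
  assumes s: "s \<in> S" and "x \<in> carrier (E s)" "y \<in> carrier (E s)" "h \<in> carrier H"
  shows "\<phi> s (x \<oplus>\<^bsub>E s\<^esub> y) h = \<phi> s x h \<oplus>\<^bsub>H\<^esub> \<phi> s y h"
proof -
  interpret Es: inner_product_space "E s" by (rule fibre_inner[OF s])
  show ?thesis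
    by (rule H.hinner_ext_total[OF rep_total[OF s]])
      (use assms in \<open>auto simp: rep_closed rep_hinner H.hinner_add_left Es.hinner_add_left algebra_simps\<close>)
qed

lemma rep_smult:
  assumes s: "s \<in> S" and "x \<in> carrier (E s)" "h \<in> carrier H"
  shows "\<phi> s (c \<odot>\<^bsub>E s\<^esub> x) h = c \<odot>\<^bsub>H\<^esub> \<phi> s x h"
proof -
  interpret Es: inner_product_space "E s" by (rule fibre_inner[OF s])
  show ?thesis
    by (rule H.hinner_ext_total[OF rep_total[OF s]])
      (use assms in \<open>auto simp: rep_closed rep_hinner H.hinner_smult_left Es.hinner_smult_left\<close>)
qed

text \<open>This allows \<open>\<phi> s x\<close> to be expanded along an orthonormal basis of the
  fibre, and makes vanishing on that basis sufficient.\<close>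

lemma rep_functional:
  assumes s: "s \<in> S" and h: "h \<in> carrier H" and k: "k \<in> carrier H"
  shows "bounded_functional (E s) (\<lambda>x. hinner H (\<phi> s x h) k)"
  unfolding bounded_functional_def
proof (intro conjI ballI allI exI)
  interpret Es: inner_product_space "E s" by (rule fibre_inner[OF s])
  fix x assume x: "x \<in> carrier (E s)"
  show "hinner H (\<phi> s (c \<odot>\<^bsub>E s\<^esub> x) h) k = c * hinner H (\<phi> s x h) k" for c
    using s x h k by (simp add: rep_smult H.hinner_smult_left rep_closed)
  show "hinner H (\<phi> s (x \<oplus>\<^bsub>E s\<^esub> y) h) k = hinner H (\<phi> s x h) k + hinner H (\<phi> s y h) k"
    if "y \<in> carrier (E s)" for y
    using s x h k that by (simp add: rep_add H.hinner_add_left rep_closed)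
  have "(hnorm H (\<phi> s x h))\<^sup>2 = (hnorm (E s) x * hnorm H h)\<^sup>2"
    using rep_hinner[OF s x x h h] Es.hinner_self[OF x] H.hinner_self[OF h]
    by (simp add: H.hnorm_sq[OF rep_closed[OF s x h]] power_mult_distrib flip: of_real_mult of_real_power)
  then have "hnorm H (\<phi> s x h) = hnorm (E s) x * hnorm H h"
    using Es.hnorm_nonneg[OF x] H.hnorm_nonneg[OF h] H.hnorm_nonneg[OF rep_closed[OF s x h]]
    by (simp add: power2_eq_iff_nonneg)
  then show "cmod (hinner H (\<phi> s x h) k) \<le> (hnorm H h * hnorm H k) * hnorm (E s) x"
    using H.Cauchy_Schwarz[OF rep_closed[OF s x h] k] by (simp add: mult_ac)
qed

lemma rep_onb_total:
  assumes s: "s \<in> S" and k: "k \<in> carrier H"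
    and orth: "\<And>b h. b \<in> onb s \<Longrightarrow> h \<in> carrier H \<Longrightarrow> hinner H k (\<phi> s b h) = 0"
  shows "k = \<zero>\<^bsub>H\<^esub>"
proof -
  interpret Es: hilbert_space "E s" by (rule fibre_hilbert[OF s])
  have tot: "total_in (E s) (onb s)"
    using Es.some_onb by (simp add: onb_family_def)
  have "hinner H (\<phi> s x h) k = 0" if x: "x \<in> carrier (E s)" and h: "h \<in> carrier H" for x h
  proof (rule Es.functional_vanish[OF tot rep_functional[OF s h k] _ x])
    fix b assume b: "b \<in> onb s"
    show "hinner H (\<phi> s b h) k = 0"
      using orth[OF b h] H.hinner_commute[OF k rep_closed[OF s onb_closed[OF s b] h]] by simp
  qed
  then have "hinner H k (\<phi> s x h) = 0" if x: "x \<in> carrier (E s)" and h: "h \<in> carrier H" for x h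
    using H.hinner_commute[OF rep_closed[OF s x h] k] that by simp
  then show ?thesis using rep_total[OF s] k by (auto simp: total_in_def)
qed

text \<open>The operators \<open>\<phi> s b\<close> are isometries with orthogonal ranges that
  together fill \<open>H\<close>, which amounts to identifying the tensor product of
  \<open>E s\<close> and \<open>H\<close> with \<open>H\<close>.\<close>

lemma rep_onb_basis:
  assumes s: "s \<in> S"
  shows "onb_family H (\<lambda>(b, i). \<phi> s b i) (onb s \<times> some_onb H)"
proof -
  interpret Es: hilbert_space "E s" by (rule fibre_hilbert[OF s])
  have on: "orthonormal (E s) (\<lambda>b. b) (onb s)"
    using Es.some_onb by (simp add: onb_family_def)
  have onH: "orthonormal H (\<lambda>b. b) (some_onb H)" and totH: "total_in H (some_onb H)"
    using H.some_onb by (simp_all add: onb_family_def)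
  note c = H.orthonormal_closed[OF onH] onb_closed[OF s] rep_closed[OF s]
  have 1: "orthonormal H (\<lambda>(b, i). \<phi> s b i) (onb s \<times> some_onb H)"
    using c by (auto simp: orthonormal_def rep_hinner[OF s]
        Es.orthonormal_hinner[OF on] H.orthonormal_hinner[OF onH])
  have "k = \<zero>\<^bsub>H\<^esub>"
    if k: "k \<in> carrier H" and orth: "\<And>b i. b \<in> onb s \<Longrightarrow> i \<in> some_onb H \<Longrightarrow> hinner H k (\<phi> s b i) = 0" for k
  proof (rule rep_onb_total[OF s k])
    fix b h assume b: "b \<in> onb s" and h: "h \<in> carrier H"
    have "radj s b k = \<zero>\<^bsub>H\<^esub>"
      by (rule H.hinner_ext_total[OF totH])
        (use b k c orth s in \<open>simp_all add: radj_closed radj_hinner H.hinner_zero_left\<close>)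
    then show "hinner H k (\<phi> s b h) = 0"
      using radj_hinner[OF s _ k h, of b] b c h by (simp add: H.hinner_zero_left)
  qed
  then show ?thesis
    unfolding onb_family_def total_in_def using 1 c by auto
qed

text \<open>The weak form of the statement that the range projections of the
  \<open>\<phi> s b\<close> sum to 1: Parseval over the pairs \<open>(b, i)\<close>, summed over
  \<open>i\<close> first.\<close>

lemma radj_has_sum:
  assumes s: "s \<in> S" and h: "h \<in> carrier H" and k: "k \<in> carrier H"
  shows "((\<lambda>b. hinner H (radj s b h) (radj s b k)) has_sum hinner H h k) (onb s)"
proof (rule has_sum_SigmaD)
  have onH: "orthonormal H (\<lambda>b. b) (some_onb H)"
    using H.some_onb by (simp_all add: onb_family_def)
  show "((\<lambda>p. hinner H h (case p of (b, i) \<Rightarrow> \<phi> s b i) * cnj (hinner H k (case p of (b, i) \<Rightarrow> \<phi> s b i)))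
      has_sum hinner H h k) (onb s \<times> some_onb H)"
    by (rule H.Parseval[OF rep_onb_basis[OF s] h k])
  fix b assume b: "b \<in> onb s"
  have "((\<lambda>i. hinner H (radj s b h) i * cnj (hinner H (radj s b k) i)) has_sum
      hinner H (radj s b h) (radj s b k)) (some_onb H)"
    by (rule H.Parseval[OF H.some_onb]) (use s b h k in \<open>auto intro!: radj_closed onb_closed\<close>)
  then show "((\<lambda>i. hinner H h (case (b, i) of (b, i) \<Rightarrow> \<phi> s b i) *
      cnj (hinner H k (case (b, i) of (b, i) \<Rightarrow> \<phi> s b i))) has_sum
      hinner H (radj s b h) (radj s b k)) (some_onb H)"
    by (subst has_sum_cong)
      (use s b h k in \<open>simp_all add: radj_hinner onb_closed H.orthonormal_closed[OF onH]\<close>)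
qed

lemma radj_norm_has_sum:
  assumes s: "s \<in> S" and h: "h \<in> carrier H"
  shows "((\<lambda>b. (hnorm H (radj s b h))\<^sup>2) has_sum (hnorm H h)\<^sup>2) (onb s)"
proof -
  have "((\<lambda>b. complex_of_real ((hnorm H (radj s b h))\<^sup>2)) has_sum of_real ((hnorm H h)\<^sup>2)) (onb s)"
    using radj_has_sum[OF s h h] unfolding H.hinner_self[OF h]
    by (subst has_sum_cong) (use s h in \<open>auto simp: H.hinner_self radj_closed onb_closed\<close>)
  then show ?thesis unfolding has_sum_of_real_iff .
qed

text \<open>The norms of \<open>radj s b h\<close> are square summable with sum |h|^2, so
  Cauchy-Schwarz passes the bound of \<open>A\<close> on to the sum.\<close>

lemma alpha_form:
  assumes s: "s \<in> S" and A: "A \<in> bop H"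
    and C: "C \<ge> 0" "\<And>x. x \<in> carrier H \<Longrightarrow> hnorm H (A x) \<le> C * hnorm H x"
    and h: "h \<in> carrier H" and k: "k \<in> carrier H"
  shows "(\<lambda>b. hinner H (A (radj s b h)) (radj s b k)) summable_on onb s"
    and "cmod (\<Sum>\<^sub>\<infinity>b\<in>onb s. hinner H (A (radj s b h)) (radj s b k)) \<le> C * hnorm H h * hnorm H k"
proof -
  note n = radj_norm_has_sum[OF s]
  have Cn: "((\<lambda>b. (C * hnorm H (radj s b h))\<^sup>2) has_sum (C * hnorm H h)\<^sup>2) (onb s)"
    unfolding power_mult_distrib by (rule has_sum_cmult_right[OF n[OF h]])
  have le: "cmod (hinner H (A (radj s b h)) (radj s b k)) \<le>
      C * hnorm H (radj s b h) * hnorm H (radj s b k)" if b: "b \<in> onb s" for b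
    using H.hinner_operator_bound[OF A C] radj_closed[OF s onb_closed[OF s b]] h k by blast
  note cs = l2_Cauchy_Schwarz[OF has_sum_imp_summable[OF Cn] has_sum_imp_summable[OF n[OF k]] le]
  show "(\<lambda>b. hinner H (A (radj s b h)) (radj s b k)) summable_on onb s" by (rule cs(2))
  show "cmod (\<Sum>\<^sub>\<infinity>b\<in>onb s. hinner H (A (radj s b h)) (radj s b k)) \<le> C * hnorm H h * hnorm H k"
    using cs(3) C(1) h k by (simp add: infsumI[OF Cn] infsumI[OF n] H.hnorm_nonneg)
qed

text \<open>Moving \<open>\<phi> s b\<close> to the other side of the inner product, the displayed
  series gives the matrix coefficients of the sum over \<open>b\<close> of \<open>\<phi> s b\<close>
  A \<open>radj s b\<close>. They determine \<open>T\<close>, so the choice is unique whenever the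
  series converges in this sense.\<close>

definition alpha :: "'i \<Rightarrow> ('h \<Rightarrow> 'h) \<Rightarrow> 'h \<Rightarrow> 'h" where
  "alpha s A = (SOME T. T \<in> bop H \<and> (\<forall>h\<in>carrier H. \<forall>k\<in>carrier H.
    ((\<lambda>b. hinner H (A (radj s b h)) (radj s b k)) has_sum hinner H (T h) k) (onb s)))"

lemma alpha:
  assumes s: "s \<in> S" and A: "A \<in> bop H"
  shows "alpha s A \<in> bop H \<and> (\<forall>h\<in>carrier H. \<forall>k\<in>carrier H.
    ((\<lambda>b. hinner H (A (radj s b h)) (radj s b k)) has_sum hinner H (alpha s A h) k) (onb s))"
proof -
  let ?P = "\<lambda>T. T \<in> bop H \<and> (\<forall>h\<in>carrier H. \<forall>k\<in>carrier H.
    ((\<lambda>b. hinner H (A (radj s b h)) (radj s b k)) has_sum hinner H (T h) k) (onb s))"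
  obtain C where C: "C \<ge> 0" "\<And>x. x \<in> carrier H \<Longrightarrow> hnorm H (A x) \<le> C * hnorm H x"
    using H.bop_bound[OF A] by metis
  note cl = radj_closed[OF s onb_closed[OF s]]
  obtain T where "?P T"
  proof (rule H.operator_of_form_sum[of "onb s" "\<lambda>b h k. hinner H (A (radj s b h)) (radj s b k)" C])
    show "sesquilinear_form H (\<lambda>h k. hinner H (A (radj s b h)) (radj s b k))"
      if b: "b \<in> onb s" for b
      using cl[OF b] H.bop_closed[OF A] unfolding sesquilinear_form_def
      by (simp add: radj_add[OF s onb_closed[OF s b]] radj_smult[OF s onb_closed[OF s b]]
          H.bop_add[OF A] H.bop_smult[OF A] H.hinner_add_left H.hinner_add_right
          H.hinner_smult_left H.hinner_smult_right)
  qed (use C alpha_form[OF s A C] in auto)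
  then show ?thesis unfolding alpha_def by (rule someI[of ?P])
qed

lemma alpha_bop: "s \<in> S \<Longrightarrow> A \<in> bop H \<Longrightarrow> alpha s A \<in> bop H"
  using alpha by blast

lemma alpha_has_sum:
  "\<lbrakk>s \<in> S; A \<in> bop H; h \<in> carrier H; k \<in> carrier H\<rbrakk> \<Longrightarrow>
    ((\<lambda>b. hinner H (A (radj s b h)) (radj s b k)) has_sum hinner H (alpha s A h) k) (onb s)"
  using alpha by blast

text \<open>By \<open>radj_rep\<close>, applying \<open>radj s b\<close> to
  \<open>\<phi> s x h\<close> gives the coefficient of \<open>x\<close> at \<open>b\<close> times
  \<open>h\<close>; the defining series becomes the expansion of \<open>\<phi> s x (A h)\<close>
  along the basis. The resulting relation no longer mentions the basis.\<close>

lemma alpha_rep: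
  assumes s: "s \<in> S" and A: "A \<in> bop H" and x: "x \<in> carrier (E s)" and h: "h \<in> carrier H"
  shows "alpha s A (\<phi> s x h) = \<phi> s x (A h)"
proof (rule H.hinner_ext)
  interpret Es: hilbert_space "E s" by (rule fibre_hilbert[OF s])
  have Ah: "A h \<in> carrier H" using A h by (rule H.bop_closed)
  have xh: "\<phi> s x h \<in> carrier H" by (rule rep_closed[OF s x h])
  show "alpha s A (\<phi> s x h) \<in> carrier H" using xh alpha_bop[OF s A] H.bop_closed by blast
  show "\<phi> s x (A h) \<in> carrier H" by (rule rep_closed[OF s x Ah])
  fix k assume k: "k \<in> carrier H"
  have "((\<lambda>b. hinner (E s) x b * hinner H (\<phi> s b (A h)) k) has_sum hinner H (\<phi> s x (A h)) k) (onb s)"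
    by (rule Es.functional_has_sum[OF Es.some_onb x rep_functional[OF s Ah k]])
  moreover have "hinner H (A (radj s b (\<phi> s x h))) (radj s b k) =
      hinner (E s) x b * hinner H (\<phi> s b (A h)) k" if b: "b \<in> onb s" for b
  proof -
    note bc = onb_closed[OF s b]
    have "hinner H (A h) (radj s b k) = hinner H (\<phi> s b (A h)) k"
      unfolding radj_def by (rule H.op_adj_hinner[OF rep_bop[OF s bc] Ah k])
    then show ?thesis
      using s bc x h k Ah
      by (simp add: radj_rep H.bop_smult[OF A] H.hinner_smult_left radj_closed)
  qed
  ultimately have "((\<lambda>b. hinner H (A (radj s b (\<phi> s x h))) (radj s b k))
      has_sum hinner H (\<phi> s x (A h)) k) (onb s)"
    by (simp cong: has_sum_cong)
  then show "hinner H (alpha s A (\<phi> s x h)) k = hinner H (\<phi> s x (A h)) k"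
    using alpha_has_sum[OF s A xh k] has_sum_unique by blast
qed

text \<open>The working characterisation of \<open>alpha\<close>: linearity, multiplicativity and
  unitality follow by checking the relation for the candidate operator.\<close>

lemma alpha_unique:
  assumes s: "s \<in> S" and A: "A \<in> bop H" and T: "T \<in> bop H"
    and "\<And>x h. x \<in> carrier (E s) \<Longrightarrow> h \<in> carrier H \<Longrightarrow> T (\<phi> s x h) = \<phi> s x (A h)"
  shows "alpha s A = T"
  by (rule H.bop_eq_on_total[OF rep_total[OF s] alpha_bop[OF s A] T])
    (use assms in \<open>auto simp: alpha_rep\<close>)

lemma alpha_star_endomorphism:
  assumes s: "s \<in> S"
  shows "star_endomorphism H (alpha s)"
  unfolding star_endomorphism_def
proof (intro conjI ballI allI)
  note cl = rep_closed[OF s] H.bop_closed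
  show "alpha s \<in> bop H \<rightarrow> bop H" using alpha_bop[OF s] by auto
  fix A assume A: "A \<in> bop H"
  show "alpha s (op_smult H c A) = op_smult H c (alpha s A)" for c
    by (rule alpha_unique[OF s])
      (use s A cl in \<open>auto simp: H.op_smult_bop alpha_bop op_apply alpha_rep H.bop_smult[OF rep_bop]\<close>)
  show "alpha s (op_add H A B) = op_add H (alpha s A) (alpha s B)" if B: "B \<in> bop H" for B
    by (rule alpha_unique[OF s])
      (use s A B cl in \<open>auto simp: H.op_add_bop alpha_bop op_apply alpha_rep H.bop_add[OF rep_bop]\<close>)
  show "alpha s (compose (carrier H) A B) = compose (carrier H) (alpha s A) (alpha s B)"
    if B: "B \<in> bop H" for B
    by (rule alpha_unique[OF s])
      (use s A B cl in \<open>auto simp: H.compose_bop alpha_bop compose_eq alpha_rep\<close>)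
  \<comment> \<open>The intertwining relation says nothing directly about adjoints, so here the
    defining series is conjugated term by term.\<close>
  have "op_adj H (alpha s A) = alpha s (op_adj H A)"
  proof (rule H.op_adj_eqI)
    fix h k assume h: "h \<in> carrier H" and k: "k \<in> carrier H"
    have "((\<lambda>b. cnj (hinner H (op_adj H A (radj s b k)) (radj s b h)))
        has_sum cnj (hinner H (alpha s (op_adj H A) k) h)) (onb s)"
      unfolding has_sum_cnj_iff by (rule alpha_has_sum[OF s H.op_adj_bop[OF A] k h])
    moreover have "cnj (hinner H (op_adj H A (radj s b k)) (radj s b h)) =
        hinner H (A (radj s b h)) (radj s b k)" if b: "b \<in> onb s" for b
    proof -
      have c: "radj s b h \<in> carrier H" "radj s b k \<in> carrier H"
        using radj_closed[OF s onb_closed[OF s b]] h k by auto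
      show ?thesis
        using H.op_adj_hinner'[OF A c(2,1)] H.hinner_commute[of "A (radj s b h)" "radj s b k"]
          c H.bop_closed[OF A] by simp
    qed
    ultimately have "((\<lambda>b. hinner H (A (radj s b h)) (radj s b k))
        has_sum cnj (hinner H (alpha s (op_adj H A) k) h)) (onb s)"
      by (simp cong: has_sum_cong)
    then have "hinner H (alpha s A h) k = cnj (hinner H (alpha s (op_adj H A) k) h)"
      using alpha_has_sum[OF s A h k] has_sum_unique by blast
    also have "\<dots> = hinner H h (alpha s (op_adj H A) k)"
      using h k H.bop_closed[OF alpha_bop[OF s H.op_adj_bop[OF A]]]
      by (intro H.hinner_commute[symmetric])
    finally show "hinner H (alpha s A h) k = hinner H h (alpha s (op_adj H A) k)" .
  qed (use s A in \<open>auto simp: alpha_bop H.op_adj_bop\<close>)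
  then show "alpha s (op_adj H A) = op_adj H (alpha s A)" ..
qed

text \<open>Pulling back replaces the sequences \<open>x n\<close>, \<open>y n\<close> by the doubly
  indexed families \<open>radj s b (x n)\<close>, \<open>radj s b (y n)\<close>. These are again
  square summable because summation over \<open>b\<close> restores the squared norm of each
  vector.\<close>

lemma alpha_ultraweak_functional:
  assumes s: "s \<in> S" and \<omega>: "\<omega> \<in> ultraweak_functionals H"
  obtains \<omega>' where "\<omega>' \<in> ultraweak_functionals H" "\<And>A. A \<in> bop H \<Longrightarrow> \<omega> (alpha s A) = \<omega>' A"
proof -
  interpret Es: hilbert_space "E s" by (rule fibre_hilbert[OF s])
  have on: "orthonormal (E s) (\<lambda>b. b) (onb s)" and tot: "total_in (E s) (onb s)"
    using Es.some_onb by (simp_all add: onb_family_def)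
  have "onb s \<noteq> {}"
  proof
    assume "onb s = {}"
    then have "\<forall>x\<in>carrier (E s). x = \<zero>\<^bsub>E s\<^esub>" using tot by (auto simp: total_in_def)
    then show False using fibre_nonzero[OF s] Es.M.zero_closed by blast
  qed
  \<comment> \<open>Ultraweak functionals are indexed by \<open>nat\<close>, so the pairs must be
    countably infinite. The factor \<open>nat\<close> ensures this even for a finite-dimensional
    fibre, provided its basis is non-empty.\<close>
  then have "infinite ((UNIV :: nat set) \<times> onb s)" by (simp add: finite_cartesian_product_iff)
  moreover have "countable ((UNIV :: nat set) \<times> onb s)"
    using Es.orthonormal_countable[OF fibre_separable[OF s] on] by simp
  ultimately obtain g :: "nat \<Rightarrow> nat \<times> 'a" where g: "bij_betw g UNIV (UNIV \<times> onb s)"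
    using bij_betw_from_nat_into by blast
  have gb: "snd (g m) \<in> onb s" for m using bij_betwE[OF g] by (metis UNIV_I mem_Times_iff)
  obtain x y where \<omega>_def: "\<omega> = (\<lambda>A. \<Sum>n. hinner H (A (x n)) (y n))"
    and "range x \<subseteq> carrier H" "range y \<subseteq> carrier H"
    and sx: "summable (\<lambda>n. (hnorm H (x n))\<^sup>2)" and sy: "summable (\<lambda>n. (hnorm H (y n))\<^sup>2)"
    using \<omega> unfolding ultraweak_functionals_def by auto
  then have x: "\<And>n. x n \<in> carrier H" and y: "\<And>n. y n \<in> carrier H" by auto
  have sq: "(\<lambda>p. (hnorm H (radj s (snd p) (z (fst p))))\<^sup>2) summable_on (UNIV \<times> onb s)"
    if z: "\<And>n. z n \<in> carrier H" and sz: "summable (\<lambda>n. (hnorm H (z n))\<^sup>2)" for z :: "nat \<Rightarrow> 'h"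
  proof (rule summable_on_SigmaI)
    show "((\<lambda>b. (hnorm H (radj s (snd (n, b)) (z (fst (n, b)))))\<^sup>2) has_sum (hnorm H (z n))\<^sup>2) (onb s)" for n
      using radj_norm_has_sum[OF s z] by simp
    show "(\<lambda>n. (hnorm H (z n))\<^sup>2) summable_on UNIV"
      using sz by (simp add: summable_on_UNIV_nonneg_real_iff)
  qed simp
  define lift where "lift z m = radj s (snd (g m)) (z (fst (g m)))" for z :: "nat \<Rightarrow> 'h" and m
  have lc: "lift z m \<in> carrier H" if "\<And>n. z n \<in> carrier H" for z m
    unfolding lift_def by (rule radj_closed[OF s onb_closed[OF s gb] that])
  have ls: "summable (\<lambda>m. (hnorm H (lift z m))\<^sup>2)"
    if "\<And>n. z n \<in> carrier H" and "summable (\<lambda>n. (hnorm H (z n))\<^sup>2)" for z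
    using sq[OF that] unfolding lift_def
    by (intro summable_on_imp_summable)
      (simp add: summable_on_reindex_bij_betw[OF g, where f = "\<lambda>p. (hnorm H (radj s (snd p) (z (fst p))))\<^sup>2"])
  show ?thesis
  proof (rule that[of "\<lambda>A. \<Sum>m. hinner H (A (lift x m)) (lift y m)"])
    show "(\<lambda>A. \<Sum>m. hinner H (A (lift x m)) (lift y m)) \<in> ultraweak_functionals H"
      unfolding ultraweak_functionals_def
      using lc[of x] lc[of y] ls[of x] ls[of y] x y sx sy by blast
    fix A assume A: "A \<in> bop H"
    obtain C where C: "C \<ge> 0" "\<And>x. x \<in> carrier H \<Longrightarrow> hnorm H (A x) \<le> C * hnorm H x"
      using H.bop_bound[OF A] by metis
    let ?F = "\<lambda>p. hinner H (A (radj s (snd p) (x (fst p)))) (radj s (snd p) (y (fst p)))"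
    have "(\<lambda>p. (C * hnorm H (radj s (snd p) (x (fst p))))\<^sup>2) summable_on (UNIV \<times> onb s)"
      unfolding power_mult_distrib using sq[OF x sx] by (rule summable_on_cmult_right)
    then have "?F summable_on (UNIV \<times> onb s)"
      by (rule l2_Cauchy_Schwarz(2)[OF _ sq[OF y sy]])
        (use x y radj_closed[OF s onb_closed[OF s]] in \<open>auto intro!: H.hinner_operator_bound[OF A C]\<close>)
    then have F: "(?F has_sum infsum ?F (UNIV \<times> onb s)) (UNIV \<times> onb s)" by (rule has_sum_infsum)
    have "((\<lambda>n. hinner H (alpha s A (x n)) (y n)) has_sum infsum ?F (UNIV \<times> onb s)) UNIV"
      \<comment> \<open>Absolute convergence over pairs permits summing over \<open>b\<close> first,
        which produces \<open>alpha s A\<close>; summing along \<open>g\<close> gives the new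
        functional.\<close>
      by (rule has_sum_SigmaD[OF F]) (use alpha_has_sum[OF s A x y] in simp)
    then have "\<omega> (alpha s A) = infsum ?F (UNIV \<times> onb s)"
      unfolding \<omega>_def by (rule sums_unique[OF has_sum_imp_sums, symmetric])
    moreover have "((\<lambda>m. hinner H (A (lift x m)) (lift y m)) has_sum infsum ?F (UNIV \<times> onb s)) UNIV"
      using F unfolding lift_def by (simp add: has_sum_reindex_bij_betw[OF g, where f = ?F])
    then have "(\<Sum>m. hinner H (A (lift x m)) (lift y m)) = infsum ?F (UNIV \<times> onb s)"
      by (rule sums_unique[OF has_sum_imp_sums, symmetric])
    ultimately show "\<omega> (alpha s A) = (\<Sum>m. hinner H (A (lift x m)) (lift y m))" by simp
  qed
qed

lemma alpha_normal:
  assumes s: "s \<in> S"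
  shows "normal_map H (alpha s)"
proof -
  let ?B = "{{A \<in> bop H. \<omega> A \<in> U} | \<omega> U. \<omega> \<in> ultraweak_functionals H \<and> open U}"
  have top: "topspace (ultraweak_topology H) = bop H"
  proof -
    \<comment> \<open>The zero functional with \<open>U = UNIV\<close> exhibits all of
      \<open>bop H\<close> as one of the generating sets.\<close>
    have "(\<lambda>A. \<Sum>n. hinner H (A ((\<lambda>n. \<zero>\<^bsub>H\<^esub>) n)) ((\<lambda>n. \<zero>\<^bsub>H\<^esub>) n)) \<in> ultraweak_functionals H"
      unfolding ultraweak_functionals_def
      by (intro CollectI exI[of _ "\<lambda>n. \<zero>\<^bsub>H\<^esub>"] conjI refl) (auto simp: H.hnorm_zero_iff[THEN iffD2])
    then obtain \<omega> where "\<omega> \<in> ultraweak_functionals H" by blast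
    then have "bop H \<in> ?B" by (intro CollectI exI[of _ \<omega>] exI[of _ UNIV]) auto
    then have "\<Union>?B = bop H" by auto
    then show ?thesis by (simp add: ultraweak_topology_def topology_generated_by_topspace)
  qed
  have "continuous_map (ultraweak_topology H) (topology_generated_by ?B) (alpha s)"
  proof (rule continuous_on_generated_topo)
    fix V assume "V \<in> ?B"
    then obtain \<omega> U where V: "V = {A \<in> bop H. \<omega> A \<in> U}" and \<omega>: "\<omega> \<in> ultraweak_functionals H" and U: "open U"
      by blast
    obtain \<omega>' where \<omega>': "\<omega>' \<in> ultraweak_functionals H" "\<And>A. A \<in> bop H \<Longrightarrow> \<omega> (alpha s A) = \<omega>' A"
      using alpha_ultraweak_functional[OF s \<omega>] by metis
    have "alpha s -` V \<inter> topspace (ultraweak_topology H) = {A \<in> bop H. \<omega>' A \<in> U}"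
      using \<omega>' alpha_bop[OF s] by (auto simp: V top)
    then show "openin (ultraweak_topology H) (alpha s -` V \<inter> topspace (ultraweak_topology H))"
      unfolding ultraweak_topology_def using \<omega>'(1) U
      by (auto intro!: topology_generated_by_Basis)
  next
    show "alpha s ` topspace (ultraweak_topology H) \<subseteq> \<Union>?B"
      using top alpha_bop[OF s]
      unfolding ultraweak_topology_def topology_generated_by_topspace by auto
  qed
  then show ?thesis by (simp add: normal_map_def ultraweak_topology_def)
qed

section \<open>The semigroup law, and recovery of the product system from the semigroup\<close>

lemma nonzero_vector:
  obtains h where "h \<in> carrier H" "hinner H h h \<noteq> 0"
  using H_nonzero H.M.zero_closed H.hinner_definite by blast

lemma alpha_id: "s \<in> S \<Longrightarrow> alpha s (op_id H) = op_id H"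
  by (rule alpha_unique) (auto simp: H.op_id_bop op_apply rep_closed)

text \<open>If \<open>k\<close> is orthogonal to all these vectors, totality for \<open>t\<close>
  gives \<open>radj s x k = \<zero>\<close>, and then totality for \<open>s\<close> gives
  \<open>k = \<zero>\<close>.\<close>

lemma rep_rep_total:
  assumes s: "s \<in> S" and t: "t \<in> S"
  shows "total_in H {\<phi> s x (\<phi> t y h) | x y h. x \<in> carrier (E s) \<and> y \<in> carrier (E t) \<and> h \<in> carrier H}"
  unfolding total_in_def
proof (intro conjI ballI impI)
  show "{\<phi> s x (\<phi> t y h) | x y h. x \<in> carrier (E s) \<and> y \<in> carrier (E t) \<and> h \<in> carrier H} \<subseteq> carrier H"
    using s t by (auto intro!: rep_closed)
  fix k assume k: "k \<in> carrier H" and orth: "\<forall>v\<in>{\<phi> s x (\<phi> t y h) | x y h.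
    x \<in> carrier (E s) \<and> y \<in> carrier (E t) \<and> h \<in> carrier H}. hinner H k v = 0"
  have adj0: "radj s x k = \<zero>\<^bsub>H\<^esub>" if x: "x \<in> carrier (E s)" for x
  proof (rule H.hinner_ext_total[OF rep_total[OF t]])
    fix v assume "v \<in> {\<phi> t y h | y h. y \<in> carrier (E t) \<and> h \<in> carrier H}"
    then obtain y h where v: "v = \<phi> t y h" "y \<in> carrier (E t)" "h \<in> carrier H" by blast
    then have "hinner H k (\<phi> s x v) = 0" using orth x by blast
    then show "hinner H (radj s x k) v = hinner H \<zero>\<^bsub>H\<^esub> v"
      using v s t x k by (simp add: radj_hinner rep_closed H.hinner_zero_left)
  qed (use radj_closed[OF s x k] in auto)
  have "hinner H k (\<phi> s x h) = 0" if x: "x \<in> carrier (E s)" and h: "h \<in> carrier H" for x h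
    using radj_hinner[OF s x k h] adj0[OF x] h by (simp add: H.hinner_zero_left)
  then show "k = \<zero>\<^bsub>H\<^esub>" using rep_total[OF s] k by (auto simp: total_in_def)
qed

lemma alpha_add:
  assumes s: "s \<in> S" and t: "t \<in> S" and A: "A \<in> bop H"
  shows "alpha (s + t) A = alpha s (alpha t A)"
proof (rule H.bop_eq_on_total[OF rep_rep_total[OF s t]])
  fix v assume "v \<in> {\<phi> s x (\<phi> t y h) | x y h. x \<in> carrier (E s) \<and> y \<in> carrier (E t) \<and> h \<in> carrier H}"
  then obtain x y h where v: "v = \<phi> s x (\<phi> t y h)"
    and c: "x \<in> carrier (E s)" "y \<in> carrier (E t)" "h \<in> carrier H" by blast
  have m: "\<phi> (s + t) (\<mu> s t x y) k = \<phi> s x (\<phi> t y k)" if "k \<in> carrier H" for k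
    using rep_mult[OF s t c(1,2)] that by (simp add: compose_eq)
  have "alpha (s + t) A v = \<phi> (s + t) (\<mu> s t x y) (A h)"
    unfolding v m[OF c(3), symmetric]
    by (rule alpha_rep[OF add_closed[OF s t] A mult_closed[OF s t c(1,2)] c(3)])
  also have "\<dots> = \<phi> s x (\<phi> t y (A h))" using m H.bop_closed[OF A c(3)] by simp
  also have "\<dots> = alpha s (alpha t A) v"
    unfolding v using c by (simp add: alpha_rep s t A alpha_bop rep_closed)
  finally show "alpha (s + t) A v = alpha s (alpha t A) v" .
qed (use s t A in \<open>auto simp: alpha_bop add_closed\<close>)

lemma alpha_zero:
  assumes A: "A \<in> bop H"
  shows "alpha 0 A = A"
proof -
  obtain e where e: "e \<in> carrier (E 0)" "hinner (E 0) e e = 1"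
    and unit: "\<And>s x. s \<in> S \<Longrightarrow> x \<in> carrier (E s) \<Longrightarrow> \<mu> 0 s e x = x"
    using one_exists by metis
  have one: "1 \<odot>\<^bsub>H\<^esub> h = h" if "h \<in> carrier H" for h
    by (rule H.hinner_ext) (use that in \<open>simp_all add: H.hinner_smult_left\<close>)
  have id: "\<phi> 0 e h = h" if h: "h \<in> carrier H" for h
  proof -
    have eh: "\<phi> 0 e h \<in> carrier H" by (rule rep_closed[OF zero_mem e(1) h])
    \<comment> \<open>\<open>\<phi> 0 e\<close> is an idempotent isometry; cancelling one factor
      with its adjoint leaves the identity.\<close>
    have "\<phi> 0 e (\<phi> 0 e h) = \<phi> 0 e h"
      using rep_mult[OF zero_mem zero_mem e(1) e(1)] unit[OF zero_mem e(1)] h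
      by (simp add: compose_eq) (metis compose_eq)
    then have "radj 0 e (\<phi> 0 e (\<phi> 0 e h)) = radj 0 e (\<phi> 0 e h)" by simp
    then show ?thesis
      using radj_rep[OF zero_mem e(1) e(1)] e(2) h eh one by simp
  qed
  show ?thesis
    by (rule alpha_unique[OF zero_mem A A])
      (metis H.bop_closed A id rep_closed zero_mem alpha_rep e(1))
qed

lemma alpha_E0_semigroup: "E0_semigroup S H alpha"
  unfolding E0_semigroup_def E_semigroup_def
proof (intro conjI ballI)
  fix s assume s: "s \<in> S"
  show "star_endomorphism H (alpha s)" by (rule alpha_star_endomorphism[OF s])
  show "normal_map H (alpha s)" by (rule alpha_normal[OF s])
  show "alpha s (op_id H) = op_id H" by (rule alpha_id[OF s])
  obtain h where h: "h \<in> carrier H" "h \<noteq> \<zero>\<^bsub>H\<^esub>"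
    using H_nonzero H.M.zero_closed by blast
  have "op_id H h \<noteq> op_zero H h" using h by (simp add: op_id_def op_zero_def)
  then show "\<exists>A\<in>bop H. alpha s A \<noteq> op_zero H"
    using alpha_id[OF s] H.op_id_bop by metis
qed (auto simp: alpha_add alpha_zero)

text \<open>For \<open>T\<close> in the fibre, each \<open>radj s b\<close> composed with
  \<open>T\<close> commutes with all of \<open>bop H\<close>, hence is a scalar \<open>c b\<close>.
  These scalars are square summable, since the squared norms of \<open>radj s b (T h)\<close> sum to
  that of \<open>T h\<close>, and the vector \<open>y\<close> with coefficients \<open>c b\<close>
  satisfies \<open>T = \<phi> s y\<close>.\<close>

lemma assoc_fibre_carrier:
  assumes s: "s \<in> S"
  shows "carrier (assoc_fibre H alpha s) = \<phi> s ` carrier (E s)"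
proof (intro equalityI subsetI)
  fix T assume "T \<in> \<phi> s ` carrier (E s)"
  then obtain x where T: "T = \<phi> s x" and x: "x \<in> carrier (E s)" by blast
  have "compose (carrier H) (alpha s A) T = compose (carrier H) T A" if A: "A \<in> bop H" for A
    by (rule H.bop_eqI)
      (use s A x in \<open>auto simp: T H.compose_bop alpha_bop rep_bop compose_eq alpha_rep\<close>)
  then show "T \<in> carrier (assoc_fibre H alpha s)"
    using rep_bop[OF s x] by (simp add: assoc_fibre_def T)
next
  interpret Es: hilbert_space "E s" by (rule fibre_hilbert[OF s])
  fix T assume "T \<in> carrier (assoc_fibre H alpha s)"
  then have T: "T \<in> bop H"
    and comm: "\<And>A. A \<in> bop H \<Longrightarrow> compose (carrier H) (alpha s A) T = compose (carrier H) T A"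
    by (auto simp: assoc_fibre_def)
  have TA: "alpha s A (T h) = T (A h)" if "A \<in> bop H" "h \<in> carrier H" for A h
    using comm[OF that(1)] that(2) by (metis compose_eq)
  have "\<exists>c. \<forall>h\<in>carrier H. radj s b (T h) = c \<odot>\<^bsub>H\<^esub> h" if b: "b \<in> onb s" for b
  proof -
    note bc = onb_closed[OF s b]
    \<comment> \<open>The adjoint of the intertwining relation \<open>alpha_rep\<close>, applied to
      the adjoint of \<open>A\<close>.\<close>
    have adj_alpha: "radj s b (alpha s A k) = A (radj s b k)" if A: "A \<in> bop H" and k: "k \<in> carrier H" for A k
    proof (rule H.hinner_ext)
      note c = H.bop_closed[OF A] H.bop_closed[OF alpha_bop[OF s A]] radj_closed[OF s bc]
        H.bop_closed[OF H.op_adj_bop[OF A]] rep_closed[OF s bc]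
      show "radj s b (alpha s A k) \<in> carrier H" "A (radj s b k) \<in> carrier H"
        using c k by auto
      fix z assume z: "z \<in> carrier H"
      have "op_adj H (alpha s A) = alpha s (op_adj H A)"
        using alpha_star_endomorphism[OF s] A by (auto simp: star_endomorphism_def)
      then have "hinner H (alpha s A k) (\<phi> s b z) = hinner H k (\<phi> s b (op_adj H A z))"
        using H.op_adj_hinner[OF alpha_bop[OF s A] k c(5)[OF z]]
          alpha_rep[OF s H.op_adj_bop[OF A] bc z] by simp
      then show "hinner H (radj s b (alpha s A k)) z = hinner H (A (radj s b k)) z"
        using c k z s bc by (simp add: radj_hinner H.op_adj_hinner[OF A, symmetric])
    qed
    have "compose (carrier H) (radj s b) T \<in> bop H"
      unfolding radj_def by (intro H.compose_bop H.op_adj_bop rep_bop s bc T)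
    then obtain c where "\<And>h. h \<in> carrier H \<Longrightarrow> compose (carrier H) (radj s b) T h = c \<odot>\<^bsub>H\<^esub> h"
    proof (rule H.commutant_scalar[OF H_nonzero])
      fix A h assume A: "A \<in> bop H" and h: "h \<in> carrier H"
      show "compose (carrier H) (radj s b) T (A h) = A (compose (carrier H) (radj s b) T h)"
        using A h H.bop_closed[OF A h] H.bop_closed[OF T h] adj_alpha[OF A, of "T h"]
        by (simp add: compose_eq TA)
    qed blast
    then show ?thesis by (auto simp: compose_eq)
  qed
  then obtain c where c: "\<And>b h. b \<in> onb s \<Longrightarrow> h \<in> carrier H \<Longrightarrow> radj s b (T h) = c b \<odot>\<^bsub>H\<^esub> h"
    by metis
  obtain h where h: "h \<in> carrier H" "hinner H h h \<noteq> 0" by (rule nonzero_vector)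
  have hn: "hnorm H h \<noteq> 0" using h by (simp add: H.hinner_self)
  have "(\<lambda>b. (hnorm H (radj s b (T h)))\<^sup>2) summable_on onb s"
    using radj_norm_has_sum[OF s H.bop_closed[OF T h(1)]] has_sum_imp_summable by blast
  then have "(\<lambda>b. inverse ((hnorm H h)\<^sup>2) * (hnorm H (radj s b (T h)))\<^sup>2) summable_on onb s"
    by (rule summable_on_cmult_right)
  then have sc: "(\<lambda>b. (cmod (c b))\<^sup>2) summable_on onb s"
    using hn h by (subst summable_on_cong) (auto simp: c H.hnorm_smult power_mult_distrib)
  have on: "orthonormal (E s) (\<lambda>b. b) (onb s)"
    using Es.some_onb by (simp add: onb_family_def)
  obtain y where y: "y \<in> carrier (E s)" "\<And>b. b \<in> onb s \<Longrightarrow> hinner (E s) y b = c b"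
    using Es.Riesz_Fischer[OF on sc] by metis
  have totB: "total_in H ((\<lambda>(b, i). \<phi> s b i) ` (onb s \<times> some_onb H))"
    using rep_onb_basis[OF s] by (simp add: onb_family_def)
  have onH: "orthonormal H (\<lambda>b. b) (some_onb H)"
    using H.some_onb by (simp add: onb_family_def)
  have "T = \<phi> s y"
  proof (rule H.bop_eqI[OF T rep_bop[OF s y(1)]])
    fix k assume k: "k \<in> carrier H"
    show "T k = \<phi> s y k"
    proof (rule H.hinner_ext_total[OF totB])
      fix v assume "v \<in> (\<lambda>(b, i). \<phi> s b i) ` (onb s \<times> some_onb H)"
      then obtain b i where v: "v = \<phi> s b i" "b \<in> onb s" "i \<in> some_onb H" by auto
      have i: "i \<in> carrier H" using H.orthonormal_closed[OF onH v(3)] .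
      have "hinner H (T k) (\<phi> s b i) = hinner H (radj s b (T k)) i"
        using v k i s T by (simp add: radj_hinner onb_closed H.bop_closed)
      also have "\<dots> = hinner H (\<phi> s y k) (\<phi> s b i)"
        using v k i s y by (simp add: c rep_hinner onb_closed H.hinner_smult_left)
      finally show "hinner H (T k) v = hinner H (\<phi> s y k) v" by (simp add: v)
    qed (use k s y T in \<open>auto simp: H.bop_closed rep_closed\<close>)
  qed
  then show "T \<in> \<phi> s ` carrier (E s)" using y(1) by blast
qed

text \<open>The scalar exists by \<open>radj_rep\<close> and is unique because \<open>H\<close> is
  non-zero, so the definite description in \<open>assoc_fibre\<close> denotes.\<close>

lemma assoc_fibre_hinner:
  assumes s: "s \<in> S" and x: "x \<in> carrier (E s)" and y: "y \<in> carrier (E s)"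
  shows "hinner (assoc_fibre H alpha s) (\<phi> s x) (\<phi> s y) = hinner (E s) x y"
proof -
  have "compose (carrier H) (op_adj H (\<phi> s y)) (\<phi> s x) = op_smult H (hinner (E s) x y) (op_id H)"
  proof (rule H.bop_eqI)
    show "compose (carrier H) (op_adj H (\<phi> s y)) (\<phi> s x) \<in> bop H"
      using s x y by (intro H.compose_bop H.op_adj_bop rep_bop)
  qed (use s x y in \<open>auto simp: H.op_smult_bop H.op_id_bop compose_eq op_apply radj_rep
      simp flip: radj_def\<close>)
  moreover have "c = d" if "op_smult H c (op_id H) = op_smult H d (op_id H)" for c d
  proof -
    obtain h where h: "h \<in> carrier H" "hinner H h h \<noteq> 0" by (rule nonzero_vector)
    have "c \<odot>\<^bsub>H\<^esub> h = d \<odot>\<^bsub>H\<^esub> h"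
      using fun_cong[OF that, of h] h by (simp add: op_apply)
    then have "c * hinner H h h = d * hinner H h h"
      using H.hinner_smult_left[OF h(1) h(1)] by metis
    then show ?thesis using h by simp
  qed
  ultimately show ?thesis unfolding assoc_fibre_def by (auto intro!: the_equality)
qed

lemma ps_isomorphic_assoc: "ps_isomorphic S E \<mu> (assoc_fibre H alpha) (assoc_mult H)"
  unfolding ps_isomorphic_def
proof (intro exI[of _ \<phi>] conjI ballI)
  show "\<phi> (s + t) (\<mu> s t x y) = assoc_mult H s t (\<phi> s x) (\<phi> t y)"
    if "s \<in> S" "t \<in> S" "x \<in> carrier (E s)" "y \<in> carrier (E t)" for s t x y
    using rep_mult[OF that] by (simp add: assoc_mult_def)
  fix s assume s: "s \<in> S"
  interpret Es: hilbert_space "E s" by (rule fibre_hilbert[OF s])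
  show "unitary_op (E s) (assoc_fibre H alpha s) (\<phi> s)"
    unfolding unitary_op_def
  proof (intro conjI ballI)
    have "\<phi> s (x \<oplus>\<^bsub>E s\<^esub> y) = op_add H (\<phi> s x) (\<phi> s y)" if "x \<in> carrier (E s)" "y \<in> carrier (E s)" for x y
      by (rule H.bop_eqI) (use s that in \<open>auto simp: rep_bop H.op_add_bop op_apply rep_add\<close>)
    moreover have "\<phi> s (c \<odot>\<^bsub>E s\<^esub> x) = op_smult H c (\<phi> s x)" if "x \<in> carrier (E s)" for c x
      by (rule H.bop_eqI) (use s that in \<open>auto simp: rep_bop H.op_smult_bop op_apply rep_smult\<close>)
    ultimately show "linear_op (E s) (assoc_fibre H alpha s) (\<phi> s)"
      unfolding linear_op_def assoc_fibre_carrier[OF s] by (auto simp: assoc_fibre_def)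
    have "inj_on (\<phi> s) (carrier (E s))"
    proof (rule inj_onI)
      fix x y assume x: "x \<in> carrier (E s)" and y: "y \<in> carrier (E s)" and eq: "\<phi> s x = \<phi> s y"
      obtain h where h: "h \<in> carrier H" "hinner H h h \<noteq> 0" by (rule nonzero_vector)
      show "x = y"
      proof (rule Es.hinner_ext[OF x y])
        fix z assume z: "z \<in> carrier (E s)"
        show "hinner (E s) x z = hinner (E s) y z"
          using rep_hinner[OF s x z h(1) h(1)] rep_hinner[OF s y z h(1) h(1)] eq h(2) by simp
      qed
    qed
    then show "bij_betw (\<phi> s) (carrier (E s)) (carrier (assoc_fibre H alpha s))"
      by (simp add: bij_betw_def assoc_fibre_carrier[OF s])
  qed (rule assoc_fibre_hinner[OF s])
qed

end

section \<open>The essential representation on the inductive limit\<close>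

text \<open>The multiples of \<open>a\<close> are written as sums because the index group is an
  arbitrary abelian group. By \<open>absorbing\<close>, \<open>a\<close> is an order unit for the
  preorder defined by \<open>S\<close>.\<close>

locale order_unit_product_system = semigroup_product_system S E \<mu>
  for S :: "'i::ab_group_add set" and E :: "'i \<Rightarrow> 'a hilb" and \<mu> +
  fixes a :: 'i and u :: 'a
  assumes countable_index: "countable S"
    and unit_mem: "a \<in> S"
    and absorbing: "s \<in> S \<Longrightarrow> \<exists>n::nat. (\<Sum>i<n. a) - s \<in> S"
    and unit_closed: "u \<in> carrier (E a)"
    and unit_hinner: "hinner (E a) u u = 1"
begin

section \<open>Levels and the connecting maps given by right multiplication with
  \<open>u\<close>\<close>

definition ml :: "nat \<Rightarrow> 'i" where "ml n = (\<Sum>i<n. a)"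

lemma ml_0 [simp]: "ml 0 = 0" by (simp add: ml_def)

lemma ml_Suc: "ml (Suc n) = ml n + a" by (simp add: ml_def)

lemma ml_add: "ml (m + n) = ml m + ml n"
  by (induction n) (simp_all add: ml_Suc add.assoc)

lemma ml_mem: "ml n \<in> S"
  by (induction n) (simp_all add: ml_Suc zero_mem add_closed unit_mem)

lemma add_ml_mem: "s \<in> S \<Longrightarrow> s + ml n \<in> S"
  by (simp add: add_closed ml_mem)

primrec rmul :: "'i \<Rightarrow> 'a \<Rightarrow> nat \<Rightarrow> 'a" where
  "rmul s x 0 = x"
| "rmul s x (Suc n) = \<mu> (s + ml n) a (rmul s x n) u"

lemma rmul_closed: "s \<in> S \<Longrightarrow> x \<in> carrier (E s) \<Longrightarrow> rmul s x n \<in> carrier (E (s + ml n))"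
proof (induction n)
  case (Suc n)
  then show ?case
    using mult_closed[OF add_ml_mem[of s n] unit_mem _ unit_closed] by (simp add: ml_Suc add.assoc)
qed simp

lemma rmul_hinner:
  assumes "s \<in> S" "x \<in> carrier (E s)" "y \<in> carrier (E s)"
  shows "hinner (E (s + ml n)) (rmul s x n) (rmul s y n) = hinner (E s) x y"
proof (induction n)
  case (Suc n)
  then show ?case
    using mult_hinner[OF add_ml_mem[of s n] unit_mem rmul_closed[of s x n] rmul_closed[of s y n]
        unit_closed unit_closed] assms
    by (simp add: ml_Suc add.assoc unit_hinner)
qed simp

lemma rmul_add:
  assumes "s \<in> S" "x \<in> carrier (E s)" "y \<in> carrier (E s)"
  shows "rmul s (x \<oplus>\<^bsub>E s\<^esub> y) n = rmul s x n \<oplus>\<^bsub>E (s + ml n)\<^esub> rmul s y n"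
proof (induction n)
  case (Suc n)
  then show ?case
    using mult_add_left[OF add_ml_mem[of s n] unit_mem rmul_closed[of s x n] rmul_closed[of s y n]
        unit_closed] assms
    by (simp add: ml_Suc add.assoc)
qed simp

lemma rmul_smult:
  assumes "s \<in> S" "x \<in> carrier (E s)"
  shows "rmul s (c \<odot>\<^bsub>E s\<^esub> x) n = c \<odot>\<^bsub>E (s + ml n)\<^esub> rmul s x n"
proof (induction n)
  case (Suc n)
  then show ?case
    using mult_smult_left[OF add_ml_mem[of s n] unit_mem rmul_closed[of s x n] unit_closed] assms
    by (simp add: ml_Suc add.assoc)
qed simp

lemma rmul_rmul: "rmul (s + ml m) (rmul s x m) n = rmul s x (m + n)"
  by (induction n) (simp_all add: ml_add add.assoc)

text \<open>Associativity makes left multiplications commute with the connecting maps; this is why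
  they descend to the limits.\<close>

lemma mult_rmul:
  assumes r: "r \<in> S" and s: "s \<in> S" and y: "y \<in> carrier (E r)" and x: "x \<in> carrier (E s)"
  shows "\<mu> r (s + ml n) y (rmul s x n) = rmul (r + s) (\<mu> r s y x) n"
proof (induction n)
  case (Suc n)
  then show ?case
    using mult_assoc[OF r add_ml_mem[OF s, of n] unit_mem y rmul_closed[OF s x] unit_closed]
    by (simp add: ml_Suc add.assoc)
qed simp

text \<open>The quadruple \<open>(s, n, k, x)\<close> stands for the image of \<open>x \<in> E s\<close> at level \<open>n\<close> of the inductive
  limit of \<open>E (t + ml 0) \<rightarrow> E (t + ml 1) \<rightarrow> \<dots>\<close> with \<open>t = s - ml n\<close>; the multiplicity \<open>k\<close> makes the
  direct sum of these limits infinite dimensional even for trivial \<open>S\<close>.\<close>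

definition points :: "('i \<times> nat \<times> nat \<times> 'a) set" where
  "points = {(s, n, k, x). s \<in> S \<and> x \<in> carrier (E s)}"

text \<open>The inner product of the two represented limit vectors. The condition on the indices
  says that both lie over the same t = s - na = s' - n'a; then \<open>n'\<close> and
  \<open>n\<close> further lifts, respectively, bring them into one fibre at level
  \<open>n + n'\<close>. Different t and different multiplicities are orthogonal.\<close>

fun kernel :: "'i \<times> nat \<times> nat \<times> 'a \<Rightarrow> 'i \<times> nat \<times> nat \<times> 'a \<Rightarrow> complex" where
  "kernel (s, n, k, x) (s', n', k', x') =
    (if k = k' \<and> s + ml n' = s' + ml n
     then hinner (E (s + ml n')) (rmul s x n') (rmul s' x' n) else 0)"

lemma points_iff [simp]: "(s, n, k, x) \<in> points \<longleftrightarrow> s \<in> S \<and> x \<in> carrier (E s)"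
  by (simp add: points_def)

lemma kernel_commute:
  assumes "p \<in> points" "q \<in> points"
  shows "kernel q p = cnj (kernel p q)"
proof -
  obtain s n k x s' n' k' x' where pq: "p = (s, n, k, x)" "q = (s', n', k', x')"
    by (metis prod_cases4)
  have *: "s \<in> S" "x \<in> carrier (E s)" "s' \<in> S" "x' \<in> carrier (E s')" using assms pq by auto
  interpret inner_product_space "E (s + ml n')" by (rule fibre_inner[OF add_ml_mem[OF *(1)]])
  show ?thesis
    using * hinner_commute[of "rmul s x n'" "rmul s' x' n"] rmul_closed[of s x n'] rmul_closed[of s' x' n]
    by (auto simp: pq)
qed

lemma kernel_same_level:
  "s \<in> S \<Longrightarrow> x \<in> carrier (E s) \<Longrightarrow> y \<in> carrier (E s) \<Longrightarrow>
    kernel (s, n, k, x) (s, n, k, y) = hinner (E s) x y"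
  by (simp add: rmul_hinner)

text \<open>Both sides compare the same vectors in fibres \<open>l\<close> levels apart. All right
  factors are the same \<open>u\<close>, so the extra \<open>l\<close> may be counted last, and
  \<open>rmul\<close> is isometric.\<close>

lemma kernel_lift:
  assumes s: "s \<in> S" and x: "x \<in> carrier (E s)" and q: "q \<in> points"
  shows "kernel (s + ml l, n + l, k, rmul s x l) q = kernel (s, n, k, x) q"
proof -
  obtain s' n' k' x' where q': "q = (s', n', k', x')" by (metis prod_cases4)
  have q: "s' \<in> S" "x' \<in> carrier (E s')" using q q' by auto
  have cond: "s + ml l + ml n' = s' + ml (n + l) \<longleftrightarrow> s + ml n' = s' + ml n"
    by (auto simp: ml_add algebra_simps)
  have "hinner (E (s + ml l + ml n')) (rmul (s + ml l) (rmul s x l) n') (rmul s' x' (n + l))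
      = hinner (E (s + ml n')) (rmul s x n') (rmul s' x' n)" if eq: "s + ml n' = s' + ml n"
  proof -
    have "rmul (s + ml l) (rmul s x l) n' = rmul (s + ml n') (rmul s x n') l"
      unfolding rmul_rmul by (simp add: add.commute)
    moreover have "rmul s' x' (n + l) = rmul (s + ml n') (rmul s' x' n) l"
      by (simp add: eq rmul_rmul)
    moreover have "E (s + ml l + ml n') = E (s + ml n' + ml l)" by (simp add: algebra_simps)
    ultimately show ?thesis
      using rmul_hinner[OF add_ml_mem[OF s, of n'] rmul_closed[OF s x, of n'], of "rmul s' x' n" l]
        rmul_closed[OF q, of n] by (simp add: eq[symmetric])
  qed
  then show ?thesis using cond by (simp add: q')
qed

lemma lower_level:
  assumes "s + ml m = t + ml n" "m \<le> n"
  shows "s = t + ml (n - m)"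
proof -
  have "ml n = ml (n - m) + ml m" using assms(2) ml_add[of "n - m" m] by simp
  then show ?thesis using assms(1) by (simp add: algebra_simps)
qed

text \<open>Only the lower vector has to be raised to level \<open>n\<close>; the general kernel
  raises both further, which changes nothing by \<open>kernel_lift\<close>.\<close>

lemma kernel_lower_level:
  assumes s: "s \<in> S" and t: "t \<in> S" and x: "x \<in> carrier (E s)" and y: "y \<in> carrier (E t)"
    and eq: "s + ml m = t + ml n" and mn: "m \<le> n"
  shows "kernel (s, n, k, x) (t, m, k, y) = hinner (E s) x (rmul t y (n - m))"
proof -
  have st: "s = t + ml (n - m)" by (rule lower_level[OF eq mn])
  have r: "rmul t y (n - m) \<in> carrier (E s)" using rmul_closed[OF t y] st by simp
  have "kernel (t, m, k, y) (s, n, k, x) = kernel (s, n, k, rmul t y (n - m)) (s, n, k, x)"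
    using kernel_lift[OF t y, of "(s, n, k, x)" "n - m" m k] s x mn st by simp
  then have "kernel (s, n, k, x) (t, m, k, y) = kernel (s, n, k, x) (s, n, k, rmul t y (n - m))"
    using kernel_commute[of "(t, m, k, y)" "(s, n, k, x)"]
      kernel_commute[of "(s, n, k, rmul t y (n - m))" "(s, n, k, x)"] s t x y r
    by (simp del: kernel.simps)
  then show ?thesis using kernel_same_level[OF s x r] by simp
qed

lemma kernel_add:
  assumes s: "s \<in> S" and x: "x \<in> carrier (E s)" "y \<in> carrier (E s)" and q: "q \<in> points"
  shows "kernel (s, n, k, x \<oplus>\<^bsub>E s\<^esub> y) q = kernel (s, n, k, x) q + kernel (s, n, k, y) q"
proof -
  obtain s' n' k' x' where q': "q = (s', n', k', x')" by (metis prod_cases4)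
  have q: "s' \<in> S" "x' \<in> carrier (E s')" using q q' by auto
  interpret inner_product_space "E (s + ml n')" by (rule fibre_inner[OF add_ml_mem[OF s]])
  show ?thesis
  proof (cases "k = k' \<and> s' + ml n = s + ml n'")
    case True
    then show ?thesis
      using s x rmul_closed[OF q, of n] by (simp add: q' rmul_add hinner_add_left rmul_closed)
  qed (auto simp: q')
qed

lemma kernel_smult:
  assumes s: "s \<in> S" and x: "x \<in> carrier (E s)" and q: "q \<in> points"
  shows "kernel (s, n, k, c \<odot>\<^bsub>E s\<^esub> x) q = c * kernel (s, n, k, x) q"
proof -
  obtain s' n' k' x' where q': "q = (s', n', k', x')" by (metis prod_cases4)
  have q: "s' \<in> S" "x' \<in> carrier (E s')" using q q' by auto
  interpret inner_product_space "E (s + ml n')" by (rule fibre_inner[OF add_ml_mem[OF s]])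
  show ?thesis
  proof (cases "k = k' \<and> s' + ml n = s + ml n'")
    case True
    then show ?thesis
      using s x rmul_closed[OF q, of n] by (simp add: q' rmul_smult hinner_smult_left rmul_closed)
  qed (auto simp: q')
qed

text \<open>The orthogonal complement in \<open>E s\<close> of what comes from lower levels.
  Quantifying over all \<open>s'\<close> covers the case that s - (n - n')a is not in
  \<open>S\<close>: for any other \<open>s'\<close> the kernel vanishes anyway. Multiplicity 0
  stands for all, since the kernel only sees whether two multiplicities agree.\<close>

definition innovation :: "'i \<Rightarrow> nat \<Rightarrow> 'a set" where
  "innovation s n = {x \<in> carrier (E s). \<forall>s'\<in>S. \<forall>n'<n. \<forall>y\<in>carrier (E s').
    kernel (s, n, 0, x) (s', n', 0, y) = 0}"

definition innovation_basis :: "'i \<Rightarrow> nat \<Rightarrow> 'a set" where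
  "innovation_basis s n = (SOME B. B \<subseteq> innovation s n \<and> orthonormal (E s) (\<lambda>b. b) B \<and>
    (\<forall>x\<in>innovation s n. (\<forall>b\<in>B. hinner (E s) x b = 0) \<longrightarrow> x = \<zero>\<^bsub>E s\<^esub>))"

lemma innovation_basis:
  assumes s: "s \<in> S"
  shows "innovation_basis s n \<subseteq> innovation s n \<and> orthonormal (E s) (\<lambda>b. b) (innovation_basis s n) \<and>
    (\<forall>x\<in>innovation s n. (\<forall>b\<in>innovation_basis s n. hinner (E s) x b = 0) \<longrightarrow> x = \<zero>\<^bsub>E s\<^esub>)"
proof -
  interpret Es: inner_product_space "E s" by (rule fibre_inner[OF s])
  have "innovation s n \<subseteq> carrier (E s)" by (auto simp: innovation_def)
  moreover have "c \<odot>\<^bsub>E s\<^esub> x \<in> innovation s n" if "x \<in> innovation s n" for c x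
    using that s by (auto simp: innovation_def kernel_smult simp del: kernel.simps)
  ultimately obtain B where "B \<subseteq> innovation s n" "orthonormal (E s) (\<lambda>b. b) B"
    "\<And>x. x \<in> innovation s n \<Longrightarrow> (\<And>b. b \<in> B \<Longrightarrow> hinner (E s) x b = 0) \<Longrightarrow> x = \<zero>\<^bsub>E s\<^esub>"
    using Es.maximal_orthonormal_subset by metis
  then have "\<exists>B. B \<subseteq> innovation s n \<and> orthonormal (E s) (\<lambda>b. b) B \<and>
    (\<forall>x\<in>innovation s n. (\<forall>b\<in>B. hinner (E s) x b = 0) \<longrightarrow> x = \<zero>\<^bsub>E s\<^esub>)"
    by (intro exI[of _ B]) blast
  then show ?thesis unfolding innovation_basis_def by (rule someI_ex)
qed

definition basis_points :: "('i \<times> nat \<times> nat \<times> 'a) set" where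
  "basis_points = (SIGMA s:S. SIGMA n:UNIV. UNIV \<times> innovation_basis s n)"

lemma basis_points_iff [simp]:
  "(s, n, k, b) \<in> basis_points \<longleftrightarrow> s \<in> S \<and> b \<in> innovation_basis s n"
  by (auto simp: basis_points_def)

lemma innovation_basis_closed: "s \<in> S \<Longrightarrow> b \<in> innovation_basis s n \<Longrightarrow> b \<in> carrier (E s)"
  using innovation_basis[of s n] by (auto simp: innovation_def)

lemma basis_points_subset: "basis_points \<subseteq> points"
  by (auto simp: innovation_basis_closed)

lemma kernel_basis_lower:
  assumes "s \<in> S" "b \<in> innovation_basis s n" "s' \<in> S" "n' < n" "y \<in> carrier (E s')"
  shows "kernel (s, n, k, b) (s', n', k', y) = 0" and "kernel (s', n', k', y) (s, n, k, b) = 0"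
proof -
  have b: "b \<in> innovation s n" using innovation_basis[OF assms(1)] assms(2) by auto
  have 0: "kernel (s, n, 0, b) (s', n', 0, y) = 0"
    using b assms(3-5) unfolding innovation_def by blast
  show 1: "kernel (s, n, k, b) (s', n', k', y) = 0"
  proof (cases "k = k'")
    case True
    then show ?thesis using 0 by simp
  qed simp
  show "kernel (s', n', k', y) (s, n, k, b) = 0"
    using kernel_commute[of "(s, n, k, b)" "(s', n', k', y)"] 1 assms innovation_basis_closed
    by (simp del: kernel.simps)
qed

lemma kernel_basis:
  assumes "p \<in> basis_points" "q \<in> basis_points"
  shows "kernel p q = (if p = q then 1 else 0)"
proof -
  obtain s n k x s' n' k' x' where pq: "p = (s, n, k, x)" "q = (s', n', k', x')"
    by (metis prod_cases4)
  have *: "s \<in> S" "x \<in> innovation_basis s n" "s' \<in> S" "x' \<in> innovation_basis s' n'"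
    using assms pq by auto
  note c = innovation_basis_closed[OF *(1,2)] innovation_basis_closed[OF *(3,4)]
  consider "n < n'" | "n' < n" | "n = n'" by linarith
  then show ?thesis
  proof cases
    case 1
    then show ?thesis using kernel_basis_lower(2)[OF *(3,4,1) _ c(1)] pq by simp
  next
    case 2
    then show ?thesis using kernel_basis_lower(1)[OF *(1,2,3) _ c(2)] pq by simp
  next
    case 3
    show ?thesis
    proof (cases "s = s' \<and> k = k'")
      case True
      have on: "orthonormal (E s) (\<lambda>b. b) (innovation_basis s n)"
        using innovation_basis[OF *(1)] by blast
      have "kernel p q = hinner (E s) x x'"
        unfolding pq using True 3 c *(1) kernel_same_level by auto
      also have "\<dots> = (if x = x' then 1 else 0)"
        using on * True 3 by (auto simp: orthonormal_def)
      finally show ?thesis using True 3 pq by simp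
    qed (use 3 pq in auto)
  qed
qed

text \<open>Strong induction on the level. Let z be the image of \<open>x\<close> under the adjoint
  of a lift from a lower level m. Against basis points of level at most m, z has the same kernel
  values as \<open>x\<close>; against higher ones it has none. So z = 0 by induction,
  \<open>x\<close> is an innovation vector, and orthogonality to \<open>innovation_basis\<close>
  makes it zero.\<close>

lemma basis_points_total:
  assumes "s \<in> S" "x \<in> carrier (E s)" "\<And>j. j \<in> basis_points \<Longrightarrow> kernel (s, n, k, x) j = 0"
  shows "x = \<zero>\<^bsub>E s\<^esub>"
  using assms
proof (induction n arbitrary: s x rule: less_induct)
  case (less n)
  note s = less.prems(1) and x = less.prems(2)
  interpret Es: hilbert_space "E s" by (rule fibre_hilbert[OF s])
  have "kernel (s, n, 0, x) (t, m, 0, y) = 0" if t: "t \<in> S" and m: "m < n" and y: "y \<in> carrier (E t)" for t m y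
  proof (cases "s + ml m = t + ml n")
    case eq: True
    interpret Et: hilbert_space "E t" by (rule fibre_hilbert[OF t])
    define l where "l = n - m"
    have st: "s = t + ml l" unfolding l_def by (rule lower_level[OF eq]) (use m in simp)
    have rc: "rmul t w l \<in> carrier (E s)" if "w \<in> carrier (E t)" for w
      using rmul_closed[OF t that] st by simp
    have bf: "bounded_functional (E t) (\<lambda>w. hinner (E s) (rmul t w l) x)"
      unfolding bounded_functional_def
    proof (intro conjI ballI allI exI)
      fix w assume w: "w \<in> carrier (E t)"
      show "hinner (E s) (rmul t (w \<oplus>\<^bsub>E t\<^esub> w') l) x = hinner (E s) (rmul t w l) x + hinner (E s) (rmul t w' l) x"
        if "w' \<in> carrier (E t)" for w'
        using rmul_add[OF t w that, of l] rc[OF w] rc[OF that] x by (simp add: Es.hinner_add_left flip: st)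
      show "hinner (E s) (rmul t (c \<odot>\<^bsub>E t\<^esub> w) l) x = c * hinner (E s) (rmul t w l) x" for c
        using rmul_smult[OF t w, of c l] rc[OF w] x by (simp add: Es.hinner_smult_left flip: st)
      have "hnorm (E s) (rmul t w l) = hnorm (E t) w"
        using rmul_hinner[OF t w w, of l] by (simp add: hnorm_def flip: st)
      then show "cmod (hinner (E s) (rmul t w l) x) \<le> hnorm (E s) x * hnorm (E t) w"
        using Es.Cauchy_Schwarz[OF rc[OF w] x] by (simp add: mult.commute)
    qed
    \<comment> \<open>\<open>z\<close> is the adjoint of the lift applied to \<open>x\<close>,
      obtained by Riesz representation in \<open>E t\<close>.\<close>
    obtain z where z: "z \<in> carrier (E t)"
      and zr: "\<And>w. w \<in> carrier (E t) \<Longrightarrow> hinner (E s) (rmul t w l) x = hinner (E t) w z"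
      using Et.Riesz_representation[OF bf] by blast
    have zr': "hinner (E s) x (rmul t w l) = hinner (E t) z w" if w: "w \<in> carrier (E t)" for w
      using zr[OF w] Es.hinner_commute[OF rc[OF w] x] Et.hinner_commute[OF w z] by simp
    have "z = \<zero>\<^bsub>E t\<^esub>"
    proof (rule less.IH[OF m t z])
      fix j assume j: "j \<in> basis_points"
      obtain r i k' b where jd: "j = (r, i, k', b)" by (metis prod_cases4)
      have r: "r \<in> S" and b: "b \<in> innovation_basis r i" using j jd by auto
      have bc: "b \<in> carrier (E r)" by (rule innovation_basis_closed[OF r b])
      show "kernel (t, m, k, z) j = 0"
      proof (cases "i \<le> m")
        case False
        then show ?thesis using kernel_basis_lower(2)[OF r b t _ z] jd by simp
      next
        case im: True
        show ?thesis
        proof (cases "k = k' \<and> t + ml i = r + ml m")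
          case True
          then have k': "k' = k" and tr: "t + ml i = r + ml m" by auto
          have sr: "s + ml i = r + ml n"
            using st tr m ml_add[of m l] by (simp add: l_def algebra_simps)
          have tw: "t = r + ml (m - i)" by (rule lower_level[OF tr im])
          have wc: "rmul r b (m - i) \<in> carrier (E t)" using rmul_closed[OF r bc] tw by simp
          have "kernel (t, m, k, z) j = hinner (E t) z (rmul r b (m - i))"
            unfolding jd k' by (rule kernel_lower_level[OF t r z bc tr im])
          also have "\<dots> = hinner (E s) x (rmul t (rmul r b (m - i)) l)"
            using zr'[OF wc] by simp
          \<comment> \<open>The lift of \<open>b\<close> from level \<open>i\<close> to
            \<open>n\<close> passes through level \<open>m\<close>, so \<open>z\<close> inherits the
            vanishing from \<open>x\<close>.\<close>
          also have "rmul t (rmul r b (m - i)) l = rmul r b (n - i)"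
            using rmul_rmul[of r "m - i" b l] tw im m by (simp add: l_def)
          also have "hinner (E s) x (rmul r b (n - i)) = kernel (s, n, k, x) j"
            unfolding jd k' by (rule kernel_lower_level[OF s r x bc sr, symmetric]) (use im m in simp)
          also have "\<dots> = 0" by (rule less.prems(3)[OF j])
          finally show ?thesis .
        qed (use jd in auto)
      qed
    qed
    then have "hinner (E s) x (rmul t y l) = 0"
      using zr'[OF y] Et.hinner_zero_left[OF y] by simp
    then show ?thesis
      using kernel_lower_level[OF s t x y eq, of 0] m by (simp add: l_def del: kernel.simps)
  qed simp
  then have xW: "x \<in> innovation s n" using x unfolding innovation_def by blast
  have "hinner (E s) x b = 0" if b: "b \<in> innovation_basis s n" for b
    using less.prems(3)[of "(s, n, k, b)"] s b
      kernel_same_level[OF s x innovation_basis_closed[OF s b], of n k] by (simp del: kernel.simps)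
  then show ?case using innovation_basis[OF s] xW by blast
qed

text \<open>The basis points of level at most \<open>n\<close> over the same t and with the same
  multiplicity, lifted into \<open>E s\<close>, form an orthonormal basis of \<open>E s\<close>.
  Points of higher level are orthogonal to level \<open>n\<close> by construction, and all others
  have kernel 0.\<close>

lemma kernel_Parseval_same_level:
  assumes s: "s \<in> S" and x: "x \<in> carrier (E s)" and y: "y \<in> carrier (E s)"
  shows "((\<lambda>j. kernel (s, n, k, x) j * cnj (kernel (s, n, k, y) j)) has_sum hinner (E s) x y) basis_points"
proof -
  interpret Es: hilbert_space "E s" by (rule fibre_hilbert[OF s])
  define I where "I = {(t, m, k', b) \<in> basis_points. k' = k \<and> m \<le> n \<and> s + ml m = t + ml n}"
  define e where "e = (\<lambda>(t, m, k' :: nat, b). rmul t b (n - m))"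
  have IJ: "I \<subseteq> basis_points" by (auto simp: I_def)
  have Id: "\<exists>t m b. j = (t, m, k, b) \<and> t \<in> S \<and> b \<in> carrier (E t) \<and> m \<le> n \<and> s + ml m = t + ml n \<and>
      e j = rmul t b (n - m) \<and> e j \<in> carrier (E s) \<and> s = t + ml (n - m)" if j: "j \<in> I" for j
  proof -
    obtain t m k' b where jd: "j = (t, m, k', b)" by (metis prod_cases4)
    then have *: "k' = k" "m \<le> n" "s + ml m = t + ml n" "t \<in> S" "b \<in> carrier (E t)"
      using j innovation_basis_closed by (auto simp: I_def)
    have "s = t + ml (n - m)" by (rule lower_level[OF *(3,2)])
    then show ?thesis
      using * rmul_closed[OF *(4,5), of "n - m"] by (auto simp: jd e_def)
  qed
  have ke: "kernel (s, n, k, z) j = hinner (E s) z (e j)" if j: "j \<in> I" and z: "z \<in> carrier (E s)" for j z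
  proof -
    obtain t m b where "j = (t, m, k, b)" "t \<in> S" "b \<in> carrier (E t)" "m \<le> n"
      "s + ml m = t + ml n" "e j = rmul t b (n - m)"
      using Id[OF j] by blast
    then show ?thesis using kernel_lower_level[OF s _ z, of t b m n k] by (simp del: kernel.simps)
  qed
  have k0: "kernel (s, n, k, z) j = 0" if j: "j \<in> basis_points - I" and z: "z \<in> carrier (E s)" for j z
  proof -
    obtain t m k' b where jd: "j = (t, m, k', b)" by (metis prod_cases4)
    show ?thesis
    proof (cases "m \<le> n")
      case False
      then show ?thesis using kernel_basis_lower(2)[of t b m s n z] j s z jd by auto
    next
      case True
      then show ?thesis using j jd by (auto simp: I_def)
    qed
  qed
  have "orthonormal (E s) e I"
    unfolding orthonormal_def
  proof (intro conjI ballI)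
    show "e \<in> I \<rightarrow> carrier (E s)" using Id by blast
    fix i j assume i: "i \<in> I" and j: "j \<in> I"
    obtain t m b where id: "i = (t, m, k, b)" "t \<in> S" "b \<in> carrier (E t)" "m \<le> n"
      "e i = rmul t b (n - m)" "e i \<in> carrier (E s)" "s = t + ml (n - m)"
      using Id[OF i] by blast
    have "hinner (E s) (e i) (e j) = kernel (s, n, k, e i) j" by (rule ke[OF j id(6), symmetric])
    also have "\<dots> = kernel i j"
      using kernel_lift[OF id(2,3), of j "n - m" m k] j IJ basis_points_subset id by auto
    finally show "hinner (E s) (e i) (e j) = (if i = j then 1 else 0)"
      using kernel_basis[OF subsetD[OF IJ i] subsetD[OF IJ j]] by simp
  qed
  moreover have "total_in (E s) (e ` I)"
    unfolding total_in_def
  proof (intro conjI ballI impI)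
    show "e ` I \<subseteq> carrier (E s)" using Id by blast
    fix z assume z: "z \<in> carrier (E s)" and orth: "\<forall>v\<in>e ` I. hinner (E s) z v = 0"
    have "kernel (s, n, k, z) j = 0" if "j \<in> basis_points" for j
      using ke[OF _ z, of j] k0[OF _ z, of j] orth that by (cases "j \<in> I") auto
    then show "z = \<zero>\<^bsub>E s\<^esub>" using basis_points_total[OF s z] by blast
  qed
  ultimately have "onb_family (E s) e I" by (simp add: onb_family_def)
  then have "((\<lambda>j. hinner (E s) x (e j) * cnj (hinner (E s) y (e j))) has_sum hinner (E s) x y) I"
    by (rule Es.Parseval[OF _ x y])
  then show ?thesis
    by (subst has_sum_cong_neutral[where S = basis_points and T = I]) (use ke k0 x y IJ in auto)
qed

text \<open>If both vectors lie over the same t with the same multiplicity, they are raised to level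
  \<open>n + n'\<close>, where the previous lemma applies inside one fibre.\<close>

lemma kernel_Parseval:
  assumes "p \<in> points" "q \<in> points"
  shows "((\<lambda>j. kernel p j * cnj (kernel q j)) has_sum kernel p q) basis_points"
proof -
  obtain s n k x s' n' k' x' where pq: "p = (s, n, k, x)" "q = (s', n', k', x')"
    by (metis prod_cases4)
  have *: "s \<in> S" "x \<in> carrier (E s)" "s' \<in> S" "x' \<in> carrier (E s')" using assms pq by auto
  show ?thesis
  proof (cases "k = k' \<and> s + ml n' = s' + ml n")
    case True
    have c: "rmul s x n' \<in> carrier (E (s + ml n'))" "rmul s' x' n \<in> carrier (E (s + ml n'))"
      using rmul_closed[OF *(1,2), of n'] rmul_closed[OF *(3,4), of n] True[THEN conjunct2, symmetric]
      by simp_all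
    have l: "kernel (s + ml n', n + n', k, rmul s x n') j = kernel p j"
      "kernel (s + ml n', n + n', k, rmul s' x' n) j = kernel q j" if "j \<in> basis_points" for j
      using that kernel_lift[OF *(1,2), of j n' n k] kernel_lift[OF *(3,4), of j n n' k] True
        basis_points_subset pq by (auto simp: add.commute)
    have kpq: "kernel p q = hinner (E (s + ml n')) (rmul s x n') (rmul s' x' n)"
      using True pq by simp
    have "((\<lambda>j. kernel p j * cnj (kernel q j)) has_sum
        hinner (E (s + ml n')) (rmul s x n') (rmul s' x' n)) basis_points"
      using kernel_Parseval_same_level[OF add_ml_mem[OF *(1)] c, of "n + n'" k]
      by (simp add: l cong: has_sum_cong)
    then show ?thesis by (simp only: kpq)
  next
    case False
    \<comment> \<open>A basis point related to both \<open>p\<close> and \<open>q\<close> would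
      force them to be related to each other.\<close>
    have 0: "kernel p j * cnj (kernel q j) = 0" for j
    proof -
      obtain t m i b where jd: "j = (t, m, i, b)" by (metis prod_cases4)
      have "s + ml n' = s' + ml n" if "s + ml m = t + ml n" "s' + ml m = t + ml n'"
      proof -
        have "(s + ml n') + ml m = (s + ml m) + ml n'" by (simp add: ac_simps)
        also have "\<dots> = (s' + ml m) + ml n" unfolding that by (simp add: ac_simps)
        also have "\<dots> = (s' + ml n) + ml m" by (simp add: ac_simps)
        finally show ?thesis by simp
      qed
      then show ?thesis using False by (auto simp: pq jd)
    qed
    have "kernel p q = 0" using False pq by auto
    then show ?thesis using has_sum_0[OF 0] by simp
  qed
qed

section \<open>Coordinates of the limit vectors in the sequence space\<close>

lemma countable_basis_points: "countable basis_points"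
  unfolding basis_points_def
proof (intro countable_SIGMA countable_index)
  fix s n assume s: "s \<in> S"
  interpret Es: inner_product_space "E s" by (rule fibre_inner[OF s])
  show "countable (innovation_basis s n)"
    using Es.orthonormal_countable[OF fibre_separable[OF s]] innovation_basis[OF s] by blast
qed auto

text \<open>At level 0 every vector is an innovation, so a basis vector of \<open>E 0\<close>,
  repeated with every multiplicity, already gives infinitely many points.\<close>

lemma infinite_basis_points: "infinite basis_points"
proof -
  interpret E0: inner_product_space "E 0" by (rule fibre_inner[OF zero_mem])
  have "innovation 0 0 = carrier (E 0)" by (auto simp: innovation_def)
  then have "innovation_basis 0 0 \<noteq> {}"
    using innovation_basis[OF zero_mem, of 0] fibre_nonzero[OF zero_mem] E0.M.zero_closed by blast
  then obtain b where b: "b \<in> innovation_basis 0 0" by blast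
  have "inj (\<lambda>k::nat. (0::'i, 0::nat, k, b))" by (auto intro: injI)
  then have "infinite (range (\<lambda>k::nat. (0::'i, 0::nat, k, b)))" by (rule range_inj_infinite)
  moreover have "range (\<lambda>k::nat. (0::'i, 0::nat, k, b)) \<subseteq> basis_points"
    using b zero_mem by auto
  ultimately show ?thesis using finite_subset by blast
qed

text \<open>A Kolmogorov decomposition of \<open>kernel\<close>: by \<open>kernel_Parseval\<close>,
  listing the kernel values along the basis points turns the kernel into the inner product of
  \<open>ell2\<close>.\<close>

definition coords :: "'i \<times> nat \<times> nat \<times> 'a \<Rightarrow> nat \<Rightarrow> complex" where
  "coords p i = kernel p (from_nat_into basis_points i)"

lemma basis_points_enumeration: "bij_betw (from_nat_into basis_points) UNIV basis_points"
  by (rule bij_betw_from_nat_into[OF countable_basis_points infinite_basis_points])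

lemma enumeration_points: "from_nat_into basis_points i \<in> points"
  using bij_betwE[OF basis_points_enumeration] basis_points_subset by blast

lemma coords_closed:
  assumes p: "p \<in> points"
  shows "coords p \<in> carrier ell2"
proof -
  have "((\<lambda>i. coords p i * cnj (coords p i)) has_sum kernel p p) UNIV"
    unfolding coords_def
    using kernel_Parseval[OF p p]
    by (subst has_sum_reindex_bij_betw[OF basis_points_enumeration,
          where f = "\<lambda>j. kernel p j * cnj (kernel p j)"])
  then have "((\<lambda>i. Re (coords p i * cnj (coords p i))) has_sum Re (kernel p p)) UNIV"
    by (rule has_sum_Re)
  then show ?thesis
    by (auto simp: has_sum_imp_summable simp flip: complex_norm_square simp del: of_real_power)
qed

lemma coords_hinner:
  assumes p: "p \<in> points" and q: "q \<in> points"
  shows "hinner ell2 (coords p) (coords q) = kernel p q"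
proof -
  have "((\<lambda>i. coords p i * cnj (coords q i)) has_sum kernel p q) UNIV"
    unfolding coords_def
    using kernel_Parseval[OF p q]
    by (subst has_sum_reindex_bij_betw[OF basis_points_enumeration,
          where f = "\<lambda>j. kernel p j * cnj (kernel q j)"])
  then show ?thesis by (simp add: hinner_ell2 infsumI)
qed

text \<open>Hence the image of \<open>coords\<close> is total: \<open>ell2\<close> is the completed
  direct sum of the limits, with nothing left over.\<close>

lemma coords_basis_point: "coords (from_nat_into basis_points i) = ell2_unit i"
proof
  fix n
  have "from_nat_into basis_points i = from_nat_into basis_points n \<longleftrightarrow> n = i"
    using bij_betw_imp_inj_on[OF basis_points_enumeration] by (auto simp: inj_eq)
  then show "coords (from_nat_into basis_points i) n = ell2_unit i n"
    using bij_betwE[OF basis_points_enumeration]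
    by (simp add: coords_def kernel_basis ell2_unit_def)
qed

lemma coords_basis: "onb_family ell2 coords basis_points"
proof -
  have "orthonormal ell2 coords basis_points"
    unfolding orthonormal_def
    using basis_points_subset
    by (auto simp: coords_hinner kernel_basis subsetD simp del: ell2_simps intro!: coords_closed)
  moreover have "total_in ell2 (coords ` basis_points)"
  proof -
    have "coords ` basis_points = range ell2_unit"
      using bij_betw_imp_surj_on[OF basis_points_enumeration] coords_basis_point
      by (metis (no_types, lifting) image_cong image_image)
    then show ?thesis using ell2_unit_basis by (simp add: onb_family_def)
  qed
  ultimately show ?thesis by (simp add: onb_family_def)
qed

lemma coords_total: "total_in ell2 (coords ` basis_points)"
  using coords_basis by (simp add: onb_family_def)

lemma coords_lift:
  assumes "s \<in> S" "x \<in> carrier (E s)"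
  shows "coords (s + ml l, n + l, k, rmul s x l) = coords (s, n, k, x)"
  by (simp add: fun_eq_iff coords_def kernel_lift[OF assms enumeration_points] del: kernel.simps)

section \<open>The essential representation by left multiplication\<close>

fun act :: "'i \<Rightarrow> 'a \<Rightarrow> 'i \<times> nat \<times> nat \<times> 'a \<Rightarrow> 'i \<times> nat \<times> nat \<times> 'a" where
  "act r y (s, n, k, x) = (r + s, n, k, \<mu> r s y x)"

lemma act_closed: "r \<in> S \<Longrightarrow> y \<in> carrier (E r) \<Longrightarrow> p \<in> points \<Longrightarrow> act r y p \<in> points"
  by (cases p) (auto simp: add_closed mult_closed)

text \<open>\<open>act\<close> keeps the level and shifts t to r + t for both vectors, so the index
  condition is unchanged. By \<open>mult_rmul\<close> the left factors move outside the lifts, and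
  \<open>mult_hinner\<close> splits them off.\<close>

lemma kernel_act:
  assumes r: "r \<in> S" and y: "y \<in> carrier (E r)" "y' \<in> carrier (E r)"
    and "p \<in> points" "q \<in> points"
  shows "kernel (act r y p) (act r y' q) = hinner (E r) y y' * kernel p q"
proof -
  obtain s n k x s' n' k' x' where pq: "p = (s, n, k, x)" "q = (s', n', k', x')"
    by (metis prod_cases4)
  have *: "s \<in> S" "x \<in> carrier (E s)" "s' \<in> S" "x' \<in> carrier (E s')" using assms pq by auto
  show ?thesis
  proof (cases "k = k' \<and> s' + ml n = s + ml n'")
    case True
    have c: "rmul s' x' n \<in> carrier (E (s + ml n'))"
      using rmul_closed[OF *(3,4), of n] True by simp
    have "r + s' + ml n = r + s + ml n'" using True by (simp add: add.assoc)
    then have "kernel (act r y p) (act r y' q) =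
        hinner (E (r + s + ml n')) (rmul (r + s) (\<mu> r s y x) n') (rmul (r + s') (\<mu> r s' y' x') n)"
      using True by (simp add: pq)
    also have "\<dots> = hinner (E (r + (s + ml n'))) (\<mu> r (s + ml n') y (rmul s x n'))
        (\<mu> r (s + ml n') y' (rmul s' x' n))"
      using mult_rmul[OF r *(1) y(1) *(2), of n'] mult_rmul[OF r *(3) y(2) *(4), of n] True
      by (simp add: add.assoc)
    also have "\<dots> = hinner (E r) y y' * hinner (E (s + ml n')) (rmul s x n') (rmul s' x' n)"
      by (rule mult_hinner[OF r add_ml_mem[OF *(1)] y rmul_closed[OF *(1,2)] c])
    finally show ?thesis using True by (simp add: pq)
  next
    case False
    then show ?thesis by (auto simp: pq add.assoc)
  qed
qed

definition rep :: "'i \<Rightarrow> 'a \<Rightarrow> (nat \<Rightarrow> complex) \<Rightarrow> nat \<Rightarrow> complex" where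
  "rep r y = (SOME T. T \<in> bop ell2 \<and>
    (\<forall>p\<in>points. T (coords p) = coords (act r y p)))"

lemma rep:
  assumes r: "r \<in> S" and y: "y \<in> carrier (E r)"
  shows "rep r y \<in> bop ell2 \<and>
    (\<forall>p\<in>points. rep r y (coords p) = coords (act r y p))"
proof -
  interpret Er: inner_product_space "E r" by (rule fibre_inner[OF r])
  have "hinner ell2 (coords (act r y p)) (coords (act r y q)) =
      of_real ((hnorm (E r) y)\<^sup>2) * hinner ell2 (coords p) (coords q)"
    if "p \<in> points" "q \<in> points" for p q
    using that r y by (simp add: coords_hinner act_closed kernel_act Er.hinner_self)
  then obtain T where "T \<in> bop ell2" "\<And>p. p \<in> points \<Longrightarrow> T (coords p) = coords (act r y p)"
    using ell2.isometry_extension[of points coords "\<lambda>p. coords (act r y p)" "(hnorm (E r) y)\<^sup>2" basis_points]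
      coords_closed act_closed[OF r y] basis_points_subset coords_basis
    by (metis zero_le_power2)
  then have "\<exists>T. T \<in> bop ell2 \<and> (\<forall>p\<in>points. T (coords p) = coords (act r y p))" by blast
  then show ?thesis unfolding rep_def by (rule someI_ex)
qed

text \<open>Essentiality, the step that needs \<open>absorbing\<close>: after enough lifts, every
  basis point lies in a fibre where products with left factor in \<open>E r\<close> are
  total.\<close>

lemma rep_total:
  assumes r: "r \<in> S"
  shows "total_in ell2 {rep r y h | y h. y \<in> carrier (E r) \<and> h \<in> carrier ell2}"
  unfolding total_in_def
proof (intro conjI ballI impI)
  show "{rep r y h | y h. y \<in> carrier (E r) \<and> h \<in> carrier ell2} \<subseteq> carrier ell2"
    using rep[OF r] ell2.bop_closed by blast
  fix v assume v: "v \<in> carrier ell2"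
    and orth: "\<forall>w\<in>{rep r y h | y h. y \<in> carrier (E r) \<and> h \<in> carrier ell2}. hinner ell2 v w = 0"
  have "hinner ell2 v (coords p) = 0" if p: "p \<in> basis_points" for p
  proof -
    obtain s n k x where pd: "p = (s, n, k, x)" by (metis prod_cases4)
    have "p \<in> points" using p basis_points_subset by blast
    then have s: "s \<in> S" and x: "x \<in> carrier (E s)" using pd by auto
    obtain N where N: "ml N - r \<in> S" using absorbing[OF r] unfolding ml_def by blast
    \<comment> \<open>The right factor left over in s + Na once r is split off; it belongs to
      \<open>S\<close> by the choice of \<open>N\<close>.\<close>
    define t where "t = ml N - r + s"
    have t: "t \<in> S" unfolding t_def by (rule add_closed[OF N s])
    have rt: "r + t = s + ml N" by (simp add: t_def algebra_simps)
    have rtS: "r + t \<in> S" by (rule add_closed[OF r t])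
    interpret Et: hilbert_space "E (r + t)" by (rule fibre_hilbert[OF rtS])
    define f where "f z = hinner ell2 (coords (r + t, n + N, k, z)) v" for z
    have pt: "(r + t, n + N, k, z) \<in> points" if "z \<in> carrier (E (r + t))" for z
      using that rtS by simp
    have lin: "coords (r + t, n + N, k, z \<oplus>\<^bsub>E (r + t)\<^esub> w) =
        coords (r + t, n + N, k, z) \<oplus>\<^bsub>ell2\<^esub> coords (r + t, n + N, k, w)"
      if "z \<in> carrier (E (r + t))" "w \<in> carrier (E (r + t))" for z w
      by (simp add: fun_eq_iff coords_def kernel_add[OF rtS that enumeration_points] del: kernel.simps)
    have lin': "coords (r + t, n + N, k, c \<odot>\<^bsub>E (r + t)\<^esub> z) =
        c \<odot>\<^bsub>ell2\<^esub> coords (r + t, n + N, k, z)"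
      if "z \<in> carrier (E (r + t))" for c z
      by (simp add: fun_eq_iff coords_def kernel_smult[OF rtS that enumeration_points] del: kernel.simps)
    have f: "bounded_functional (E (r + t)) f"
      unfolding bounded_functional_def
    proof (intro conjI ballI allI exI)
      fix z assume z: "z \<in> carrier (E (r + t))"
      show "f (z \<oplus>\<^bsub>E (r + t)\<^esub> w) = f z + f w" if w: "w \<in> carrier (E (r + t))" for w
        unfolding f_def lin[OF z w]
        by (rule ell2.hinner_add_left[OF coords_closed[OF pt[OF z]] coords_closed[OF pt[OF w]] v])
      show "f (c \<odot>\<^bsub>E (r + t)\<^esub> z) = c * f z" for c
        unfolding f_def lin'[OF z]
        by (rule ell2.hinner_smult_left[OF coords_closed[OF pt[OF z]] v])
      have "hnorm ell2 (coords (r + t, n + N, k, z)) = hnorm (E (r + t)) z"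
        unfolding hnorm_def coords_hinner[OF pt[OF z] pt[OF z]] kernel_same_level[OF rtS z z] ..
      then show "cmod (f z) \<le> hnorm ell2 v * hnorm (E (r + t)) z"
        using ell2.Cauchy_Schwarz[OF coords_closed[OF pt[OF z]] v] by (simp add: f_def mult.commute)
    qed
    \<comment> \<open>\<open>f\<close> vanishes on the products from \<open>E r\<close> and
      \<open>E t\<close>, whose coordinates lie in the range of \<open>rep r y\<close>; these
      products are total in \<open>E (r + t)\<close>.\<close>
    have "f (rmul s x N) = 0"
    proof (rule Et.functional_vanish[OF mult_total[OF r t] f])
      fix w assume "w \<in> {\<mu> r t y z | y z. y \<in> carrier (E r) \<and> z \<in> carrier (E t)}"
      then obtain y z where w: "w = \<mu> r t y z" and y: "y \<in> carrier (E r)" and z: "z \<in> carrier (E t)"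
        by blast
      have q: "(t, n + N, k, z) \<in> points" using t z by simp
      have w': "coords (r + t, n + N, k, w) = rep r y (coords (t, n + N, k, z))"
        using rep[OF r y] q w by auto
      have "hinner ell2 v (rep r y (coords (t, n + N, k, z))) = 0"
        using orth y coords_closed[OF q] by blast
      moreover have "coords (r + t, n + N, k, w) \<in> carrier ell2"
        by (rule coords_closed[OF pt]) (use w mult_closed[OF r t y z] in simp)
      ultimately show "f w = 0"
        using ell2.hinner_commute[OF v, of "coords (r + t, n + N, k, w)"] unfolding f_def w' by simp
    qed (use rmul_closed[OF s x, of N] rt in simp)
    moreover have "coords (r + t, n + N, k, rmul s x N) = coords p"
      using coords_lift[OF s x, of N n k] by (simp only: rt pd)
    ultimately have "hinner ell2 (coords p) v = 0" by (simp add: f_def)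
    then show ?thesis
      using ell2.hinner_commute[OF coords_closed v, of p] p basis_points_subset by auto
  qed
  then show "v = \<zero>\<^bsub>ell2\<^esub>"
    using coords_total v unfolding total_in_def by blast
qed

lemma limit_representation:
  "product_system_representation S E \<mu> ell2 rep"
proof (intro product_system_representation.intro product_system_representation_axioms.intro
    semigroup_product_system_axioms hilbert_space_ell2 rep_total)
  have bop: "rep s x \<in> bop ell2" if "s \<in> S" "x \<in> carrier (E s)" for s x
    using rep[OF that] by blast
  then show "rep s x \<in> bop ell2" if "s \<in> S" "x \<in> carrier (E s)" for s x
    using that .
  have rc: "rep s x (coords p) = coords (act s x p)"
    if "s \<in> S" "x \<in> carrier (E s)" "p \<in> basis_points" for s x p
    using rep[OF that(1,2)] that(3) basis_points_subset by blast
  have rc': "rep s x (coords p) = coords (act s x p)"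
    if "s \<in> S" "x \<in> carrier (E s)" "p \<in> points" for s x p
    using rep[OF that(1,2)] that(3) by blast
  have bp: "p \<in> points" "coords p \<in> carrier ell2" if "p \<in> basis_points" for p
    using that basis_points_subset coords_closed by blast+
  fix s x y h k assume s: "s \<in> S" and x: "x \<in> carrier (E s)"
  show "rep (s + t) (\<mu> s t x z) = compose (carrier ell2) (rep s x) (rep t z)"
    if t: "t \<in> S" and z: "z \<in> carrier (E t)" for t z
  proof (rule ell2.bop_eq_on_total[OF coords_total])
    show "rep (s + t) (\<mu> s t x z) \<in> bop ell2"
      by (rule bop[OF add_closed[OF s t] mult_closed[OF s t x z]])
    show "compose (carrier ell2) (rep s x) (rep t z) \<in> bop ell2"
      by (rule ell2.compose_bop[OF bop[OF s x] bop[OF t z]])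
    fix v assume "v \<in> coords ` basis_points"
    then obtain p where p: "p \<in> basis_points" and v: "v = coords p" by blast
    obtain s' n k' w where pd: "p = (s', n, k', w)" by (metis prod_cases4)
    have w: "s' \<in> S" "w \<in> carrier (E s')" using bp(1)[OF p] pd by auto
    have "act (s + t) (\<mu> s t x z) p = act s x (act t z p)"
      using mult_assoc[OF s t w(1) x z w(2)] by (simp add: pd add.assoc)
    then show "rep (s + t) (\<mu> s t x z) v =
        compose (carrier ell2) (rep s x) (rep t z) v"
      unfolding v compose_eq[OF bp(2)[OF p]]
      using rc[OF add_closed[OF s t] mult_closed[OF s t x z] p] rc[OF t z p]
        rc'[OF s x act_closed[OF t z bp(1)[OF p]]] by simp
  qed
  assume y: "y \<in> carrier (E s)" and h: "h \<in> carrier ell2" and k: "k \<in> carrier ell2"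
  let ?c = "hinner (E s) x y"
  \<comment> \<open>The inner product formula is proved as an operator identity, because equality of
    bounded operators can be tested on coordinate vectors alone; there it is
    \<open>kernel_act\<close>.\<close>
  have "compose (carrier ell2) (op_adj ell2 (rep s y)) (rep s x) =
      op_smult ell2 ?c (op_id ell2)"
  proof (rule ell2.bop_eq_on_total[OF coords_total])
    show "compose (carrier ell2) (op_adj ell2 (rep s y)) (rep s x) \<in> bop ell2"
      by (intro ell2.compose_bop ell2.op_adj_bop bop s x y)
    show "op_smult ell2 ?c (op_id ell2) \<in> bop ell2" by (intro ell2.op_smult_bop ell2.op_id_bop)
    fix v assume "v \<in> coords ` basis_points"
    then obtain p where p: "p \<in> basis_points" and v: "v = coords p" by blast
    note pc = bp(2)[OF p]
    have xv: "rep s x v \<in> carrier ell2" unfolding v by (rule ell2.bop_closed[OF bop[OF s x] pc])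
    have "op_adj ell2 (rep s y) (rep s x v) = ?c \<odot>\<^bsub>ell2\<^esub> v"
    proof (rule ell2.hinner_ext_total[OF coords_total])
      show "op_adj ell2 (rep s y) (rep s x v) \<in> carrier ell2"
        by (rule ell2.bop_closed[OF ell2.op_adj_bop[OF bop[OF s y]] xv])
      show "?c \<odot>\<^bsub>ell2\<^esub> v \<in> carrier ell2"
        unfolding v by (rule ell2.smult_closed[OF ell2.carrier_complex_ring pc])
      fix w assume "w \<in> coords ` basis_points"
      then obtain q where q: "q \<in> basis_points" and w: "w = coords q" by blast
      have "hinner ell2 (op_adj ell2 (rep s y) (rep s x v)) w =
          hinner ell2 (rep s x v) (rep s y w)"
        unfolding w by (rule ell2.op_adj_hinner'[OF bop[OF s y] xv bp(2)[OF q]])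
      also have "\<dots> = kernel (act s x p) (act s y q)"
        unfolding v w rc[OF s x p] rc[OF s y q]
        by (rule coords_hinner[OF act_closed[OF s x bp(1)[OF p]] act_closed[OF s y bp(1)[OF q]]])
      also have "\<dots> = ?c * hinner ell2 v w"
        unfolding v w coords_hinner[OF bp(1)[OF p] bp(1)[OF q]]
        by (rule kernel_act[OF s x y bp(1)[OF p] bp(1)[OF q]])
      also have "\<dots> = hinner ell2 (?c \<odot>\<^bsub>ell2\<^esub> v) w"
        unfolding v w by (rule ell2.hinner_smult_left[OF pc bp(2)[OF q], symmetric])
      finally show "hinner ell2 (op_adj ell2 (rep s y) (rep s x v)) w =
          hinner ell2 (?c \<odot>\<^bsub>ell2\<^esub> v) w" .
    qed
    then show "compose (carrier ell2) (op_adj ell2 (rep s y)) (rep s x) v =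
        op_smult ell2 ?c (op_id ell2) v"
      using pc by (simp only: compose_eq op_apply v)
  qed
  then have eq: "op_adj ell2 (rep s y) (rep s x h) = ?c \<odot>\<^bsub>ell2\<^esub> h"
    using h by (metis compose_eq op_apply(1,3))
  have "hinner ell2 (rep s x h) (rep s y k) =
      hinner ell2 (op_adj ell2 (rep s y) (rep s x h)) k"
    by (rule ell2.op_adj_hinner'[OF bop[OF s y] ell2.bop_closed[OF bop[OF s x] h] k, symmetric])
  also have "\<dots> = ?c * hinner ell2 h k"
    unfolding eq by (rule ell2.hinner_smult_left[OF h k])
  finally show "hinner ell2 (rep s x h) (rep s y k) = ?c * hinner ell2 h k" .
next
  have "ell2_unit 0 \<noteq> \<zero>\<^bsub>ell2\<^esub>" by (auto simp: ell2_unit_def fun_eq_iff)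
  then show "carrier ell2 \<noteq> {\<zero>\<^bsub>ell2\<^esub>}" using ell2_unit_carrier[of 0] by blast
qed

end

section \<open>Finitely generated semigroups: countability and an order unit\<close>

lemma finitely_generated_countable:
  assumes "finitely_generated S"
  shows "countable S"
proof -
  obtain r :: nat and e where S: "S = {\<Sum>i=1..r. int (m i) *s e i | m. True}"
    using assms unfolding finitely_generated_def by auto
  have "S \<subseteq> (\<lambda>l. \<Sum>i=1..r. int (l ! i) *s e i) ` UNIV"
  proof
    fix s assume "s \<in> S"
    then obtain m :: "nat \<Rightarrow> nat" where s: "s = (\<Sum>i=1..r. int (m i) *s e i)" unfolding S by auto
    \<comment> \<open>Generators are numbered from 1, so entry 0 of the list is padding.\<close>
    have "s = (\<Sum>i=1..r. int (map m [0..<Suc r] ! i) *s e i)"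
      unfolding s by (rule sum.cong) (auto simp del: upt_Suc)
    then show "s \<in> (\<lambda>l. \<Sum>i=1..r. int (l ! i) *s e i) ` UNIV" by blast
  qed
  then show ?thesis by (rule countable_subset) simp
qed

text \<open>In terms of the generators, \<open>a\<close> has all coefficients 1, so a multiple of it
  dominates any given coefficients and the difference is again a combination with natural
  coefficients.\<close>

lemma finitely_generated_order_unit:
  fixes S :: "(int^'d) set"
  assumes "finitely_generated S"
  obtains a where "a \<in> S" "\<And>s. s \<in> S \<Longrightarrow> \<exists>n::nat. (\<Sum>i<n. a) - s \<in> S"
proof -
  obtain r :: nat and e where S: "S = {\<Sum>i=1..r. int (m i) *s e i | m. True}"
    using assms unfolding finitely_generated_def by auto
  define a where "a = (\<Sum>i=1..r. e i)"
  show ?thesis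
  proof (rule that[of a])
    show "a \<in> S" unfolding S a_def by (intro CollectI exI[of _ "\<lambda>_. 1"]) (simp add: vector_smult_lid)
    fix s assume "s \<in> S"
    then obtain m :: "nat \<Rightarrow> nat" where s: "s = (\<Sum>i=1..r. int (m i) *s e i)" unfolding S by auto
    \<comment> \<open>A convenient common bound for all \<open>m i\<close>; it makes the
      natural-number differences \<open>n - m i\<close> genuine.\<close>
    define n where "n = (\<Sum>i=1..r. m i)"
    have mn: "m i \<le> n" if "i \<in> {1..r}" for i
      unfolding n_def by (rule member_le_sum) (use that in auto)
    have na: "(\<Sum>i<n. a) = int n *s a" for n
      by (induction n) (simp_all add: vector_sadd_rdistrib vector_smult_lid add.commute del: sum_constant)
    have "(\<Sum>i<n. a) = (\<Sum>i=1..r. int n *s e i)"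
      unfolding na unfolding a_def by (simp add: vec_eq_iff sum_distrib_left)
    then have "(\<Sum>i<n. a) - s = (\<Sum>i=1..r. int n *s e i - int (m i) *s e i)"
      unfolding s by (simp only: sum_subtractf)
    also have "\<dots> = (\<Sum>i=1..r. int (n - m i) *s e i)"
      by (rule sum.cong) (simp_all add: mn of_nat_diff vec_eq_iff algebra_simps)
    finally have "(\<Sum>i<n. a) - s = (\<Sum>i=1..r. int (n - m i) *s e i)" .
    moreover have "(\<Sum>i=1..r. int (n - m i) *s e i) \<in> S"
      unfolding S by (intro CollectI exI[of _ "\<lambda>i. n - m i"]) simp
    ultimately show "\<exists>n::nat. (\<Sum>i<n. a) - s \<in> S" by (intro exI[of _ n]) (simp only:)
  qed
qed

theorem mainTheorem1:
  fixes S :: "(int^'d) set"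
    and E :: "int^'d \<Rightarrow> 'a hilb"
    and \<mu> :: "int^'d \<Rightarrow> int^'d \<Rightarrow> 'a \<Rightarrow> 'a \<Rightarrow> 'a"
  assumes "finitely_generated S"
    and "product_system S E \<mu>"
  shows "\<exists>(H :: (nat \<Rightarrow> complex) hilb) \<alpha>.
    hilbert_space H \<and> separable_hilb H \<and> infinite_dimensional H \<and>
    E0_semigroup S H \<alpha> \<and>
    ps_isomorphic S E \<mu> (assoc_fibre H \<alpha>) (assoc_mult H)"
proof -
  interpret semigroup_product_system S E \<mu>
    using assms finitely_generated_zero finitely_generated_add
    by (intro semigroup_product_system.intro semigroup_product_system_axioms.intro) auto
  obtain a where a: "a \<in> S" "\<And>s. s \<in> S \<Longrightarrow> \<exists>n::nat. (\<Sum>i<n. a) - s \<in> S"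
    using finitely_generated_order_unit[OF assms(1)] by metis
  interpret Ea: hilbert_space "E a" by (rule fibre_hilbert[OF a(1)])
  have on: "orthonormal (E a) (\<lambda>b. b) (some_onb (E a))" and tot: "total_in (E a) (some_onb (E a))"
    using Ea.some_onb by (simp_all add: onb_family_def)
  \<comment> \<open>Since the fibre is non-zero its basis is non-empty, and any member serves as the
    unit vector \<open>u\<close>.\<close>
  have "some_onb (E a) \<noteq> {}"
    using tot fibre_nonzero[OF a(1)] Ea.M.zero_closed by (auto simp: total_in_def)
  then obtain u where "u \<in> some_onb (E a)" by blast
  then have u: "u \<in> carrier (E a)" "hinner (E a) u u = 1"
    using on by (auto simp: orthonormal_def)
  interpret order_unit_product_system S E \<mu> a u
    by unfold_locales (use a u finitely_generated_countable[OF assms(1)] in auto)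
  interpret R: product_system_representation S E \<mu> ell2 rep
    by (rule limit_representation)
  show ?thesis
    using hilbert_space_ell2 separable_ell2 infinite_dimensional_ell2 R.alpha_E0_semigroup
      R.ps_isomorphic_assoc by blast
qed

end
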